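(* Let $n\ge 1$, $n<p<\infty$, $\frac1p+\frac1q=1$, and let $\rho$ be an admissible measure on $\mathbb{R}^n$. The best constant $C_*$ in the generalized Morrey inequality $[u]_\rho\le C_*\|Du\|_p$, $u\in\mathcal{D}^{1,p}(\mathbb{R}^n)$, is given by $$C_*=\frac{\inf\left\{\left(\int_{\mathbb{R}^n}|F(y)|^q\,dy\right)^{1/q}:\ F\in L^q(\mathbb{R}^n;\mathbb{R}^n),\ \mathrm{div}\,F=\rho\text{ in }\mathbb{R}^n\right\}}{\left|\int_{\mathbb{R}^n}y\,d\rho(y)\right|^{1-n/p}}.$$
   Context: $\mathcal{D}^{1,p}(\mathbb{R}^n)$ is the space of $u\in L^1_{\rm loc}(\mathbb{R}^n)$ whose weak partial derivatives $u_{x_i}$, $i=1,\dots,n$, all belong to $L^p(\mathbb{R}^n)$. Since $p>n$, each $u$ is identified with its $(1-n/p)$-Hölder continuous representative. $\|Du\|_p:=\left(\int_{\mathbb{R}^n}|Du|^p\,dx\right)^{1/p}$. An admissible measure is a signed Borel measure $\rho$ on $\mathbb{R}^n$ with compact support, $\rho(\mathbb{R}^n)=0$, and $\int_{\mathbb{R}^n}y\,d\rho(y)\ne 0$. $\mathcal{S}(n)$ is the set of similarity transformations $S(y)=\lambda Oy+z$ of $\mathbb{R}^n$ with $\lambda>0$, $O\in\mathrm{O}(n)$, $z\in\mathbb{R}^n$. The push forward is $(S_\#\rho)(A)=\rho(S^{-1}(A))$ for Borel $A\subset\mathbb{R}^n$. For $u\in\mathcal{D}^{1,p}(\mathbb{R}^n)$,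 $$[u]_\rho:=\sup\left\{\frac{\left|\int u\,d\mu\right|}{\left|\int x\,d\mu(x)\right|^{1-n/p}}:\ \mu=S_\#\rho,\ S\in\mathcal{S}(n)\right\}.$$ $C_*$ is the smallest constant $C$ such that $[u]_\rho\le C\|Du\|_p$ holds for all $u\in\mathcal{D}^{1,p}(\mathbb{R}^n)$. For $F\in L^q(\mathbb{R}^n;\mathbb{R}^n)$, $\mathrm{div}\,F=\rho$ in $\mathbb{R}^n$ means that $-\int_{\mathbb{R}^n}Dv\cdot F\,dy=\int_{\mathbb{R}^n}v\,d\rho$ for all $v\in\mathcal{D}^{1,p}(\mathbb{R}^n)$. *)

theory Defs
  imports "HOL-Analysis.Analysis"
begin

section \<open>Signed Borel measures\<close>

text \<open>
  A signed measure is a real-valued set function; its values outside the Borel sets are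
  irrelevant. Real values suffice here: if \<open>\<rho>\<close> is a signed measure with \<open>\<rho> UNIV\<close> finite,
  then all its values are finite.
\<close>

definition signed_borel_measure :: "('a::topological_space set \<Rightarrow> real) \<Rightarrow> bool" where
  "signed_borel_measure \<rho> \<longleftrightarrow>
     \<rho> {} = 0 \<and>
     (\<forall>A :: nat \<Rightarrow> 'a set. range A \<subseteq> sets borel \<longrightarrow> disjoint_family A \<longrightarrow>
        (\<lambda>i. \<rho> (A i)) sums \<rho> (\<Union>i. A i))"

text \<open>
  The positive part of the Jordan decomposition,
  \<open>\<rho>\<^sup>+(A) = sup {\<rho>(B) | B \<subseteq> A Borel}\<close>; the negative part is the positive part of \<open>-\<rho>\<close>.
  The coercion \<open>ennreal\<close> sends negative numbers to 0, which is harmless since \<open>B = {}\<close>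
  already contributes 0.
\<close>

definition positive_part :: "('a::topological_space set \<Rightarrow> real) \<Rightarrow> 'a measure" where
  "positive_part \<rho> =
     measure_of UNIV (sets borel) (\<lambda>A. SUP B\<in>{B \<in> sets borel. B \<subseteq> A}. ennreal (\<rho> B))"

definition signed_integral ::
  "('a::topological_space set \<Rightarrow> real) \<Rightarrow> ('a \<Rightarrow> 'b::{banach, second_countable_topology}) \<Rightarrow> 'b"
  where
  "signed_integral \<rho> f =
     integral\<^sup>L (positive_part \<rho>) f - integral\<^sup>L (positive_part (\<lambda>A. - \<rho> A)) f"

text \<open>
  A point lies outside the support iff it has an open neighbourhood that is null for the total
  variation, i.e. all of whose Borel subsets have \<open>\<rho>\<close>-measure 0.
\<close>

definition signed_support :: "('a::topological_space set \<Rightarrow> real) \<Rightarrow> 'a set" where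
  "signed_support \<rho> =
     {x. \<forall>U. open U \<longrightarrow> x \<in> U \<longrightarrow> (\<exists>B\<in>sets borel. B \<subseteq> U \<and> \<rho> B \<noteq> 0)}"

definition admissible_measure :: "((real ^ 'n) set \<Rightarrow> real) \<Rightarrow> bool" where
  "admissible_measure \<rho> \<longleftrightarrow>
     signed_borel_measure \<rho> \<and> compact (signed_support \<rho>) \<and> \<rho> UNIV = 0 \<and>
     signed_integral \<rho> (\<lambda>y. y) \<noteq> 0"

definition push_forward :: "('a \<Rightarrow> 'b) \<Rightarrow> ('a set \<Rightarrow> real) \<Rightarrow> 'b set \<Rightarrow> real" where
  "push_forward S \<rho> = (\<lambda>A. \<rho> (S -` A))"

definition similarities :: "(real ^ 'n \<Rightarrow> real ^ 'n) set" where
  "similarities =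
     {S. \<exists>c R z. c > 0 \<and> orthogonal_transformation R \<and> S = (\<lambda>y. c *\<^sub>R R y + z)}"

section \<open>The homogeneous Sobolev space\<close>

text \<open>
  Elements of \<open>L\<^sup>p\<close> are represented by functions, without identifying functions that agree
  almost everywhere.
\<close>

definition Lp_fun :: "real \<Rightarrow> ('a::euclidean_space \<Rightarrow> 'b::euclidean_space) set" where
  "Lp_fun p = {f. f \<in> borel_measurable lebesgue \<and> integrable lebesgue (\<lambda>x. norm (f x) powr p)}"

definition Lp_norm :: "real \<Rightarrow> ('a::euclidean_space \<Rightarrow> 'b::euclidean_space) \<Rightarrow> real" where
  "Lp_norm p f = (\<integral>x. norm (f x) powr p \<partial>lebesgue) powr (1 / p)"

definition L1_loc :: "('a::euclidean_space \<Rightarrow> real) set" where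
  "L1_loc = {f. \<forall>K. compact K \<longrightarrow> set_integrable lebesgue K f}"

definition partial_deriv :: "'n \<Rightarrow> (real ^ 'n \<Rightarrow> real) \<Rightarrow> real ^ 'n \<Rightarrow> real" where
  "partial_deriv i f x = frechet_derivative f (at x) (axis i 1)"

primrec C_diff :: "nat \<Rightarrow> (real ^ 'n \<Rightarrow> real) \<Rightarrow> bool" where
  "C_diff 0 f \<longleftrightarrow> continuous_on UNIV f"
| "C_diff (Suc k) f \<longleftrightarrow>
     (\<forall>x. f differentiable (at x)) \<and> (\<forall>i. C_diff k (partial_deriv i f))"

definition test_functions :: "(real ^ 'n \<Rightarrow> real) set" where
  "test_functions = {\<phi>. (\<forall>k. C_diff k \<phi>) \<and> compact (closure {x. \<phi> x \<noteq> 0})}"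

definition has_weak_partial ::
  "(real ^ 'n \<Rightarrow> real) \<Rightarrow> 'n \<Rightarrow> (real ^ 'n \<Rightarrow> real) \<Rightarrow> bool" where
  "has_weak_partial u i g \<longleftrightarrow>
     g \<in> L1_loc \<and>
     (\<forall>\<phi>\<in>test_functions.
        (\<integral>x. u x * partial_deriv i \<phi> x \<partial>lebesgue) = - (\<integral>x. g x * \<phi> x \<partial>lebesgue))"

text \<open>The weak gradient is determined up to a null set; \<open>weak_grad\<close> picks a representative.\<close>

definition weak_grad :: "(real ^ 'n \<Rightarrow> real) \<Rightarrow> real ^ 'n \<Rightarrow> real ^ 'n" where
  "weak_grad u = (SOME G. \<forall>i. has_weak_partial u i (\<lambda>x. G x $ i))"

definition holder_continuous :: "real \<Rightarrow> ('a::metric_space \<Rightarrow> 'b::metric_space) \<Rightarrow> bool" where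
  "holder_continuous \<alpha> u \<longleftrightarrow> (\<exists>K. \<forall>x y. dist (u x) (u y) \<le> K * dist x y powr \<alpha>)"

text \<open>
  For \<open>p > n\<close>, elements of \<open>D\<^sup>1\<^sup>,\<^sup>p\<close> are identified with their Hoelder continuous
  representatives; accordingly this set consists of these representatives.
\<close>

definition D1p :: "real \<Rightarrow> (real ^ 'n \<Rightarrow> real) set" where
  "D1p p =
     {u. u \<in> L1_loc \<and>
         (\<forall>i. \<exists>g \<in> Lp_fun p. has_weak_partial u i g) \<and>
         holder_continuous (1 - real CARD('n) / p) u}"

section \<open>The generalized Morrey inequality\<close>

definition morrey_seminorm ::
  "real \<Rightarrow> ((real ^ 'n) set \<Rightarrow> real) \<Rightarrow> (real ^ 'n \<Rightarrow> real) \<Rightarrow> ereal" where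
  "morrey_seminorm p \<rho> u =
     (SUP \<mu>\<in>{push_forward S \<rho> | S. S \<in> similarities}.
        ereal (\<bar>signed_integral \<mu> u\<bar> /
               norm (signed_integral \<mu> (\<lambda>x. x)) powr (1 - real CARD('n) / p)))"

definition morrey_inequality :: "real \<Rightarrow> ((real ^ 'n) set \<Rightarrow> real) \<Rightarrow> real \<Rightarrow> bool" where
  "morrey_inequality p \<rho> C \<longleftrightarrow>
     (\<forall>u\<in>D1p p. morrey_seminorm p \<rho> u \<le> ereal (C * Lp_norm p (weak_grad u)))"

definition best_morrey_constant :: "real \<Rightarrow> ((real ^ 'n) set \<Rightarrow> real) \<Rightarrow> real \<Rightarrow> bool" where
  "best_morrey_constant p \<rho> C \<longleftrightarrow>
     morrey_inequality p \<rho> C \<and> (\<forall>C'. morrey_inequality p \<rho> C' \<longrightarrow> C \<le> C')"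

text \<open>The equation \<open>div F = \<rho>\<close>, tested against all of \<open>D\<^sup>1\<^sup>,\<^sup>p\<close>.\<close>

definition has_divergence ::
  "real \<Rightarrow> (real ^ 'n \<Rightarrow> real ^ 'n) \<Rightarrow> ((real ^ 'n) set \<Rightarrow> real) \<Rightarrow> bool" where
  "has_divergence p F \<rho> \<longleftrightarrow>
     (\<forall>v\<in>D1p p. - (\<integral>y. weak_grad v y \<bullet> F y \<partial>lebesgue) = signed_integral \<rho> v)"

end

theory Submission
  imports Defs
begin

text \<open>
  Put \<open>L u = \<integral> u d\<rho>\<close>. Since \<open>\<rho>\<close> has compact support and total mass 0, a local Morrey estimate
  gives \<open>\<bar>L u\<bar> \<le> A \<parallel>Du\<parallel>\<^sub>p\<close>, so \<open>m\<close>, the infimum of \<open>\<integral> \<bar>Du\<bar>\<^sup>p\<close> over \<open>L u = 1\<close>, is positive (if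
  \<open>L = 0\<close>, both sides of the claim vanish). By uniform convexity the gradients of a minimising
  sequence converge in \<open>L\<^sup>p\<close> to some \<open>G\<close>, and the first variation gives
  \<open>\<integral> \<bar>G\<bar>\<^sup>p\<^sup>-\<^sup>2 G \<bullet> Dv = m L v\<close>. Hence \<open>F = - \<bar>G\<bar>\<^sup>p\<^sup>-\<^sup>2 G / m\<close> satisfies \<open>div F = \<rho>\<close>, and its \<open>L\<^sup>q\<close> norm
  \<open>m\<^sup>-\<^sup>1\<^sup>/\<^sup>p\<close> is the best constant in \<open>\<bar>L u\<bar> \<le> a \<parallel>Du\<parallel>\<^sub>p\<close>; by Hoelder's inequality no other
  solution has smaller norm. A similarity of ratio \<open>c\<close> multiplies both \<open>\<parallel>Du\<parallel>\<^sub>p\<close> and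
  \<open>\<bar>\<integral> y d\<rho>\<bar>\<^sup>1\<^sup>-\<^sup>n\<^sup>/\<^sup>p\<close> by \<open>c\<^sup>1\<^sup>-\<^sup>n\<^sup>/\<^sup>p\<close>, so the supremum over similarities does not change the constant.
\<close>

section \<open>Signed Borel measures\<close>

text \<open>The least norm of a solution of \<open>div F = \<rho>\<close> is the norm of the
  functional sending Du to L u on the space of gradients, so the formula asserts a norm-preserving
  representation of this functional by an \<open>L^q\<close> field. The minimiser supplies the field
  explicitly, in place of a Hahn-Banach extension and a description of the dual space. For n = 1 the
  exponent may lie between 1 and 2, where no multiple of the convexity defect dominates norm (a - b)
  powr p; an additional term of size \<epsilon> treats all p > 1 alike. The local estimate compares
  u x with one average of u that is the same for every x: the averages are rescaled about x, start
  from a fixed kernel and concentrate at x. Their rate of change decays like \<sigma> powr (n / p -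
  2), which is integrable at infinity exactly when p > n. Hoelder continuity identifies the limit
  with u x at every point; almost every point would not do, since \<rho> may be singular.\<close>

lemma signed_borel_sums:
  assumes "signed_borel_measure \<rho>" "range A \<subseteq> sets borel" "disjoint_family A"
  shows "(\<lambda>i. \<rho> (A i)) sums \<rho> (\<Union>i. A i)"
  using assms unfolding signed_borel_measure_def by blast

lemma signed_borel_additive:
  assumes \<rho>: "signed_borel_measure \<rho>" and A: "A \<in> sets borel" and B: "B \<in> sets borel"
    and AB: "A \<inter> B = {}"
  shows "\<rho> (A \<union> B) = \<rho> A + \<rho> B"
proof -
  have [simp]: "\<rho> {} = 0" using \<rho> by (simp add: signed_borel_measure_def)
  have "(\<lambda>i. \<rho> (binaryset A B i)) sums \<rho> (\<Union>i. binaryset A B i)"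
    using A B AB by (intro signed_borel_sums[OF \<rho>]) (auto simp: disjoint_family_on_def binaryset_def)
  moreover have "(\<lambda>i. \<rho> (binaryset A B i)) sums (\<rho> A + \<rho> B)"
    using binaryset_sums[of \<rho> A B] by simp
  ultimately show ?thesis
    by (metis UN_binaryset_eq sums_unique2)
qed

lemma signed_borel_diff:
  assumes \<rho>: "signed_borel_measure \<rho>" and A: "A \<in> sets borel" and B: "B \<in> sets borel"
    and "A \<subseteq> B"
  shows "\<rho> (B - A) = \<rho> B - \<rho> A"
proof -
  have "\<rho> (A \<union> (B - A)) = \<rho> A + \<rho> (B - A)"
    using A B by (intro signed_borel_additive[OF \<rho>]) auto
  moreover have "A \<union> (B - A) = B" using assms by auto
  ultimately show ?thesis by simp
qed

lemma signed_borel_measure_uminus: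
  "signed_borel_measure \<rho> \<Longrightarrow> signed_borel_measure (\<lambda>A. - \<rho> A)"
  unfolding signed_borel_measure_def by (auto intro: sums_minus)

text \<open>Pick \<open>B\<close> inside \<open>E\<close> with \<open>\<bar>\<rho> B\<bar>\<close>
  exceeding \<open>1 + \<bar>\<rho> E\<bar>\<close>. Then \<open>B\<close> and \<open>E - B\<close>
  both have measure above 1 in absolute value, and \<open>\<rho>\<close> cannot be bounded on the
  subsets of both. A piece on which it is unbounded is kept, the other one is split off.\<close>

lemma signed_borel_unbounded_split:
  fixes \<rho> :: "'a::topological_space set \<Rightarrow> real"
  assumes \<rho>: "signed_borel_measure \<rho>" and E: "E \<in> sets borel"
    and unb: "\<And>c. \<exists>B\<in>sets borel. B \<subseteq> E \<and> c < \<bar>\<rho> B\<bar>"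
  shows "\<exists>E'\<in>sets borel. E' \<subseteq> E \<and> (\<forall>c. \<exists>B\<in>sets borel. B \<subseteq> E' \<and> c < \<bar>\<rho> B\<bar>) \<and> 1 < \<bar>\<rho> (E - E')\<bar>"
proof (rule ccontr)
  assume contra: "\<not> ?thesis"
  obtain B where B: "B \<in> sets borel" "B \<subseteq> E" "1 + \<bar>\<rho> E\<bar> < \<bar>\<rho> B\<bar>"
    using unb[of "1 + \<bar>\<rho> E\<bar>"] by auto
  have EB: "E - B \<in> sets borel" using B E by auto
  have d: "\<rho> (E - B) = \<rho> E - \<rho> B" using B E by (intro signed_borel_diff[OF \<rho>]) auto
  have "E - (E - B) = B" using B by auto
  have "\<not> (\<forall>c. \<exists>C\<in>sets borel. C \<subseteq> E - B \<and> c < \<bar>\<rho> C\<bar>)"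
  proof -
    have "1 < \<bar>\<rho> (E - (E - B))\<bar>" using \<open>E - (E - B) = B\<close> B by simp
    then show ?thesis using contra EB by blast
  qed
  then obtain c1 where c1: "\<And>C. C \<in> sets borel \<Longrightarrow> C \<subseteq> E - B \<Longrightarrow> \<bar>\<rho> C\<bar> \<le> c1"
    by (meson not_less)
  have "1 < \<bar>\<rho> (E - B)\<bar>" using d B by linarith
  then have "\<not> (\<forall>c. \<exists>C\<in>sets borel. C \<subseteq> B \<and> c < \<bar>\<rho> C\<bar>)"
    using contra B by blast
  then obtain c2 where c2: "\<And>C. C \<in> sets borel \<Longrightarrow> C \<subseteq> B \<Longrightarrow> \<bar>\<rho> C\<bar> \<le> c2"
    by (meson not_less)
  obtain C where C: "C \<in> sets borel" "C \<subseteq> E" "c1 + c2 < \<bar>\<rho> C\<bar>"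
    using unb[of "c1 + c2"] by auto
  have "\<rho> ((C \<inter> B) \<union> (C - B)) = \<rho> (C \<inter> B) + \<rho> (C - B)"
    using C B by (intro signed_borel_additive[OF \<rho>]) auto
  moreover have "(C \<inter> B) \<union> (C - B) = C" by auto
  moreover have "\<bar>\<rho> (C \<inter> B)\<bar> \<le> c2" using C B by (intro c2) auto
  moreover have "\<bar>\<rho> (C - B)\<bar> \<le> c1" using C B by (intro c1) auto
  ultimately show False using C(3) by simp
qed

text \<open>If \<open>\<rho>\<close> were unbounded, one could split off successively disjoint sets of
  measure larger than 1 in absolute value, contradicting the convergence of the sum of their
  measures.\<close>

lemma signed_borel_bounded:
  fixes \<rho> :: "'a::topological_space set \<Rightarrow> real"
  assumes \<rho>: "signed_borel_measure \<rho>"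
  shows "\<exists>c. \<forall>B\<in>sets borel. \<bar>\<rho> B\<bar> \<le> c"
proof (rule ccontr)
  assume contra: "\<not> ?thesis"
  define P where "P n E \<longleftrightarrow> E \<in> sets borel \<and> (\<forall>c. \<exists>B\<in>sets borel. B \<subseteq> E \<and> c < \<bar>\<rho> B\<bar>)"
    for n :: nat and E :: "'a set"
  define Q where "Q n E E' \<longleftrightarrow> E' \<subseteq> E \<and> 1 < \<bar>\<rho> (E - E')\<bar>"
    for n :: nat and E E' :: "'a set"
  have "\<exists>f. \<forall>n. P n (f n) \<and> Q n (f n) (f (Suc n))"
  proof (rule dependent_nat_choice)
    have "\<forall>c. \<exists>B\<in>sets borel. c < \<bar>\<rho> B\<bar>" using contra by (simp add: not_le)
    then show "\<exists>x. P 0 x" unfolding P_def by (intro exI[of _ UNIV]) simp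
    show "\<exists>y. P (Suc n) y \<and> Q n x y" if "P n x" for x n
    proof -
      have "x \<in> sets borel" "\<And>c. \<exists>B\<in>sets borel. B \<subseteq> x \<and> c < \<bar>\<rho> B\<bar>"
        using that by (simp_all add: P_def)
      from signed_borel_unbounded_split[OF \<rho> this] show ?thesis
        unfolding P_def Q_def by metis
    qed
  qed
  then obtain f where "\<forall>n. P n (f n) \<and> Q n (f n) (f (Suc n))" by (rule exE)
  then have f: "\<And>n. P n (f n)" "\<And>n. Q n (f n) (f (Suc n))" by simp_all
  have dec: "decseq f" using f(2) by (intro decseq_SucI) (auto simp: Q_def)
  define D where "D n = f n - f (Suc n)" for n
  have "disjoint_family D"
    unfolding disjoint_family_on_def
  proof (intro ballI impI)
    fix m n :: nat assume "m \<noteq> n"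
    then show "D m \<inter> D n = {}"
    proof (induction m n rule: linorder_wlog)
      case (le a b)
      then have "Suc a \<le> b" by simp
      then have "f b \<subseteq> f (Suc a)" by (rule decseqD[OF dec])
      then show ?case by (auto simp: D_def)
    next
      case (sym a b) then show ?case by (simp add: Int_commute)
    qed
  qed
  moreover have "range D \<subseteq> sets borel" using f(1) by (auto simp: D_def P_def)
  ultimately have "(\<lambda>i. \<rho> (D i)) sums \<rho> (\<Union>i. D i)" by (intro signed_borel_sums[OF \<rho>])
  then have "(\<lambda>i. \<rho> (D i)) \<longlonglongrightarrow> 0" by (intro summable_LIMSEQ_zero) (auto simp: sums_iff)
  then have "eventually (\<lambda>i. \<bar>\<rho> (D i)\<bar> < 1) sequentially"
    by (auto simp: dist_real_def dest: tendstoD[where e = 1])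
  then obtain i where "\<bar>\<rho> (D i)\<bar> < 1" by (auto simp: eventually_sequentially)
  moreover have "1 < \<bar>\<rho> (D i)\<bar>" using f(2)[of i] by (simp add: Q_def D_def)
  ultimately show False by simp
qed

section \<open>The positive part as a finite measure\<close>

lemma sets_positive_part [simp, measurable_cong]: "sets (positive_part \<rho>) = sets borel"
  unfolding positive_part_def using sets.sets_measure_of_eq[of borel] by (simp only: space_borel)

lemma space_positive_part [simp]: "space (positive_part \<rho>) = UNIV"
  unfolding positive_part_def by (simp add: space_measure_of_conv)

text \<open>Competitors \<open>C\<close> for \<open>A\<close> and \<open>D\<close> for
  \<open>B\<close> are disjoint, so their union competes for \<open>A \<union> B\<close>. As
  \<open>ennreal\<close> truncates at 0, its values add up only when both measures are nonnegative;
  otherwise one of the two sets alone is a good enough competitor.\<close>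

lemma SUP_signed_borel_superadditive:
  assumes \<rho>: "signed_borel_measure \<rho>" and A: "A \<in> sets borel" "B \<in> sets borel" "A \<inter> B = {}"
  defines "P \<equiv> \<lambda>A. (SUP B\<in>{B \<in> sets borel. B \<subseteq> A}. ennreal (\<rho> B))"
  shows "P A + P B \<le> P (A \<union> B)"
proof -
  have "ennreal (\<rho> C) + ennreal (\<rho> D) \<le> P (A \<union> B)"
    if C: "C \<in> sets borel" "C \<subseteq> A" and D: "D \<in> sets borel" "D \<subseteq> B" for C D
  proof -
    have up: "ennreal (\<rho> X) \<le> P (A \<union> B)" if "X \<in> sets borel" "X \<subseteq> A \<union> B" for X
      unfolding P_def using that by (intro SUP_upper) auto
    consider "\<rho> C \<le> 0" | "\<rho> D \<le> 0" | "\<rho> C \<ge> 0" "\<rho> D \<ge> 0" by linarith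
    then show ?thesis
    proof cases
      case 1 then show ?thesis using up[of D] D by (auto simp: ennreal_neg)
    next
      case 2 then show ?thesis using up[of C] C by (auto simp: ennreal_neg)
    next
      case 3
      have "\<rho> (C \<union> D) = \<rho> C + \<rho> D" using C D A by (intro signed_borel_additive[OF \<rho>]) auto
      then show ?thesis using up[of "C \<union> D"] C D 3 by (auto simp flip: ennreal_plus)
    qed
  qed
  then have "(SUP C\<in>{B \<in> sets borel. B \<subseteq> A}. SUP D\<in>{D \<in> sets borel. D \<subseteq> B}. ennreal (\<rho> C) + ennreal (\<rho> D)) \<le> P (A \<union> B)"
    by (intro SUP_least) auto
  also have "(SUP C\<in>{B \<in> sets borel. B \<subseteq> A}. SUP D\<in>{D \<in> sets borel. D \<subseteq> B}. ennreal (\<rho> C) + ennreal (\<rho> D)) = P A + P B"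
  proof -
    have ne: "{B \<in> sets borel. B \<subseteq> X} \<noteq> {}" for X :: "'a set" by (auto intro!: exI[of _ "{}"])
    have "(SUP D\<in>{D \<in> sets borel. D \<subseteq> B}. ennreal (\<rho> C) + ennreal (\<rho> D)) = ennreal (\<rho> C) + P B" for C
      unfolding P_def using ennreal_SUP_add_right[OF ne, of "ennreal (\<rho> C)" "\<lambda>D. ennreal (\<rho> D)"] by simp
    moreover have "(SUP C\<in>{D \<in> sets borel. D \<subseteq> A}. ennreal (\<rho> C) + P B) = P A + P B"
      unfolding P_def by (rule ennreal_SUP_add_left[OF ne])
    ultimately show ?thesis by simp
  qed
  finally show ?thesis .
qed

text \<open>\<open>measure_of\<close> returns the given set function only once this is known to be
  countably additive, which is shown here without a Hahn decomposition. Superadditivity on finite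
  unions gives one inequality. For the other, a competitor for the union is cut along the sets
  \<open>A i\<close>, and truncating its negative pieces at 0 only increases the partial
  sums.\<close>

lemma emeasure_positive_part:
  assumes \<rho>: "signed_borel_measure \<rho>" and A: "A \<in> sets borel"
  shows "emeasure (positive_part \<rho>) A = (SUP B\<in>{B \<in> sets borel. B \<subseteq> A}. ennreal (\<rho> B))"
proof -
  define P where "P = (\<lambda>A. (SUP B\<in>{B \<in> sets borel. B \<subseteq> A}. ennreal (\<rho> B)))"
  have emp [simp]: "\<rho> {} = 0" using \<rho> by (simp add: signed_borel_measure_def)
  have P0 [simp]: "P {} = 0" by (auto simp: P_def intro!: antisym SUP_least)
  have mono: "P A \<le> P B" if "A \<subseteq> B" for A B
    unfolding P_def using that by (intro SUP_subset_mono) auto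
  have "emeasure (positive_part \<rho>) A = P A"
  proof (rule emeasure_measure_of[OF positive_part_def[of \<rho>, folded P_def]])
    show "sets borel \<subseteq> Pow (UNIV :: 'a set)" by simp
    show "A \<in> sets (positive_part \<rho>)" using A by simp
    show "positive (sets (positive_part \<rho>)) P" by (simp add: positive_def)
    show "countably_additive (sets (positive_part \<rho>)) P"
      unfolding countably_additive_def
    proof (intro allI impI antisym)
      fix A :: "nat \<Rightarrow> 'a set"
      assume A: "range A \<subseteq> sets (positive_part \<rho>)" and dis: "disjoint_family A"
      have Am: "A i \<in> sets borel" for i using A by auto
      show "(\<Sum>i. P (A i)) \<le> P (\<Union>i. A i)"
      proof (rule suminf_le_const)
        fix n
        have "(\<Sum>i<n. P (A i)) \<le> P (\<Union>i<n. A i)"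
        proof (induction n)
          case (Suc n)
          have Suc_le: "(\<Sum>i<Suc n. P (A i)) \<le> P (\<Union>i<n. A i) + P (A n)"
            using Suc by (simp add: add_right_mono)
          have dn: "(\<Union>i<n. A i) \<inter> A n = {}"
          proof -
            have "A i \<inter> A n = {}" if "i < n" for i
              using disjoint_family_onD[OF dis, of i n] that by simp
            then show ?thesis by blast
          qed
          note Suc_le
          also from dn have "P (\<Union>i<n. A i) + P (A n) \<le> P ((\<Union>i<n. A i) \<union> A n)"
            unfolding P_def using Am
            by (intro SUP_signed_borel_superadditive[OF \<rho>]) auto
          also have "(\<Union>i<n. A i) \<union> A n = (\<Union>i<Suc n. A i)" by (auto simp: less_Suc_eq)
          finally show ?case .
        qed simp
        also have "\<dots> \<le> P (\<Union>i. A i)" by (intro mono) auto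
        finally show "(\<Sum>i<n. P (A i)) \<le> P (\<Union>i. A i)" .
      qed simp
      show "P (\<Union>i. A i) \<le> (\<Sum>i. P (A i))"
      proof (subst P_def, intro SUP_least, clarify)
        fix B assume B: "B \<in> sets borel" "B \<subseteq> (\<Union>i. A i)"
        have "disjoint_family (\<lambda>i. B \<inter> A i)" using dis by (auto simp: disjoint_family_on_def)
        then have "(\<lambda>i. \<rho> (B \<inter> A i)) sums \<rho> (\<Union>i. B \<inter> A i)"
          using B Am by (intro signed_borel_sums[OF \<rho>]) auto
        also have "(\<Union>i. B \<inter> A i) = B" using B by auto
        finally have "(\<lambda>n. ennreal (\<Sum>i<n. \<rho> (B \<inter> A i))) \<longlonglongrightarrow> ennreal (\<rho> B)"
          unfolding sums_def by (rule tendsto_ennrealI)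
        then show "ennreal (\<rho> B) \<le> (\<Sum>i. P (A i))"
        proof (rule LIMSEQ_le_const2, intro exI allI impI)
          fix n :: nat
          have "ennreal (\<Sum>i<n. \<rho> (B \<inter> A i)) \<le> ennreal (\<Sum>i<n. max 0 (\<rho> (B \<inter> A i)))"
            by (intro ennreal_leI sum_mono) auto
          also have "\<dots> = (\<Sum>i<n. ennreal (max 0 (\<rho> (B \<inter> A i))))" by (simp add: sum_ennreal)
          also have "\<dots> = (\<Sum>i<n. ennreal (\<rho> (B \<inter> A i)))" by (simp add: ennreal_max_0)
          also have "\<dots> \<le> (\<Sum>i<n. P (A i))"
            unfolding P_def using B Am by (intro sum_mono SUP_upper) auto
          also have "\<dots> \<le> (\<Sum>i. P (A i))" by (intro sum_le_suminf) auto
          finally show "ennreal (\<Sum>i<n. \<rho> (B \<inter> A i)) \<le> (\<Sum>i. P (A i))" .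
        qed
      qed
    qed
  qed
  then show ?thesis by (simp add: P_def)
qed

lemma finite_measure_positive_part:
  assumes \<rho>: "signed_borel_measure \<rho>"
  shows "finite_measure (positive_part \<rho>)"
proof (rule finite_measureI)
  obtain c where c: "\<And>B. B \<in> sets borel \<Longrightarrow> \<bar>\<rho> B\<bar> \<le> c" using signed_borel_bounded[OF \<rho>] by blast
  have "(SUP B\<in>{B \<in> sets borel. B \<subseteq> UNIV}. ennreal (\<rho> B)) \<le> ennreal c"
    using c by (intro SUP_least ennreal_leI) (auto simp: abs_le_iff)
  also have "\<dots> < top" by simp
  finally have "emeasure (positive_part \<rho>) UNIV < top"
    by (subst emeasure_positive_part[OF \<rho>]) auto
  then show "emeasure (positive_part \<rho>) (space (positive_part \<rho>)) \<noteq> \<infinity>"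
    by simp
qed

text \<open>As \<open>\<rho> UNIV = 0\<close>, complementation turns a competitor for
  \<open>\<rho>\<close> into one for its negative with the same value. The equality of the two
  masses is what makes constants integrate to 0.\<close>

lemma emeasure_positive_part_uminus_UNIV:
  assumes \<rho>: "signed_borel_measure \<rho>" and "\<rho> UNIV = 0"
  shows "emeasure (positive_part (\<lambda>A. - \<rho> A)) UNIV = emeasure (positive_part \<rho>) UNIV"
proof -
  have *: "- \<rho> B = \<rho> (- B)" if "B \<in> sets borel" for B
    using signed_borel_diff[OF \<rho>, of B UNIV] that assms(2) by (simp add: Compl_eq_Diff_UNIV)
  have "(SUP B\<in>sets borel. ennreal (- \<rho> B)) = (SUP B\<in>sets borel. ennreal (\<rho> (- B)))"
    using * by (intro SUP_cong) auto
  also have "\<dots> = (SUP B\<in>uminus ` sets borel. ennreal (\<rho> B))" by (simp add: image_image)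
  also have "(uminus ` sets borel :: 'a set set) = sets borel"
    by (auto simp: image_iff intro!: bexI[of _ "- _"])
  finally show ?thesis
    using \<rho> by (simp add: emeasure_positive_part signed_borel_measure_uminus)
qed

text \<open>The complement of the support is a union of open sets on whose Borel subsets
  \<open>\<rho>\<close> vanishes; by Lindelof countably many of them suffice, so it is a null
  set.\<close>

lemma AE_positive_part_signed_support:
  fixes \<rho> :: "'a::second_countable_topology set \<Rightarrow> real"
  assumes \<rho>: "signed_borel_measure \<rho>"
  shows "AE x in positive_part \<rho>. x \<in> signed_support \<rho>"
proof -
  define F where "F = {U. open U \<and> (\<forall>B\<in>sets borel. B \<subseteq> U \<longrightarrow> \<rho> B = 0)}"
  have "\<And>S. S \<in> F \<Longrightarrow> open S" by (auto simp: F_def)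
  from Lindelof[OF this] obtain G where G: "G \<subseteq> F" "countable G" "\<Union>G = \<Union>F" by blast
  have null: "U \<in> null_sets (positive_part \<rho>)" if "U \<in> F" for U
  proof -
    have "U \<in> sets borel" using that by (auto simp: F_def)
    moreover have "(SUP B\<in>{B \<in> sets borel. B \<subseteq> U}. ennreal (\<rho> B)) = 0"
      using that by (auto simp: F_def intro!: antisym SUP_least)
    ultimately show ?thesis by (auto simp: null_sets_def emeasure_positive_part[OF \<rho>])
  qed
  have "(\<Union>U\<in>G. U) \<in> null_sets (positive_part \<rho>)"
    using G null by (intro null_sets_UN') auto
  moreover have "\<Union>G = - signed_support \<rho>"
    unfolding G signed_support_def F_def by auto
  ultimately have "- signed_support \<rho> \<in> null_sets (positive_part \<rho>)" by simp
  from AE_not_in[OF this] show ?thesis by simp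
qed

lemma signed_support_uminus [simp]: "signed_support (\<lambda>A. - \<rho> A) = signed_support \<rho>"
  by (simp add: signed_support_def)

lemma integrable_positive_part:
  fixes f :: "'a::{second_countable_topology,t2_space} \<Rightarrow> 'b::{banach, second_countable_topology}"
  assumes \<rho>: "signed_borel_measure \<rho>" and K: "compact (signed_support \<rho>)"
    and f: "continuous_on UNIV f"
  shows "integrable (positive_part \<rho>) f"
proof -
  interpret finite_measure "positive_part \<rho>" by (rule finite_measure_positive_part[OF \<rho>])
  have "bounded (f ` signed_support \<rho>)"
    using K f by (intro compact_imp_bounded compact_continuous_image) (auto intro: continuous_on_subset)
  then obtain b where "\<And>x. x \<in> signed_support \<rho> \<Longrightarrow> norm (f x) \<le> b" by (auto simp: bounded_iff)
  then have "AE x in positive_part \<rho>. norm (f x) \<le> b"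
    using AE_positive_part_signed_support[OF \<rho>] by auto
  moreover have "f \<in> borel_measurable (positive_part \<rho>)"
    using borel_measurable_continuous_onI[OF f] by simp
  ultimately show ?thesis by (intro integrable_const_bound)
qed

text \<open>Because \<open>S\<close> has a measurable inverse, every Borel subset of the preimage of
  \<open>A\<close> is itself the preimage of a Borel subset of \<open>A\<close>, so both suprema run
  over the same values. For a map that is not injective, cancellation could make the positive part
  of the image smaller.\<close>

lemma positive_part_push_forward:
  assumes \<rho>: "signed_borel_measure (\<rho> :: 'a set \<Rightarrow> real)" and S: "(S :: 'a::topological_space \<Rightarrow> 'b::topological_space) \<in> borel_measurable borel"
    and T: "T \<in> borel_measurable borel" and TS: "\<And>x. T (S x) = x" and ST: "\<And>x. S (T x) = x"
  shows "signed_borel_measure (push_forward S \<rho>)"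
    and "positive_part (push_forward S \<rho>) = distr (positive_part \<rho>) borel S"
proof -
  have vS: "S -` A \<in> sets borel" if "A \<in> sets borel" for A
    using measurable_sets[OF S that] by simp
  have vT: "T -` A \<in> sets borel" if "A \<in> sets borel" for A
    using measurable_sets[OF T that] by simp
  show sb: "signed_borel_measure (push_forward S \<rho>)"
    unfolding signed_borel_measure_def push_forward_def
  proof (intro conjI allI impI)
    show "\<rho> (S -` {}) = 0" using \<rho> by (simp add: signed_borel_measure_def)
    fix A :: "nat \<Rightarrow> 'b set" assume A: "range A \<subseteq> sets borel" "disjoint_family A"
    have "(\<lambda>i. \<rho> (S -` A i)) sums \<rho> (\<Union>i. S -` A i)"
      using A vS by (intro signed_borel_sums[OF \<rho>]) (auto simp: disjoint_family_on_def)
    then show "(\<lambda>i. \<rho> (S -` A i)) sums \<rho> (S -` (\<Union>i. A i))" by (simp add: vimage_UN)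
  qed
  show "positive_part (push_forward S \<rho>) = distr (positive_part \<rho>) borel S"
  proof (rule measure_eqI)
    fix A assume "A \<in> sets (positive_part (push_forward S \<rho>))"
    then have A: "A \<in> sets borel" by simp
    have "(\<lambda>B. S -` B) ` {B \<in> sets borel. B \<subseteq> A} = {B \<in> sets borel. B \<subseteq> S -` A}"
    proof (intro equalityI subsetI)
      fix B assume B: "B \<in> {B \<in> sets borel. B \<subseteq> S -` A}"
      have "T -` B \<subseteq> A"
      proof
        fix y assume "y \<in> T -` B"
        then have "T y \<in> S -` A" using B by auto
        then show "y \<in> A" using ST by simp
      qed
      then have "T -` B \<in> {B \<in> sets borel. B \<subseteq> A}" using vT B by simp
      moreover have "B = S -` (T -` B)" using TS by (auto simp: vimage_def)
      ultimately show "B \<in> (\<lambda>B. S -` B) ` {B \<in> sets borel. B \<subseteq> A}" by blast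
    qed (use vS in auto)
    from this[symmetric] have "(SUP B\<in>{B \<in> sets borel. B \<subseteq> S -` A}. ennreal (\<rho> B)) =
        (SUP B\<in>{B \<in> sets borel. B \<subseteq> A}. ennreal (\<rho> (S -` B)))"
      by (simp only: image_image)
    then show "emeasure (positive_part (push_forward S \<rho>)) A = emeasure (distr (positive_part \<rho>) borel S) A"
      using A S vS[OF A]
      by (simp add: emeasure_distr emeasure_positive_part[OF \<rho>] emeasure_positive_part[OF sb])
        (simp add: push_forward_def)
  qed simp
qed

section \<open>Integration against a signed measure\<close>

lemma signed_integral_push_forward:
  fixes f :: "'b::topological_space \<Rightarrow> 'c::{banach, second_countable_topology}"
  assumes \<rho>: "signed_borel_measure (\<rho> :: 'a set \<Rightarrow> real)" and S: "(S :: 'a::topological_space \<Rightarrow> 'b::topological_space) \<in> borel_measurable borel"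
    and T: "T \<in> borel_measurable borel" and TS: "\<And>x. T (S x) = x" and ST: "\<And>x. S (T x) = x"
    and f: "f \<in> borel_measurable borel"
  shows "signed_integral (push_forward S \<rho>) f = signed_integral \<rho> (\<lambda>x. f (S x))"
proof -
  have "(\<lambda>A. - push_forward S \<rho> A) = push_forward S (\<lambda>A. - \<rho> A)" by (simp add: push_forward_def)
  moreover have "S \<in> measurable (positive_part r) borel" for r using S by simp
  ultimately show ?thesis unfolding signed_integral_def
    using positive_part_push_forward(2)[OF \<rho> S T TS ST] f
      positive_part_push_forward(2)[OF signed_borel_measure_uminus[OF \<rho>] S T TS ST]
    by (simp add: integral_distr)
qed

lemma signed_integral_add:
  fixes \<rho> :: "'a::{second_countable_topology,t2_space} set \<Rightarrow> real"
  assumes "signed_borel_measure \<rho>" "compact (signed_support \<rho>)"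
    and "continuous_on UNIV f" "continuous_on UNIV g"
  shows "signed_integral \<rho> (\<lambda>x. f x + g x) = signed_integral \<rho> f + signed_integral \<rho> g"
  using assms
  by (simp add: signed_integral_def integrable_positive_part signed_borel_measure_uminus)

lemma signed_integral_bounded_linear:
  fixes \<rho> :: "'a::{second_countable_topology,t2_space} set \<Rightarrow> real"
  assumes "signed_borel_measure \<rho>" "compact (signed_support \<rho>)"
    and "continuous_on UNIV f" and R: "bounded_linear R"
  shows "signed_integral \<rho> (\<lambda>x. R (f x)) = R (signed_integral \<rho> f)"
proof -
  interpret R: bounded_linear R by (rule R)
  show ?thesis using assms
    by (simp add: signed_integral_def integrable_positive_part signed_borel_measure_uminus
        integral_bounded_linear[OF R] R.diff)
qed

lemma signed_integral_const:
  assumes \<rho>: "signed_borel_measure \<rho>" and "\<rho> UNIV = 0"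
  shows "signed_integral \<rho> (\<lambda>x. c) = 0"
  using emeasure_positive_part_uminus_UNIV[OF assms]
  by (simp add: signed_integral_def measure_def)

text \<open>The constant is the total variation of \<open>\<rho>\<close>, the sum of the masses of
  its two parts. It is chosen before \<open>f\<close>, and a bound for \<open>f\<close> on the
  support is enough because both parts are concentrated there.\<close>

lemma signed_integral_abs_le:
  fixes \<rho> :: "'a::{second_countable_topology,t2_space} set \<Rightarrow> real"
  assumes \<rho>: "signed_borel_measure \<rho>" and K: "compact (signed_support \<rho>)"
  shows "\<exists>A\<ge>0. \<forall>(f :: 'a \<Rightarrow> real) b. continuous_on UNIV f \<longrightarrow> (\<forall>x\<in>signed_support \<rho>. \<bar>f x\<bar> \<le> b) \<longrightarrow>
    \<bar>signed_integral \<rho> f\<bar> \<le> A * b"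
proof -
  have *: "\<bar>integral\<^sup>L (positive_part r) f\<bar> \<le> measure (positive_part r) UNIV * b"
    if "signed_borel_measure r" "compact (signed_support r)" "continuous_on UNIV f"
      "\<forall>x\<in>signed_support r. \<bar>f x\<bar> \<le> b" for r :: "'a set \<Rightarrow> real" and f :: "'a \<Rightarrow> real" and b
  proof -
    interpret finite_measure "positive_part r" by (rule finite_measure_positive_part[OF that(1)])
    have "\<bar>integral\<^sup>L (positive_part r) f\<bar> \<le> (\<integral>x. \<bar>f x\<bar> \<partial>positive_part r)"
      by (rule integral_abs_bound)
    also have "\<dots> \<le> (\<integral>x. b \<partial>positive_part r)"
      using that AE_positive_part_signed_support[OF that(1)] integrable_positive_part[OF that(1-3)]
      by (intro integral_mono_AE) auto
    finally show ?thesis by simp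
  qed
  show ?thesis
  proof (intro exI[of _ "measure (positive_part \<rho>) UNIV + measure (positive_part (\<lambda>A. - \<rho> A)) UNIV"] conjI allI impI)
    fix f :: "'a \<Rightarrow> real" and b
    assume f: "continuous_on UNIV f" and b: "\<forall>x\<in>signed_support \<rho>. \<bar>f x\<bar> \<le> b"
    have "\<bar>integral\<^sup>L (positive_part \<rho>) f\<bar> \<le> measure (positive_part \<rho>) UNIV * b"
      using \<rho> K f b by (intro *)
    moreover have "\<bar>integral\<^sup>L (positive_part (\<lambda>A. - \<rho> A)) f\<bar> \<le> measure (positive_part (\<lambda>A. - \<rho> A)) UNIV * b"
      using K f b by (intro * signed_borel_measure_uminus \<rho>) auto
    ultimately show "\<bar>signed_integral \<rho> f\<bar> \<le>
        (measure (positive_part \<rho>) UNIV + measure (positive_part (\<lambda>A. - \<rho> A)) UNIV) * b"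
      unfolding signed_integral_def by (simp add: ring_distribs)
  qed simp
qed

section \<open>The spaces \<open>L\<^sup>p\<close>\<close>

lemma powr_mvt:
  fixes s t p :: real
  assumes "0 \<le> s" "s < t" "1 < p"
  shows "\<exists>\<xi>. s < \<xi> \<and> \<xi> < t \<and> t powr p - s powr p = (t - s) * (p * \<xi> powr (p - 1))"
proof -
  have "continuous_on {s..t} (\<lambda>x. x powr p)"
    using assms by (intro continuous_on_powr') (auto intro!: continuous_intros)
  moreover have "((\<lambda>x. x powr p) has_derivative (\<lambda>h. h * (p * x powr (p - 1)))) (at x)"
    if "s < x" "x < t" for x
    using has_real_derivative_powr[of x p] that assms
    by (simp add: has_field_derivative_def mult.commute[of _ "p * x powr (p - 1)"])
  ultimately show ?thesis
    using mvt[of s t "\<lambda>x. x powr p" "\<lambda>x h. h * (p * x powr (p - 1))"] assms by auto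
qed

text \<open>The mean value theorem on the two halves of the interval compares the increments through
  the strictly increasing derivative of \<open>x powr p\<close>. The derivative is evaluated at
  interior points only, so that \<open>s = 0\<close> is covered.\<close>

lemma powr_midpoint_less:
  fixes s t p :: real
  assumes "0 \<le> s" "s < t" "1 < p"
  shows "((s + t) / 2) powr p < (s powr p + t powr p) / 2"
proof -
  define m where "m = (s + t) / 2"
  have m: "s < m" "m < t" "m - s = (t - s) / 2" "t - m = (t - s) / 2"
    using assms by (auto simp: m_def field_simps)
  obtain x where x: "s < x" "x < m" "m powr p - s powr p = (m - s) * (p * x powr (p - 1))"
    using powr_mvt[of s m p] assms m by auto
  obtain y where y: "m < y" "y < t" "t powr p - m powr p = (t - m) * (p * y powr (p - 1))"
    using powr_mvt[of m t p] assms m by auto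
  have "x powr (p - 1) < y powr (p - 1)" using x y assms by (intro powr_less_mono2) auto
  then have "(t - s) / 2 * (p * x powr (p - 1)) < (t - s) / 2 * (p * y powr (p - 1))"
    using assms by (intro mult_strict_left_mono) auto
  then have "m powr p - s powr p < t powr p - m powr p"
    unfolding x(3) y(3) m(3) m(4) .
  then show ?thesis by (simp add: m_def)
qed

text \<open>Strictness has two sources: for different norms the scalar power is strictly convex, and
  for equal norms the triangle inequality is strict, since equality in it would force
  \<open>a = b\<close>.\<close>

lemma norm_powr_midpoint:
  fixes a b :: "'a::real_inner"
  assumes "1 < p"
  shows "norm ((1/2) *\<^sub>R (a + b)) powr p \<le> (norm a powr p + norm b powr p) / 2"
    and "a \<noteq> b \<Longrightarrow> norm ((1/2) *\<^sub>R (a + b)) powr p < (norm a powr p + norm b powr p) / 2"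
proof -
  have tri: "norm ((1/2) *\<^sub>R (a + b)) \<le> (norm a + norm b) / 2"
    using norm_triangle_ineq[of a b] by simp
  then have le1: "norm ((1/2) *\<^sub>R (a + b)) powr p \<le> ((norm a + norm b) / 2) powr p"
    using assms by (intro powr_mono2) auto
  have lt2: "((norm a + norm b) / 2) powr p < (norm a powr p + norm b powr p) / 2" if "norm a \<noteq> norm b"
    using powr_midpoint_less[of "norm a" "norm b" p] powr_midpoint_less[of "norm b" "norm a" p] that assms
    by (cases "norm a < norm b") (auto simp: add.commute)
  have le2: "((norm a + norm b) / 2) powr p \<le> (norm a powr p + norm b powr p) / 2"
    using lt2 by (cases "norm a = norm b") auto
  show "norm ((1/2) *\<^sub>R (a + b)) powr p \<le> (norm a powr p + norm b powr p) / 2"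
    using le1 le2 by simp
  assume "a \<noteq> b"
  show "norm ((1/2) *\<^sub>R (a + b)) powr p < (norm a powr p + norm b powr p) / 2"
  proof (cases "norm a = norm b")
    case True
    have "norm (a + b) \<noteq> norm a + norm b"
    proof
      assume "norm (a + b) = norm a + norm b"
      then have "norm a *\<^sub>R b = norm b *\<^sub>R a" by (simp add: norm_triangle_eq)
      then have "norm a = 0 \<or> a = b" using True by auto
      then show False using True \<open>a \<noteq> b\<close> by auto
    qed
    then have "norm ((1/2) *\<^sub>R (a + b)) < (norm a + norm b) / 2"
      using tri by simp
    then have "norm ((1/2) *\<^sub>R (a + b)) powr p < ((norm a + norm b) / 2) powr p"
      using assms by (intro powr_less_mono2) auto
    then show ?thesis using le2 by simp
  qed (use lt2 le1 in auto)
qed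

text \<open>Uniform convexity of \<open>x \<mapsto> norm x powr p\<close>: compactness handles the pairs with
  \<open>norm a powr p + norm b powr p = 1\<close>, homogeneity the others.\<close>

lemma norm_powr_uniformly_convex:
  fixes p \<epsilon> :: real
  assumes p: "1 < p" and e: "0 < \<epsilon>"
  shows "\<exists>C\<ge>0. \<forall>a b :: 'a::euclidean_space. norm (a - b) powr p \<le> \<epsilon> * (norm a powr p + norm b powr p) +
    C * ((norm a powr p + norm b powr p) / 2 - norm ((1/2) *\<^sub>R (a + b)) powr p)"
proof -
  define s where "s = (\<lambda>x :: 'a \<times> 'a. norm (fst x) powr p + norm (snd x) powr p)"
  define d where "d = (\<lambda>x :: 'a \<times> 'a. s x / 2 - norm ((1/2) *\<^sub>R (fst x + snd x)) powr p)"
  define g where "g = (\<lambda>x :: 'a \<times> 'a. norm (fst x - snd x) powr p)"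
  \<comment> \<open>The normalised pairs for which \<open>\<epsilon>\<close> alone need not suffice;
    on this compact set the two entries of a pair differ.\<close>
  define T where "T = {x. s x = 1 \<and> \<epsilon> \<le> g x}"
  have cs: "continuous_on UNIV s" unfolding s_def using p
    by (intro continuous_intros continuous_on_powr') auto
  have cd: "continuous_on UNIV d" unfolding d_def using p
    by (intro continuous_intros continuous_on_powr' cs) auto
  have cg: "continuous_on UNIV g" unfolding g_def using p
    by (intro continuous_intros continuous_on_powr') auto
  have d0: "0 \<le> d x" for x using norm_powr_midpoint(1)[OF p, of "fst x" "snd x"] by (simp add: d_def s_def)
  have le1: "norm (fst x) \<le> 1 \<and> norm (snd x) \<le> 1" if "s x = 1" for x
  proof -
    have "norm (fst x) powr p \<le> 1 powr p" "norm (snd x) powr p \<le> 1 powr p"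
      using that by (auto simp: s_def) (smt (verit) powr_ge_zero)+
    then show ?thesis using p powr_less_mono2[of p 1] by (smt (verit))
  qed
  have gle: "g x \<le> 2 powr p" if "s x = 1" for x
    unfolding g_def using le1[OF that] p norm_triangle_ineq4[of "fst x" "snd x"]
    by (intro powr_mono2) auto
  have "closed T" unfolding T_def
    using cs cg by (intro closed_Collect_conj closed_Collect_eq closed_Collect_le continuous_on_const)
  moreover have "T \<subseteq> cball 0 1 \<times> cball 0 1" using le1 by (auto simp: T_def)
  then have "bounded T" using bounded_Times[OF bounded_cball bounded_cball] bounded_subset by blast
  ultimately have "compact T" by (simp add: compact_eq_bounded_closed)
  \<comment> \<open>The defect \<open>d\<close> attains a positive minimum on \<open>T\<close>,
    while \<open>g\<close> is at most \<open>2 powr p\<close> wherever \<open>s\<close> is 1; the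
    quotient of the two numbers serves as \<open>C\<close>.\<close>
  have "\<exists>C\<ge>0. \<forall>x\<in>T. 2 powr p \<le> C * d x"
  proof (cases "T = {}")
    case False
    have "continuous_on T d" using cd continuous_on_subset by blast
    then obtain x0 where x0: "x0 \<in> T" "\<And>x. x \<in> T \<Longrightarrow> d x0 \<le> d x"
      using continuous_attains_inf[OF \<open>compact T\<close> False] by blast
    have "fst x0 \<noteq> snd x0" using x0(1) e p by (auto simp: T_def g_def)
    then have pos: "0 < d x0"
      using norm_powr_midpoint(2)[OF p, of "fst x0" "snd x0"] by (simp add: d_def s_def)
    have "2 powr p \<le> 2 powr p / d x0 * d x" if "x \<in> T" for x
      using x0(2)[OF that] pos by (simp add: field_simps)
    then show ?thesis using pos by (intro exI[of _ "2 powr p / d x0"]) auto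
  qed (auto intro: exI[of _ 0])
  then obtain C where C: "0 \<le> C" "\<And>x. x \<in> T \<Longrightarrow> 2 powr p \<le> C * d x" by auto
  have unit: "g x \<le> \<epsilon> + C * d x" if "s x = 1" for x
  proof (cases "x \<in> T")
    case True then show ?thesis using C(2)[OF True] gle[OF that] e by linarith
  next
    case False then show ?thesis using that mult_nonneg_nonneg[OF C(1) d0[of x]] by (simp add: T_def not_le)
  qed
  have "g x \<le> \<epsilon> * s x + C * d x" for x
  proof (cases "s x = 0")
    case True
    then have "fst x = 0" "snd x = 0" unfolding s_def by (smt (verit) powr_ge_zero powr_eq_0_iff norm_eq_zero)+
    then show ?thesis using True d0[of x] C(1) p by (simp add: g_def)
  next
    case False
    have sx: "0 < s x" using False unfolding s_def by (smt (verit) powr_ge_zero)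
    \<comment> \<open>\<open>s\<close>, \<open>g\<close> and \<open>d\<close> are homogeneous of
      degree \<open>p\<close>, and this factor scales \<open>s x\<close> to 1.\<close>
    define r where "r = s x powr (- 1 / p)"
    have "r powr p = s x powr (-1)" using p by (simp add: r_def powr_powr)
    then have r: "0 < r" "r powr p = 1 / s x"
      using sx by (simp_all add: r_def powr_minus_divide)
    have ns: "norm (r *\<^sub>R v) powr p = norm v powr p / s x" for v :: 'a
      using r by (simp add: powr_mult)
    have s_eq: "s y = norm (fst y) powr p + norm (snd y) powr p" for y by (simp add: s_def)
    have "s (r *\<^sub>R x) = (norm (fst x) powr p + norm (snd x) powr p) / s x"
      using s_eq[of "r *\<^sub>R x"] by (simp only: fst_scaleR snd_scaleR ns add_divide_distrib)
    then have s': "s (r *\<^sub>R x) = s x / s x" by (simp only: s_eq[of x])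
    have g': "g (r *\<^sub>R x) = g x / s x"
      using ns[of "fst x - snd x"] unfolding g_def by (simp add: scaleR_diff_right del: norm_scaleR)
    have d': "d (r *\<^sub>R x) = d x / s x"
    proof -
      have "norm ((1/2) *\<^sub>R (fst (r *\<^sub>R x) + snd (r *\<^sub>R x))) powr p = norm ((1/2) *\<^sub>R (fst x + snd x)) powr p / s x"
        using ns[of "(1/2) *\<^sub>R (fst x + snd x)"]
        by (simp only: fst_scaleR snd_scaleR scaleR_add_right scaleR_left_commute)
      then show ?thesis unfolding d_def s' by (simp add: diff_divide_distrib)
    qed
    have "g x / s x \<le> \<epsilon> + C * (d x / s x)"
      using unit[of "r *\<^sub>R x"] s' g' d' sx by simp
    then show ?thesis using sx by (simp add: field_simps)
  qed
  note main = this
  have "norm (a - b) powr p \<le> \<epsilon> * (norm a powr p + norm b powr p) +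
    C * ((norm a powr p + norm b powr p) / 2 - norm ((1/2) *\<^sub>R (a + b)) powr p)" for a b :: 'a
    using main[of "(a, b)"] by (simp add: g_def s_def d_def)
  then show ?thesis using C(1) by blast
qed

section \<open>Functions in L^p and Hoelder's inequality\<close>

lemma norm_add_powr_le:
  fixes a b :: "'a::real_normed_vector"
  assumes "0 \<le> p"
  shows "norm (a + b) powr p \<le> 2 powr p * (norm a powr p + norm b powr p)"
proof -
  have "norm (a + b) powr p \<le> (2 * max (norm a) (norm b)) powr p"
    using assms norm_triangle_ineq[of a b] by (intro powr_mono2) auto
  also have "\<dots> = 2 powr p * max (norm a) (norm b) powr p" by (simp add: powr_mult)
  also have "\<dots> \<le> 2 powr p * (norm a powr p + norm b powr p)"
    by (intro mult_left_mono) (auto simp: max_def)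
  finally show ?thesis .
qed

lemma Lp_fun_add:
  assumes "0 \<le> p" "f \<in> Lp_fun p" "g \<in> Lp_fun p"
  shows "(\<lambda>x. f x + g x) \<in> Lp_fun p"
proof -
  have [measurable]: "f \<in> borel_measurable lebesgue" "g \<in> borel_measurable lebesgue"
    using assms by (auto simp: Lp_fun_def)
  have "integrable lebesgue (\<lambda>x. 2 powr p * (norm (f x) powr p + norm (g x) powr p))"
    using assms by (intro integrable_mult_right Bochner_Integration.integrable_add) (auto simp: Lp_fun_def)
  then have "integrable lebesgue (\<lambda>x. norm (f x + g x) powr p)"
    by (rule Bochner_Integration.integrable_bound) (use norm_add_powr_le[OF assms(1)] in \<open>auto\<close>)
  then show ?thesis by (simp add: Lp_fun_def)
qed

lemma Lp_fun_scaleR: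
  assumes "f \<in> Lp_fun p"
  shows "(\<lambda>x. c *\<^sub>R f x) \<in> Lp_fun p"
  using assms by (auto simp: Lp_fun_def powr_mult intro!: borel_measurable_scaleR)

lemma Lp_fun_AE:
  assumes "f \<in> Lp_fun p" and g: "g \<in> borel_measurable lebesgue" and AE: "AE x in lebesgue. f x = g x"
  shows "g \<in> Lp_fun p" and "Lp_norm p g = Lp_norm p f"
proof -
  have [measurable]: "f \<in> borel_measurable lebesgue" "g \<in> borel_measurable lebesgue"
    using assms by (auto simp: Lp_fun_def)
  have AE': "AE x in lebesgue. norm (f x) powr p = norm (g x) powr p" using AE by auto
  have "integrable lebesgue (\<lambda>x. norm (f x) powr p)" using assms by (simp add: Lp_fun_def)
  then show "g \<in> Lp_fun p"
    using integrable_cong_AE[OF _ _ AE'] by (simp add: Lp_fun_def)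
  show "Lp_norm p g = Lp_norm p f"
    using integral_cong_AE[OF _ _ AE'] by (simp add: Lp_norm_def)
qed

lemma conjugate_exponents:
  fixes p q :: real
  assumes "1 < p" "1 / p + 1 / q = 1"
  shows "1 < q" and "q * (p - 1) = p" and "p - p / q = 1"
proof -
  have "1 / p < 1" using assms by simp
  then have "0 < 1 / q" using assms by linarith
  then have q: "0 < q" by (simp add: zero_less_divide_iff)
  moreover have "1 / q < 1" using assms by (smt (verit) divide_pos_pos)
  ultimately show "1 < q" by (simp add: divide_less_eq)
  have *: "q + p = p * q" using assms q by (simp add: field_simps)
  then show "q * (p - 1) = p" by (simp add: algebra_simps)
  show "p - p / q = 1" using * q by (simp add: field_simps)
qed

text \<open>Young's inequality for the functions divided by their norms \<open>a\<close> and
  \<open>b\<close> is integrated. Integrability comes first, from the unscaled inequality, and a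
  vanishing norm is treated separately since it cannot be divided by.\<close>

lemma Lp_inner:
  fixes f g :: "'a::euclidean_space \<Rightarrow> 'b::euclidean_space"
  assumes pq: "1 < p" "1 / p + 1 / q = 1" and f: "f \<in> Lp_fun p" and g: "g \<in> Lp_fun q"
  shows "integrable lebesgue (\<lambda>x. f x \<bullet> g x)"
    and "\<bar>\<integral>x. f x \<bullet> g x \<partial>lebesgue\<bar> \<le> Lp_norm p f * Lp_norm q g"
proof -
  have q: "1 < q" using conjugate_exponents[OF pq] by simp
  have [measurable]: "f \<in> borel_measurable lebesgue" "g \<in> borel_measurable lebesgue"
    using f g by (auto simp: Lp_fun_def)
  have fi: "integrable lebesgue (\<lambda>x. norm (f x) powr p)" and gi: "integrable lebesgue (\<lambda>x. norm (g x) powr q)"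
    using f g by (auto simp: Lp_fun_def)
  define A where "A = (\<integral>x. norm (f x) powr p \<partial>lebesgue)"
  define B where "B = (\<integral>x. norm (g x) powr q \<partial>lebesgue)"
  have young: "\<bar>f x \<bullet> g x\<bar> \<le> a * b * (norm (f x) powr p / (p * a powr p) + norm (g x) powr q / (q * b powr q))"
    if "0 < a" "0 < b" for a b x
  proof -
    have "\<bar>f x \<bullet> g x\<bar> \<le> a * b * ((norm (f x) / a) * (norm (g x) / b))"
      using that Cauchy_Schwarz_ineq2[of "f x" "g x"] by simp
    also have "\<dots> \<le> a * b * ((norm (f x) / a) powr p / p + (norm (g x) / b) powr q / q)"
      using that pq q by (intro mult_left_mono Youngs_inequality) auto
    also have "\<dots> = a * b * (norm (f x) powr p / (p * a powr p) + norm (g x) powr q / (q * b powr q))"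
      using that by (simp add: powr_divide mult.commute)
    finally show ?thesis .
  qed
  show int: "integrable lebesgue (\<lambda>x. f x \<bullet> g x)"
  proof (rule Bochner_Integration.integrable_bound)
    show "integrable lebesgue (\<lambda>x. norm (f x) powr p / p + norm (g x) powr q / q)"
      using fi gi by simp
    show "AE x in lebesgue. norm (f x \<bullet> g x) \<le> norm (norm (f x) powr p / p + norm (g x) powr q / q)"
      using young[of 1 1] pq q by (auto intro!: AE_I2 order_trans[OF _ abs_ge_self])
  qed simp
  show "\<bar>\<integral>x. f x \<bullet> g x \<partial>lebesgue\<bar> \<le> Lp_norm p f * Lp_norm q g"
  proof (cases "A = 0 \<or> B = 0")
    case True
    then have "AE x in lebesgue. f x \<bullet> g x = 0"
    proof
      assume "A = 0"
      then have "AE x in lebesgue. norm (f x) powr p = 0"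
        using integral_nonneg_eq_0_iff_AE[OF fi] by (simp add: A_def)
      then show ?thesis by eventually_elim auto
    next
      assume "B = 0"
      then have "AE x in lebesgue. norm (g x) powr q = 0"
        using integral_nonneg_eq_0_iff_AE[OF gi] by (simp add: B_def)
      then show ?thesis by eventually_elim auto
    qed
    then have "(\<integral>x. f x \<bullet> g x \<partial>lebesgue) = 0"
      by (intro integral_eq_zero_AE)
    then show ?thesis by (simp add: Lp_norm_def)
  next
    case False
    have "0 \<le> A" "0 \<le> B" by (auto simp: A_def B_def)
    then have AB: "0 < A" "0 < B" using False by auto
    define a where "a = A powr (1/p)"
    define b where "b = B powr (1/q)"
    have ab: "0 < a" "0 < b" "a powr p = A" "b powr q = B"
      using AB pq q by (auto simp: a_def b_def powr_powr)
    have "\<bar>\<integral>x. f x \<bullet> g x \<partial>lebesgue\<bar> \<le> (\<integral>x. \<bar>f x \<bullet> g x\<bar> \<partial>lebesgue)" by (rule integral_abs_bound)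
    also have "\<dots> \<le> (\<integral>x. a * b * (norm (f x) powr p / (p * a powr p) + norm (g x) powr q / (q * b powr q)) \<partial>lebesgue)"
      using int fi gi young[OF ab(1,2)] by (intro integral_mono) auto
    also have "\<dots> = a * b * (A / (p * A) + B / (q * B))"
      using fi gi ab by (simp add: A_def B_def)
    also have "\<dots> = a * b" using AB pq by simp
    finally show ?thesis by (simp add: a_def b_def A_def B_def Lp_norm_def)
  qed
qed

text \<open>The convex function \<open>norm a powr p\<close> lies above its tangent at
  \<open>b\<close>. This is Young's inequality for \<open>norm a\<close> and
  \<open>norm b powr (p - 1)\<close>, because the conjugate exponent turns the latter into
  \<open>norm b powr p\<close>. In one dimension it contains Bernoulli's inequality.\<close>

lemma norm_powr_duality:
  fixes a b :: "'a::real_inner"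
  assumes "1 < p"
  shows "norm b powr p + p * ((norm b powr (p - 2) *\<^sub>R b) \<bullet> (a - b)) \<le> norm a powr p"
proof -
  define q where "q = p / (p - 1)"
  have q: "1 / p + 1 / q = 1" "1 < q" using assms by (auto simp: q_def field_simps)
  have bb: "norm b powr (p - 2) * norm b = norm b powr (p - 1)"
    by (cases "b = 0") (auto simp flip: powr_mult_base simp: mult.commute powr_mult_base)
  have bp: "norm b powr (p - 1) * norm b = norm b powr p"
    by (cases "b = 0") (auto simp: mult.commute powr_mult_base)
  have "(norm b powr (p - 2) *\<^sub>R b) \<bullet> a \<le> norm b powr (p - 1) * norm a"
  proof -
    have "(norm b powr (p - 2) *\<^sub>R b) \<bullet> a \<le> norm (norm b powr (p - 2) *\<^sub>R b) * norm a"
      by (rule norm_cauchy_schwarz)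
    then show ?thesis using bb by simp
  qed
  also have "\<dots> = norm a * norm b powr (p - 1)" by simp
  also have "\<dots> \<le> norm a powr p / p + (norm b powr (p - 1)) powr q / q"
    using assms q by (intro Youngs_inequality) auto
  also have "(norm b powr (p - 1)) powr q = norm b powr p"
    using assms by (simp add: powr_powr q_def)
  finally have "p * ((norm b powr (p - 2) *\<^sub>R b) \<bullet> a) \<le> p * (norm a powr p / p + norm b powr p / q)"
    using assms by (intro mult_left_mono) auto
  also have "\<dots> = norm a powr p + (p - 1) * norm b powr p"
    using assms by (simp add: q_def field_simps)
  finally have 1: "p * ((norm b powr (p - 2) *\<^sub>R b) \<bullet> a) \<le> norm a powr p + (p - 1) * norm b powr p" .
  have "(norm b powr (p - 2) *\<^sub>R b) \<bullet> b = norm b powr p"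
    using bb bp by (simp add: dot_square_norm power2_eq_square flip: mult.assoc)
  then show ?thesis using 1 by (simp add: inner_diff_right algebra_simps)
qed

text \<open>The subsequence is chosen so that \<open>\<integral>norm (f (r (k + 1)) - f (r k)) powr p \<le> 4\<^sup>-\<^sup>k\<close>; then
  \<open>S = \<Sum>k. 2\<^sup>k * norm (f (r (k + 1)) - f (r k)) powr p\<close> is integrable and controls the
  increments geometrically.\<close>

lemma Lp_Cauchy_subseq:
  fixes f :: "nat \<Rightarrow> 'a::euclidean_space \<Rightarrow> 'b::euclidean_space"
  assumes p: "0 < p" and f: "\<And>k. f k \<in> Lp_fun p"
    and Cauchy: "\<And>\<epsilon>. 0 < \<epsilon> \<Longrightarrow> \<exists>N. \<forall>k\<ge>N. \<forall>l\<ge>N. (\<integral>x. norm (f k x - f l x) powr p \<partial>lebesgue) < \<epsilon>"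
  shows "\<exists>r G S. strict_mono r \<and> G \<in> borel_measurable lebesgue \<and> integrable lebesgue S \<and>
    (AE x in lebesgue. (\<lambda>k. f (r k) x) \<longlonglongrightarrow> G x) \<and>
    (AE x in lebesgue. \<forall>k. norm (f (r k) x) powr p \<le> S x)"
proof -
  have [measurable]: "f k \<in> borel_measurable lebesgue" for k using f by (simp add: Lp_fun_def)
  have diff_int: "integrable lebesgue (\<lambda>x. norm (f k x - f l x) powr p)" for k l
    using Lp_fun_add[OF _ f[of k] Lp_fun_scaleR[OF f[of l], of "-1"]] p by (simp add: Lp_fun_def)
  define P where "P n N \<longleftrightarrow> (\<forall>k\<ge>N. \<forall>l\<ge>N. (\<integral>x. norm (f k x - f l x) powr p \<partial>lebesgue) < (1/4) ^ n)"
    for n N :: nat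
  have "\<exists>r. \<forall>n. P n (r n) \<and> r n < r (Suc n)"
  proof (rule dependent_nat_choice)
    show "\<exists>N. P 0 N" using Cauchy[of "(1/4)^0"] by (simp add: P_def)
    show "\<exists>N. P (Suc n) N \<and> m < N" for m n
    proof -
      obtain N where "P (Suc n) N" using Cauchy[of "(1/4)^Suc n"] by (auto simp: P_def)
      then have "P (Suc n) (max N (Suc m))" by (simp add: P_def)
      then show ?thesis by (intro exI[of _ "max N (Suc m)"]) auto
    qed
  qed
  then obtain r where "\<forall>n. P n (r n) \<and> r n < r (Suc n)" by (rule exE)
  then have r: "strict_mono r" "\<And>n. P n (r n)" by (auto simp: strict_mono_Suc_iff)
  define d where "d k x = f (r (Suc k)) x - f (r k) x" for k x
  define h where "h k x = 2 ^ k * norm (d k x) powr p" for k x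
  have h0: "0 \<le> h k x" for k x by (simp add: h_def)
  have [measurable]: "h k \<in> borel_measurable lebesgue" for k unfolding h_def d_def by measurable
  have hint: "integrable lebesgue (h k)" for k
    unfolding h_def d_def using diff_int by simp
  have hle: "(\<integral>x. h k x \<partial>lebesgue) \<le> (1/2) ^ k" for k
  proof -
    have "r k \<le> r (Suc k)" using r(1) by (simp add: strict_mono_less_eq)
    then have "(\<integral>x. norm (d k x) powr p \<partial>lebesgue) < (1/4) ^ k"
      using r(2)[of k] unfolding P_def d_def by auto
    then have "2 ^ k * (\<integral>x. norm (d k x) powr p \<partial>lebesgue) \<le> 2 ^ k * (1/4) ^ k"
      by (intro mult_left_mono) auto
    also have "\<dots> = (1/2 :: real) ^ k" by (simp flip: power_mult_distrib)
    finally show ?thesis by (simp add: h_def)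
  qed
  have "(\<integral>\<^sup>+x. (\<Sum>k. ennreal (h k x)) \<partial>lebesgue) = (\<Sum>k. \<integral>\<^sup>+x. ennreal (h k x) \<partial>lebesgue)"
    by (intro nn_integral_suminf) simp
  also have "\<dots> = (\<Sum>k. ennreal (\<integral>x. h k x \<partial>lebesgue))"
    using hint h0 by (intro suminf_cong nn_integral_eq_integral) auto
  also have "\<dots> \<le> (\<Sum>k. ennreal ((1/2) ^ k))"
    using hle by (intro suminf_le ennreal_leI) auto
  also have "\<dots> = ennreal (\<Sum>k. (1/2) ^ k)"
    by (intro suminf_ennreal2) auto
  also have "\<dots> < top" by simp
  finally have "(\<integral>\<^sup>+x. (\<Sum>k. ennreal (h k x)) \<partial>lebesgue) \<noteq> \<infinity>"
    by simp
  then have "AE x in lebesgue. (\<Sum>k. ennreal (h k x)) \<noteq> \<infinity>"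
    by (intro nn_integral_PInf_AE) auto
  then have summ: "AE x in lebesgue. summable (\<lambda>k. h k x)"
    by eventually_elim (rule summable_suminf_not_top, use h0 in auto)
  define S0 where "S0 x = (\<Sum>k. h k x)" for x
  have "summable (\<lambda>k. \<integral>x. norm (h k x) \<partial>lebesgue)"
    by (rule summable_comparison_test'[OF summable_geometric[of "1/2"], where N = 0]) (use h0 hle in auto)
  then have S0int: "integrable lebesgue S0"
    unfolding S0_def using summ h0 hint by (intro integrable_suminf) auto
  \<comment> \<open>Each increment satisfies
    \<open>norm (d k x) powr p \<le> S0 x * (1/2) ^ k\<close>, so the norms themselves decay
    geometrically with the \<open>p\<close>-th root of 1/2 as ratio.\<close>
  define c where "c = (1/2::real) powr (1 / p)"
  have c: "0 < c" "c < 1"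
    using p powr_less_mono2[of "1/p" "1/2" 1] by (auto simp: c_def)
  \<comment> \<open>\<open>S0\<close> controls only the increments; the majorant also pays for the
    starting function and for the sum \<open>s / (1 - c)\<close> of the geometric series.\<close>
  define S where "S x = 2 powr p * (norm (f (r 0) x) powr p + S0 x / (1 - c) powr p)" for x
  have "integrable lebesgue S"
    unfolding S_def using S0int f by (auto simp: Lp_fun_def)
  have main: "convergent (\<lambda>k. f (r k) x) \<and> (\<forall>k. norm (f (r k) x) powr p \<le> S x)"
    if sm: "summable (\<lambda>k. h k x)" for x
  proof -
    have S0: "0 \<le> S0 x" unfolding S0_def using sm h0 by (intro suminf_nonneg) auto
    define s where "s = S0 x powr (1 / p)"
    have s: "0 \<le> s" "s powr p = S0 x" using p S0 by (auto simp: s_def powr_powr)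
    have dle: "norm (d k x) \<le> s * c ^ k" for k
    proof -
      have "h k x \<le> S0 x" unfolding S0_def using sum_le_suminf[OF sm, of "{k}"] h0 by simp
      then have "norm (d k x) powr p \<le> S0 x * (1/2) ^ k"
        by (simp add: h_def field_simps power_divide)
      then have "(norm (d k x) powr p) powr (1/p) \<le> (S0 x * (1/2) ^ k) powr (1/p)"
        using p by (intro powr_mono2) auto
      also have "\<dots> = s * ((1/2) ^ k) powr (1/p)" by (simp add: powr_mult s_def)
      also have "((1/2::real) ^ k) powr (1/p) = c ^ k"
        by (simp add: c_def powr_powr powr_power flip: powr_realpow)
      finally show ?thesis using p by (simp add: powr_powr)
    qed
    have geo: "summable (\<lambda>k. s * c ^ k)" using c by (intro summable_mult summable_geometric) auto
    have "summable (\<lambda>k. d k x)" using dle by (intro summable_comparison_test'[OF geo]) auto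
    then have "convergent (\<lambda>n. \<Sum>k<n. d k x)" by (simp add: summable_iff_convergent)
    moreover have tele: "(\<Sum>k<n. d k x) = f (r n) x - f (r 0) x" for n
      unfolding d_def by (rule sum_lessThan_telescope)
    ultimately have "convergent (\<lambda>n. f (r n) x - f (r 0) x)" by simp
    then have conv: "convergent (\<lambda>n. f (r n) x)"
      using convergent_add[OF _ convergent_const[of "f (r 0) x"]] by fastforce
    have "norm (f (r n) x) powr p \<le> S x" for n
    proof -
      have "norm (f (r n) x - f (r 0) x) \<le> (\<Sum>k<n. norm (d k x))"
        unfolding tele[symmetric] by (rule norm_sum)
      also have "\<dots> \<le> (\<Sum>k<n. s * c ^ k)" by (intro sum_mono dle)
      also have "\<dots> \<le> (\<Sum>k. s * c ^ k)" using s c by (intro sum_le_suminf geo) auto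
      also have "\<dots> = s / (1 - c)" using c by (simp add: suminf_mult suminf_geometric)
      finally have "norm (f (r n) x - f (r 0) x) powr p \<le> (s / (1 - c)) powr p"
        using p by (intro powr_mono2) auto
      also have "\<dots> = S0 x / (1 - c) powr p" using s c by (simp add: powr_divide)
      finally have *: "norm (f (r n) x - f (r 0) x) powr p \<le> S0 x / (1 - c) powr p" .
      have "norm (f (r 0) x + (f (r n) x - f (r 0) x)) powr p \<le>
          2 powr p * (norm (f (r 0) x) powr p + norm (f (r n) x - f (r 0) x) powr p)"
        using p by (intro norm_add_powr_le) auto
      also have "\<dots> \<le> S x" unfolding S_def using * by (intro mult_left_mono add_left_mono) auto
      finally show ?thesis by simp
    qed
    then show ?thesis using conv by blast
  qed
  have G: "(\<lambda>x. lim (\<lambda>k. f (r k) x)) \<in> borel_measurable lebesgue" by measurable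
  have "AE x in lebesgue. (\<lambda>k. f (r k) x) \<longlonglongrightarrow> lim (\<lambda>k. f (r k) x)"
    using summ by eventually_elim (use main in \<open>auto simp: convergent_LIMSEQ_iff\<close>)
  moreover have "AE x in lebesgue. \<forall>k. norm (f (r k) x) powr p \<le> S x"
    using summ by eventually_elim (use main in auto)
  ultimately show ?thesis using r(1) G \<open>integrable lebesgue S\<close> by blast
qed

text \<open>Dominated convergence, with a majorant built from \<open>S\<close> and
  \<open>norm (V x) powr p\<close>. The perturbation \<open>V\<close> is carried along because the
  limit is taken both for the energies, with \<open>V = 0\<close>, and for energies perturbed by a
  weak gradient.\<close>

lemma Lp_dominated_limit:
  fixes f :: "nat \<Rightarrow> 'a::euclidean_space \<Rightarrow> 'b::euclidean_space"
  assumes p: "0 < p" and f: "\<And>k. f k \<in> borel_measurable lebesgue" and V: "V \<in> Lp_fun p"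
    and G: "G \<in> borel_measurable lebesgue" and S: "integrable lebesgue S"
    and lim: "AE x in lebesgue. (\<lambda>k. f k x) \<longlonglongrightarrow> G x"
    and dom: "AE x in lebesgue. \<forall>k. norm (f k x) powr p \<le> S x"
  shows "(\<lambda>x. G x + V x) \<in> Lp_fun p"
    and "(\<lambda>k. \<integral>x. norm (f k x + V x) powr p \<partial>lebesgue) \<longlonglongrightarrow> (\<integral>x. norm (G x + V x) powr p \<partial>lebesgue)"
proof -
  have [measurable]: "f k \<in> borel_measurable lebesgue" "V \<in> borel_measurable lebesgue"
    "G \<in> borel_measurable lebesgue" for k using f V G by (auto simp: Lp_fun_def)
  have w: "integrable lebesgue (\<lambda>x. 2 powr p * (S x + norm (V x) powr p))"
    using S V by (auto simp: Lp_fun_def)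
  have l: "AE x in lebesgue. (\<lambda>k. norm (f k x + V x) powr p) \<longlonglongrightarrow> norm (G x + V x) powr p"
    using lim by eventually_elim (use p in \<open>auto intro!: tendsto_intros tendsto_powr'\<close>)
  have b: "AE x in lebesgue. norm (norm (f k x + V x) powr p) \<le> 2 powr p * (S x + norm (V x) powr p)" for k
    using dom
  proof eventually_elim
    case (elim x)
    have "norm (f k x + V x) powr p \<le> 2 powr p * (norm (f k x) powr p + norm (V x) powr p)"
      using p by (intro norm_add_powr_le) auto
    also have "\<dots> \<le> 2 powr p * (S x + norm (V x) powr p)"
      using elim by (intro mult_left_mono add_right_mono) auto
    finally show ?case by simp
  qed
  have "integrable lebesgue (\<lambda>x. norm (G x + V x) powr p)"
    by (rule integrable_dominated_convergence[OF _ _ w l b]) measurable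
  then show "(\<lambda>x. G x + V x) \<in> Lp_fun p" by (simp add: Lp_fun_def)
  show "(\<lambda>k. \<integral>x. norm (f k x + V x) powr p \<partial>lebesgue) \<longlonglongrightarrow> (\<integral>x. norm (G x + V x) powr p \<partial>lebesgue)"
    by (rule integral_dominated_convergence[OF _ _ w l b]) measurable
qed

section \<open>Smooth functions\<close>

lemma partial_deriv_eq:
  assumes "(f has_derivative f') (at x)"
  shows "partial_deriv i f x = f' (axis i 1)"
  using frechet_derivative_at[OF assms] by (simp add: partial_deriv_def)

lemma has_derivative_partial_deriv:
  fixes f :: "real ^ 'n \<Rightarrow> real"
  assumes "f differentiable (at x)"
  shows "(f has_derivative (\<lambda>v. \<Sum>j\<in>UNIV. v $ j * partial_deriv j f x)) (at x)"
proof -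
  have d: "(f has_derivative frechet_derivative f (at x)) (at x)"
    using assms by (simp add: frechet_derivative_works)
  then interpret linear "frechet_derivative f (at x)" by (rule has_derivative_linear)
  have "frechet_derivative f (at x) v = (\<Sum>j\<in>UNIV. v $ j * partial_deriv j f x)" for v
  proof -
    have "frechet_derivative f (at x) v = frechet_derivative f (at x) (\<Sum>j\<in>UNIV. v $ j *\<^sub>R axis j 1)"
      using basis_expansion[of v] by (simp add: scalar_mult_eq_scaleR)
    also have "\<dots> = (\<Sum>j\<in>UNIV. v $ j * partial_deriv j f x)"
      by (simp add: sum scaleR partial_deriv_def)
    finally show ?thesis .
  qed
  then have "frechet_derivative f (at x) = (\<lambda>v. \<Sum>j\<in>UNIV. v $ j * partial_deriv j f x)" by blast
  with d show ?thesis by simp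
qed

text \<open>The recursion for \<open>C_diff (Suc k)\<close> does not mention lower orders; only at
  its end, where continuity is asked for, does differentiability have to step in.\<close>

lemma C_diff_Suc_imp: "C_diff (Suc k) f \<Longrightarrow> C_diff k f"
proof (induction k arbitrary: f)
  case 0
  then show ?case by (auto intro: differentiable_imp_continuous_on simp: differentiable_on_def)
next
  case (Suc k)
  then show ?case using C_diff.simps(2)[of k f] C_diff.simps(2)[of "Suc k" f] by blast
qed

lemma C_diff_continuous: "C_diff k f \<Longrightarrow> continuous_on UNIV f"
  by (induction k) (auto dest: C_diff_Suc_imp simp del: C_diff.simps(2))

lemma C_diff_const: "C_diff k (\<lambda>x :: real ^ 'n. c)"
proof (induction k arbitrary: c)
  case (Suc k)
  have "partial_deriv i (\<lambda>x :: real ^ 'n. c) = (\<lambda>x. 0)" for i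
    by (rule ext) (subst partial_deriv_eq[of _ "\<lambda>v. 0"], auto)
  then show ?case using Suc by simp
qed simp

lemma partial_deriv_add:
  assumes "f differentiable (at x)" "g differentiable (at x)"
  shows "partial_deriv i (\<lambda>x. f x + g x) x = partial_deriv i f x + partial_deriv i g x"
proof -
  have "((\<lambda>x. f x + g x) has_derivative
      (\<lambda>h. frechet_derivative f (at x) h + frechet_derivative g (at x) h)) (at x)"
    using assms by (intro has_derivative_add) (auto simp: frechet_derivative_works)
  then show ?thesis by (simp add: partial_deriv_eq) (simp add: partial_deriv_def)
qed

lemma partial_deriv_mult:
  assumes "f differentiable (at x)" "g differentiable (at x)"
  shows "partial_deriv i (\<lambda>x. f x * g x) x = f x * partial_deriv i g x + partial_deriv i f x * g x"
proof -
  have "((\<lambda>x. f x * g x) has_derivative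
      (\<lambda>h. f x * frechet_derivative g (at x) h + frechet_derivative f (at x) h * g x)) (at x)"
    using assms by (intro has_derivative_mult) (auto simp: frechet_derivative_works)
  then show ?thesis by (simp add: partial_deriv_eq) (simp add: partial_deriv_def)
qed

lemma C_diff_add: "C_diff k f \<Longrightarrow> C_diff k g \<Longrightarrow> C_diff k (\<lambda>x. f x + g x)"
proof (induction k arbitrary: f g)
  case (Suc k)
  then have "partial_deriv i (\<lambda>x. f x + g x) = (\<lambda>x. partial_deriv i f x + partial_deriv i g x)" for i
    by (intro ext partial_deriv_add) auto
  with Suc show ?case by simp
qed (auto intro: continuous_intros)

lemma C_diff_mult: "C_diff k f \<Longrightarrow> C_diff k g \<Longrightarrow> C_diff k (\<lambda>x. f x * g x)"
proof (induction k arbitrary: f g)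
  case (Suc k)
  then have "partial_deriv i (\<lambda>x. f x * g x) = (\<lambda>x. f x * partial_deriv i g x + partial_deriv i f x * g x)" for i
    by (intro ext partial_deriv_mult) auto
  moreover have "C_diff k f" "C_diff k g" using Suc by (auto dest: C_diff_Suc_imp simp del: C_diff.simps(2))
  ultimately show ?case using Suc by (simp add: C_diff_add)
qed (auto intro: continuous_intros)

lemma C_diff_sum: "finite I \<Longrightarrow> (\<And>i. i \<in> I \<Longrightarrow> C_diff k (f i)) \<Longrightarrow> C_diff k (\<lambda>x. \<Sum>i\<in>I. f i x)"
  by (induction I rule: finite_induct) (auto intro: C_diff_add C_diff_const)

lemma C_diff_prod: "finite I \<Longrightarrow> (\<And>i. i \<in> I \<Longrightarrow> C_diff k (f i)) \<Longrightarrow> C_diff k (\<lambda>x. \<Prod>i\<in>I. f i x)"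
  by (induction I rule: finite_induct) (auto intro: C_diff_mult C_diff_const)

text \<open>Stated for a whole sequence in which each function is the derivative of its predecessor:
  a partial derivative of \<open>c m (x $ j)\<close> is a constant multiple of
  \<open>c (Suc m) (x $ j)\<close>, so the induction on the order closes.\<close>

lemma C_diff_coordinate:
  fixes c :: "nat \<Rightarrow> real \<Rightarrow> real"
  assumes "\<And>m t. (c m has_real_derivative c (Suc m) t) (at t)"
  shows "C_diff k (\<lambda>x. c m (x $ j))"
proof (induction k arbitrary: m)
  case 0
  have "continuous_on UNIV (c m)" using assms by (meson DERIV_continuous_on DERIV_subset subset_UNIV has_field_derivative_at_within)
  then show ?case by (auto intro!: continuous_intros elim: continuous_on_compose2)
next
  case (Suc k)
  have d: "((\<lambda>x. c m (x $ j)) has_derivative (\<lambda>v. c (Suc m) (x $ j) * v $ j)) (at x)" for x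
    using assms[of m "x $ j"] unfolding has_field_derivative_def
    by (intro has_derivative_compose[of "\<lambda>x. x $ j" "\<lambda>v. v $ j" x UNIV "c m"])
      (auto intro: bounded_linear_imp_has_derivative bounded_linear_vec_nth)
  have "partial_deriv i (\<lambda>x. c m (x $ j)) = (\<lambda>x. c (Suc m) (x $ j) * (axis i 1 $ j))" for i
    by (rule ext) (rule partial_deriv_eq[OF d])
  then show ?case using Suc d unfolding C_diff.simps differentiable_def
    by (auto intro!: C_diff_mult C_diff_const)
qed

lemma partial_deriv_affine:
  fixes A :: "real ^ 'm \<Rightarrow> real ^ 'n"
  assumes f: "f differentiable (at (A x + b))" and A: "linear A"
  shows "((\<lambda>x. f (A x + b)) has_derivative (\<lambda>v. \<Sum>j\<in>UNIV. A v $ j * partial_deriv j f (A x + b))) (at x)"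
proof -
  have "((\<lambda>x. A x + b) has_derivative A) (at x)"
    using linear_imp_has_derivative[OF A] by (auto intro!: derivative_eq_intros)
  from has_derivative_compose[OF this has_derivative_partial_deriv[OF f]] show ?thesis .
qed

lemma C_diff_affine:
  fixes A :: "real ^ 'm \<Rightarrow> real ^ 'n"
  assumes "C_diff k f" and A: "linear A"
  shows "C_diff k (\<lambda>x. f (A x + b))"
  using assms(1)
proof (induction k arbitrary: f)
  case 0
  have "continuous_on UNIV A" using A by (simp add: linear_continuous_on linear_conv_bounded_linear)
  then have "continuous_on UNIV (\<lambda>x. A x + b)" by (intro continuous_intros)
  with 0 show ?case by (auto elim: continuous_on_compose2)
next
  case (Suc k)
  have d: "((\<lambda>x. f (A x + b)) has_derivative (\<lambda>v. \<Sum>j\<in>UNIV. A v $ j * partial_deriv j f (A x + b))) (at x)" for x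
    using Suc by (intro partial_deriv_affine A) auto
  have "partial_deriv i (\<lambda>x. f (A x + b)) = (\<lambda>x. \<Sum>j\<in>UNIV. A (axis i 1) $ j * partial_deriv j f (A x + b))" for i
    by (rule ext) (rule partial_deriv_eq[OF d])
  moreover have "C_diff k (\<lambda>x. \<Sum>j\<in>UNIV. A (axis i 1) $ j * partial_deriv j f (A x + b))" for i
    using Suc by (intro C_diff_sum C_diff_mult C_diff_const) auto
  ultimately show ?case using d unfolding C_diff.simps differentiable_def by auto
qed

lemma test_functionsI:
  fixes \<phi> :: "real ^ 'n \<Rightarrow> real"
  assumes "\<And>k. C_diff k \<phi>" and "\<And>x. \<phi> x \<noteq> 0 \<Longrightarrow> norm x \<le> R"
  shows "\<phi> \<in> test_functions"
proof -
  have "bounded {x. \<phi> x \<noteq> 0}" using assms(2) by (auto simp: bounded_iff)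
  then show ?thesis using assms(1) by (simp add: test_functions_def compact_closure)
qed

lemma test_functions_support:
  assumes "\<phi> \<in> test_functions"
  shows "\<exists>R. \<forall>x. \<phi> x \<noteq> 0 \<longrightarrow> norm x \<le> R"
proof -
  have "bounded {x. \<phi> x \<noteq> 0}" using assms by (simp add: test_functions_def)
  then show ?thesis by (auto simp: bounded_iff)
qed

lemma test_functions_C_diff: "\<phi> \<in> test_functions \<Longrightarrow> C_diff k \<phi>"
  by (simp add: test_functions_def)

lemma test_functions_differentiable: "\<phi> \<in> test_functions \<Longrightarrow> \<phi> differentiable (at x)"
  using test_functions_C_diff[of \<phi> 1] by simp

lemma test_functions_continuous: "\<phi> \<in> test_functions \<Longrightarrow> continuous_on UNIV \<phi>"
  using C_diff_continuous[OF test_functions_C_diff] by blast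

lemma test_functions_mult:
  assumes "\<And>k. C_diff k f" "\<phi> \<in> test_functions"
  shows "(\<lambda>x. f x * \<phi> x) \<in> test_functions"
proof -
  obtain R where "\<forall>x. \<phi> x \<noteq> 0 \<longrightarrow> norm x \<le> R" using test_functions_support[OF assms(2)] by blast
  then show ?thesis
    using C_diff_mult[OF assms(1) test_functions_C_diff[OF assms(2)]]
    by (intro test_functionsI[of _ R]) auto
qed

lemma test_functions_partial_deriv:
  assumes "\<phi> \<in> test_functions"
  shows "partial_deriv i \<phi> \<in> test_functions"
proof -
  obtain R where R: "\<And>x. \<phi> x \<noteq> 0 \<Longrightarrow> norm x \<le> R" using test_functions_support[OF assms] by blast
  show ?thesis
  proof (rule test_functionsI[of _ R])
    show "C_diff k (partial_deriv i \<phi>)" for k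
      using test_functions_C_diff[OF assms, of "Suc k"] by simp
    show "norm x \<le> R" if "partial_deriv i \<phi> x \<noteq> 0" for x
    proof (rule ccontr)
      assume "\<not> norm x \<le> R"
      then have "x \<in> - cball 0 R" by (simp add: mem_cball_0)
      moreover have "open (- cball (0 :: real ^ 'a) R)" by (simp add: open_Compl)
      moreover have "0 = \<phi> y" if "y \<in> - cball 0 R" for y
        using R[of y] that by (auto simp: mem_cball_0)
      ultimately have "(\<phi> has_derivative (\<lambda>v. 0)) (at x)"
        by (intro has_derivative_transform_within_open[OF has_derivative_const[of 0]])
      from partial_deriv_eq[OF this] show False using that by simp
    qed
  qed
qed

lemma test_functions_affine:
  fixes \<phi> :: "real ^ 'n \<Rightarrow> real" and A :: "real ^ 'n \<Rightarrow> real ^ 'n"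
  assumes "\<phi> \<in> test_functions" and A: "linear A" and "0 < c" "\<And>x. c * norm x \<le> norm (A x)"
  shows "(\<lambda>x. \<phi> (A x + b)) \<in> test_functions"
proof -
  obtain R where R: "\<And>x. \<phi> x \<noteq> 0 \<Longrightarrow> norm x \<le> R" using test_functions_support[OF assms(1)] by blast
  show ?thesis
  proof (rule test_functionsI[of _ "(R + norm b) / c"])
    show "C_diff k (\<lambda>x. \<phi> (A x + b))" for k
      using assms by (intro C_diff_affine test_functions_C_diff)
    fix x assume "\<phi> (A x + b) \<noteq> 0"
    then have "norm (A x + b) \<le> R" by (rule R)
    then have "c * norm x \<le> R + norm b"
      using assms(4)[of x] norm_triangle_ineq4[of "A x + b" b] by simp
    then show "norm x \<le> (R + norm b) / c" using assms(3) by (simp add: field_simps)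
  qed
qed

lemma continuous_compact_support_integrable:
  fixes f :: "'a::euclidean_space \<Rightarrow> 'b::euclidean_space"
  assumes f: "continuous_on UNIV f" and R: "\<And>x. f x \<noteq> 0 \<Longrightarrow> norm x \<le> R"
  shows "integrable lborel f" "integrable lebesgue f"
proof -
  have "integrable lborel (\<lambda>x. indicator (cball 0 R) x *\<^sub>R f x)"
    using borel_integrable_compact[of "cball 0 R" f] continuous_on_subset[OF f] by simp
  also have "(\<lambda>x. indicator (cball 0 R) x *\<^sub>R f x) = f"
    using R by (auto simp: indicator_def fun_eq_iff)
  finally show 1: "integrable lborel f" .
  then show "integrable lebesgue f" by (simp add: integrable_completion borel_measurable_integrable)
qed

section \<open>Smooth bumps\<close>

definition flat_exp :: "real poly \<Rightarrow> real \<Rightarrow> real" where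
  "flat_exp P t = (if 0 < t then poly P (1 / t) * exp (- 1 / t) else 0)"

lemma poly_over_exp_tendsto_0:
  fixes P :: "real poly"
  shows "((\<lambda>y. poly P y * exp (- y)) \<longlongrightarrow> 0) at_top"
proof -
  \<comment> \<open>The power \<open>y ^ k\<close> is there for the induction: splitting off the
    constant term of a polynomial leaves a factor \<open>y\<close>.\<close>
  have "((\<lambda>y. y ^ k * poly P y * exp (- y)) \<longlongrightarrow> 0) at_top" for k
  proof (induction P arbitrary: k)
    case (pCons a P)
    have "((\<lambda>y. a * (y ^ k / exp y) + y ^ Suc k * poly P y * exp (- y)) \<longlongrightarrow> a * 0 + 0) at_top"
      by (intro tendsto_intros tendsto_power_div_exp_0 pCons.IH)
    then show ?case by (simp add: algebra_simps exp_minus divide_inverse)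
  qed simp
  from this[of 0] show ?thesis by simp
qed

text \<open>Differentiating \<open>P(1/t) exp (-1/t)\<close> gives a function of the same form with
  \<open>P\<close> replaced by \<open>X^2 (P - P')\<close>. Admitting all polynomials thus yields
  the derivatives of every order at once; at 0 they all vanish because the exponential beats every
  polynomial.\<close>

lemma flat_exp_has_derivative:
  "(flat_exp P has_real_derivative flat_exp ([:0, 0, 1:] * (P - pderiv P)) t) (at t)"
proof -
  consider "t < 0" | "t > 0" | "t = 0" by linarith
  then show ?thesis
  proof cases
    case 1
    have "((\<lambda>t. 0) has_real_derivative 0) (at t)" by simp
    then have "(flat_exp P has_real_derivative 0) (at t)"
      by (rule has_field_derivative_transform_within_open[of _ _ _ "{..<0}"]) (use 1 in \<open>auto simp: flat_exp_def\<close>)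
    then show ?thesis using 1 by (simp add: flat_exp_def)
  next
    case 2
    have "((\<lambda>t. poly P (1 / t) * exp (- 1 / t)) has_real_derivative
        (poly (pderiv P) (1 / t) * (- 1 / t\<^sup>2)) * exp (- 1 / t) + (exp (- 1 / t) * (1 / t\<^sup>2)) * poly P (1 / t)) (at t)"
      using 2 by (auto intro!: derivative_eq_intros DERIV_chain2[OF poly_DERIV] simp: power2_eq_square)
    then have "(flat_exp P has_real_derivative
        (poly (pderiv P) (1 / t) * (- 1 / t\<^sup>2)) * exp (- 1 / t) + (exp (- 1 / t) * (1 / t\<^sup>2)) * poly P (1 / t)) (at t)"
      by (rule has_field_derivative_transform_within_open[of _ _ _ "{0<..}"]) (use 2 in \<open>auto simp: flat_exp_def\<close>)
    moreover have "(poly (pderiv P) (1 / t) * (- 1 / t\<^sup>2)) * exp (- 1 / t) + (exp (- 1 / t) * (1 / t\<^sup>2)) * poly P (1 / t)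
        = flat_exp ([:0, 0, 1:] * (P - pderiv P)) t"
      using 2 by (simp add: flat_exp_def field_simps power2_eq_square)
    ultimately show ?thesis by simp
  next
    case 3
    \<comment> \<open>With \<open>y = 1 / h\<close> the difference quotient from the right is
      \<open>y * poly P y * exp (- y)\<close>; \<open>pCons 0\<close> absorbs the factor
      \<open>y\<close>.\<close>
    have "((\<lambda>h. poly (pCons 0 P) (inverse h) * exp (- inverse h)) \<longlongrightarrow> 0) (at_right 0)"
      using filterlim_compose[OF poly_over_exp_tendsto_0 filterlim_inverse_at_top_right] .
    then have "((\<lambda>h. flat_exp P h / h) \<longlongrightarrow> 0) (at_right 0)"
      by (rule Lim_transform_eventually)
        (auto simp: eventually_at_right_field flat_exp_def divide_inverse mult_ac intro!: exI[of _ 1])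
    moreover have "((\<lambda>h. flat_exp P h / h) \<longlongrightarrow> 0) (at_left 0)"
      by (rule Lim_transform_eventually[of "\<lambda>h. 0"])
        (auto simp: eventually_at_left_field flat_exp_def intro!: exI[of _ "-1"])
    ultimately have "((\<lambda>h. flat_exp P h / h) \<longlongrightarrow> 0) (at 0)" by (simp add: filterlim_split_at)
    then show ?thesis using 3 by (simp add: DERIV_def flat_exp_def)
  qed
qed

lemma C_diff_flat_exp: "C_diff k (\<lambda>x. flat_exp P (x $ j))"
proof -
  define c where "c m = flat_exp (((\<lambda>Q. [:0, 0, 1:] * (Q - pderiv Q)) ^^ m) P)" for m
  have "C_diff k (\<lambda>x. c 0 (x $ j))"
    by (rule C_diff_coordinate) (simp add: c_def flat_exp_has_derivative del: mult_pCons_left)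
  then show ?thesis by (simp add: c_def)
qed

text \<open>For \<open>m > 0\<close> a smooth function that is positive exactly on the open box;
  with growing \<open>m\<close> its walls steepen and it tends to the indicator of the box. The
  arguments of \<open>flat_exp\<close> are written as affine maps of \<open>x\<close> so that
  smoothness follows from affine substitution.\<close>

definition box_bump :: "nat \<Rightarrow> real ^ 'n \<Rightarrow> real ^ 'n \<Rightarrow> real ^ 'n \<Rightarrow> real" where
  "box_bump m a b x = (\<Prod>j\<in>UNIV. flat_exp 1 ((real m *\<^sub>R x + (- real m *\<^sub>R a)) $ j) * flat_exp 1 ((- real m *\<^sub>R x + real m *\<^sub>R b) $ j))"

lemma flat_exp_1: "0 \<le> flat_exp 1 t" "flat_exp 1 t \<le> 1" "flat_exp 1 t = 0 \<longleftrightarrow> t \<le> 0"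
  by (auto simp: flat_exp_def)

lemma box_bump_bounds: "0 \<le> box_bump m a b x" "box_bump m a b x \<le> 1"
proof -
  show "0 \<le> box_bump m a b x"
    unfolding box_bump_def by (intro prod_nonneg mult_nonneg_nonneg flat_exp_1)
  show "box_bump m a b x \<le> 1"
    unfolding box_bump_def by (intro prod_le_1 conjI mult_nonneg_nonneg mult_le_one flat_exp_1)
qed

lemma box_bump_pos_iff:
  assumes "0 < m" shows "box_bump m a b x \<noteq> 0 \<longleftrightarrow> x \<in> box a b"
  using assms by (auto simp: box_bump_def flat_exp_1 mem_box_cart not_le mult.commute[of "real m"])

lemma box_bump_test_function:
  assumes "0 < m" shows "box_bump m a b \<in> test_functions"
proof -
  obtain R where "\<And>x. x \<in> box a b \<Longrightarrow> norm x \<le> R" using bounded_box[of a b] by (auto simp: bounded_iff)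
  then show ?thesis
  proof (intro test_functionsI[of _ R])
    show "C_diff k (box_bump m a b)" for k unfolding box_bump_def
      by (intro C_diff_prod C_diff_mult C_diff_affine[OF C_diff_flat_exp linear_scaleR]) auto
  qed (use box_bump_pos_iff[OF assms] in blast)
qed

lemma box_bump_tendsto:
  "(\<lambda>m. box_bump (Suc m) a b x) \<longlonglongrightarrow> indicator (box a b) x"
proof (cases "x \<in> box a b")
  case False
  then show ?thesis using box_bump_pos_iff[of "Suc _" a b x] by simp
next
  case True
  have "(\<lambda>m. flat_exp 1 (real (Suc m) * d)) \<longlonglongrightarrow> 1" if "0 < d" for d
  proof -
    have "(\<lambda>m. exp (- (1 / d) * inverse (real (Suc m)))) \<longlonglongrightarrow> exp (- (1 / d) * 0)"
      by (intro tendsto_intros LIMSEQ_inverse_real_of_nat)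
    moreover have "(\<lambda>m. flat_exp 1 (real (Suc m) * d)) = (\<lambda>m. exp (- (1 / d) * inverse (real (Suc m))))"
      using that by (auto simp: fun_eq_iff flat_exp_def inverse_eq_divide mult.commute simp del: of_nat_Suc)
    ultimately show ?thesis by simp
  qed
  note lim = this
  have "(\<lambda>m. box_bump (Suc m) a b x) = (\<lambda>m. \<Prod>j\<in>UNIV. flat_exp 1 (real (Suc m) * (x $ j - a $ j)) * flat_exp 1 (real (Suc m) * (b $ j - x $ j)))"
    unfolding box_bump_def by (intro ext prod.cong) (auto simp: algebra_simps)
  moreover have "(\<lambda>m. \<Prod>j\<in>UNIV. flat_exp 1 (real (Suc m) * (x $ j - a $ j)) * flat_exp 1 (real (Suc m) * (b $ j - x $ j)))
      \<longlonglongrightarrow> (\<Prod>j\<in>(UNIV :: 'a set). 1 * 1)"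
    using True by (intro tendsto_prod tendsto_mult lim) (auto simp: mem_box_cart)
  ultimately show ?thesis using True by simp
qed

section \<open>Weak derivatives\<close>

lemma test_functions_bounded:
  assumes "\<phi> \<in> test_functions"
  shows "\<exists>B. \<forall>x. \<bar>\<phi> x\<bar> \<le> B"
proof -
  obtain R where R: "\<And>x. \<phi> x \<noteq> 0 \<Longrightarrow> norm x \<le> R" using test_functions_support[OF assms] by blast
  have "compact (\<phi> ` cball 0 R)"
    using test_functions_continuous[OF assms] by (intro compact_continuous_image) (auto intro: continuous_on_subset)
  then obtain B where B: "\<forall>y\<in>\<phi> ` cball 0 R. norm y \<le> B"
    using compact_imp_bounded bounded_iff by blast
  have "\<bar>\<phi> x\<bar> \<le> \<bar>B\<bar>" for x
    using R[of x] B by (cases "\<phi> x = 0") (auto intro: order_trans[OF _ abs_ge_self])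
  then show ?thesis by blast
qed

lemma test_functions_integrable:
  assumes "\<phi> \<in> test_functions"
  shows "integrable lebesgue \<phi>"
proof -
  obtain R where R: "\<And>x. \<phi> x \<noteq> 0 \<Longrightarrow> norm x \<le> R" using test_functions_support[OF assms] by blast
  show ?thesis by (rule continuous_compact_support_integrable(2)[OF test_functions_continuous[OF assms] R])
qed

lemma continuous_borel_measurable_lebesgue:
  "continuous_on UNIV f \<Longrightarrow> f \<in> borel_measurable lebesgue"
  using measurable_completion[of f lborel borel] borel_measurable_continuous_onI[of f] by simp

lemma lebesgue_integral_continuous:
  fixes f :: "'a::euclidean_space \<Rightarrow> 'b::{banach, second_countable_topology}"
  assumes "continuous_on UNIV f"
  shows "integral\<^sup>L lebesgue f = integral\<^sup>L lborel f"
  using borel_measurable_continuous_onI[OF assms] by (intro integral_completion) simp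

lemma partial_deriv_line:
  fixes \<phi> :: "real ^ 'n \<Rightarrow> real"
  assumes "\<And>x. \<phi> differentiable (at x)"
  shows "((\<lambda>s. \<phi> (x + s *\<^sub>R axis i 1)) has_real_derivative partial_deriv i \<phi> (x + s *\<^sub>R axis i 1)) (at s)"
proof -
  have "((\<lambda>s. x + s *\<^sub>R axis i (1::real)) has_derivative (\<lambda>s. s *\<^sub>R axis i 1)) (at s)"
    by (auto intro!: derivative_eq_intros)
  from has_derivative_compose[OF this has_derivative_partial_deriv[OF assms]]
  have "((\<lambda>s. \<phi> (x + s *\<^sub>R axis i 1)) has_derivative
      (\<lambda>v. \<Sum>j\<in>UNIV. (v *\<^sub>R axis i 1) $ j * partial_deriv j \<phi> (x + s *\<^sub>R axis i 1))) (at s)" .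
  moreover have "(\<Sum>j\<in>UNIV. (v *\<^sub>R axis i 1) $ j * partial_deriv j \<phi> (x + s *\<^sub>R axis i 1))
      = partial_deriv i \<phi> (x + s *\<^sub>R axis i 1) * v" for v
  proof -
    have "(\<Sum>j\<in>UNIV. (v *\<^sub>R axis i 1) $ j * partial_deriv j \<phi> (x + s *\<^sub>R axis i 1))
      = (\<Sum>j\<in>UNIV. if i = j then v * partial_deriv j \<phi> (x + s *\<^sub>R axis i 1) else 0)"
      by (intro sum.cong) (auto simp: axis_def)
    then show ?thesis by (simp add: mult.commute)
  qed
  ultimately show ?thesis by (simp add: has_field_derivative_def)
qed

text \<open>The difference quotients of \<open>\<phi>\<close> have integral zero by translation invariance.\<close>

lemma integral_partial_deriv_eq_0:
  fixes \<phi> :: "real ^ 'n \<Rightarrow> real"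
  assumes "\<phi> \<in> test_functions"
  shows "(\<integral>x. partial_deriv i \<phi> x \<partial>lebesgue) = 0"
proof -
  note d = test_functions_differentiable[OF assms]
  note dt = test_functions_partial_deriv[OF assms, of i]
  obtain R where R: "\<And>x. \<phi> x \<noteq> 0 \<Longrightarrow> norm x \<le> R" using test_functions_support[OF assms] by blast
  obtain B where B: "\<And>x. \<bar>partial_deriv i \<phi> x\<bar> \<le> B" using test_functions_bounded[OF dt] by blast
  have B0: "0 \<le> B" using B[of 0] by linarith
  define s where "s m x = real (Suc m) * (\<phi> (x + (1 / real (Suc m)) *\<^sub>R axis i 1) - \<phi> x)" for m x
  have cont: "continuous_on UNIV \<phi>" by (rule test_functions_continuous[OF assms])
  have cs: "continuous_on UNIV (\<lambda>x. \<phi> (x + c))" for c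
    by (rule continuous_on_compose2[OF cont]) (auto intro!: continuous_intros)
  have [measurable]: "s m \<in> borel_measurable lborel" "partial_deriv i \<phi> \<in> borel_measurable lborel" for m
  proof -
    have "continuous_on UNIV (s m)" unfolding s_def by (intro continuous_intros cs cont)
    then show "s m \<in> borel_measurable lborel" using borel_measurable_continuous_onI by simp
    show "partial_deriv i \<phi> \<in> borel_measurable lborel"
      using borel_measurable_continuous_onI[OF test_functions_continuous[OF dt]] by simp
  qed
  have lim: "(\<lambda>m. s m x) \<longlonglongrightarrow> partial_deriv i \<phi> x" for x
  proof -
    have "((\<lambda>h. (\<phi> (x + h *\<^sub>R axis i 1) - \<phi> x) / h) \<longlongrightarrow> partial_deriv i \<phi> x) (at 0)"
      using partial_deriv_line[OF d, of x i 0] by (simp add: DERIV_def)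
    moreover have "filterlim (\<lambda>m. 1 / real (Suc m)) (at 0) sequentially"
      by (auto simp: filterlim_at LIMSEQ_Suc[OF lim_1_over_n] simp del: of_nat_Suc)
    ultimately have "(\<lambda>m. (\<phi> (x + (1 / real (Suc m)) *\<^sub>R axis i 1) - \<phi> x) / (1 / real (Suc m))) \<longlonglongrightarrow> partial_deriv i \<phi> x"
      by (rule filterlim_compose)
    then show ?thesis by (simp add: s_def mult.commute del: of_nat_Suc)
  qed
  \<comment> \<open>By the mean value theorem the quotients are bounded by \<open>B\<close>, and as
    the step is at most 1 they all vanish outside the ball of radius \<open>R + 1\<close>.\<close>
  have bound: "norm (s m x) \<le> indicator (cball 0 (R + 1)) x * B" for m x
  proof (cases "norm x \<le> R + 1")
    case True
    define h where "h = 1 / real (Suc m)"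
    have h: "0 < h" "real (Suc m) = 1 / h" by (auto simp: h_def)
    obtain z where "\<phi> (x + h *\<^sub>R axis i 1) - \<phi> (x + 0 *\<^sub>R axis i 1) = (h - 0) * partial_deriv i \<phi> (x + z *\<^sub>R axis i 1)"
      using MVT2[of 0 h "\<lambda>s. \<phi> (x + s *\<^sub>R axis i 1)" "\<lambda>s. partial_deriv i \<phi> (x + s *\<^sub>R axis i 1)"]
        partial_deriv_line[OF d] h by blast
    then have "s m x = partial_deriv i \<phi> (x + z *\<^sub>R axis i 1)"
      using h(1) unfolding s_def h(2) by simp
    then show ?thesis using B True by (simp add: mem_cball_0)
  next
    case False
    have "norm (x + (1 / real (Suc m)) *\<^sub>R axis i 1) \<ge> norm x - norm ((1 / real (Suc m)) *\<^sub>R axis i (1::real))"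
      by (metis add_diff_cancel_right' diff_le_eq norm_triangle_ineq4 add.commute)
    moreover have "norm ((1 / real (Suc m)) *\<^sub>R (axis i (1::real) :: real ^ 'n)) \<le> 1" by simp
    ultimately have "norm (x + (1 / real (Suc m)) *\<^sub>R axis i 1) > R" using False by linarith
    then have "\<phi> (x + (1 / real (Suc m)) *\<^sub>R axis i 1) = 0" "\<phi> x = 0" using R False
      by (meson not_less, smt (verit) R)
    then show ?thesis using B0 by (simp add: s_def)
  qed
  have w: "integrable lborel (\<lambda>x. indicator (cball (0 :: real ^ 'n) (R + 1)) x * B)"
    by (intro integrable_mult_left integrable_real_indicator) (use emeasure_bounded_finite[of "cball (0 :: real ^ 'n) (R + 1)"] in auto)
  have "(\<lambda>m. integral\<^sup>L lborel (s m)) \<longlonglongrightarrow> integral\<^sup>L lborel (partial_deriv i \<phi>)"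
    by (rule integral_dominated_convergence[OF _ _ w]) (use lim bound in auto)
  moreover have "integral\<^sup>L lborel (s m) = 0" for m
  proof -
    have m: "\<phi> \<in> borel_measurable borel" by (rule borel_measurable_continuous_onI[OF cont])
    have int: "integrable lborel \<phi>" by (rule continuous_compact_support_integrable(1)[OF cont R])
    have tr: "integrable lborel (\<lambda>x. \<phi> (x + c))" "(\<integral>x. \<phi> (x + c) \<partial>lborel) = (\<integral>x. \<phi> x \<partial>lborel)" for c
    proof -
      have "integrable (distr lborel borel ((+) c)) \<phi>" using int by (simp add: lborel_distr_plus)
      then show "integrable lborel (\<lambda>x. \<phi> (x + c))"
        using m by (simp add: integrable_distr_eq add.commute)
      have "(\<integral>x. \<phi> x \<partial>distr lborel borel ((+) c)) = (\<integral>x. \<phi> (c + x) \<partial>lborel)"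
        using m by (intro integral_distr) auto
      then show "(\<integral>x. \<phi> (x + c) \<partial>lborel) = (\<integral>x. \<phi> x \<partial>lborel)"
        by (simp add: lborel_distr_plus add.commute)
    qed
    show ?thesis unfolding s_def using tr int by (simp del: of_nat_Suc)
  qed
  ultimately have "integral\<^sup>L lborel (partial_deriv i \<phi>) = 0" by (simp add: LIMSEQ_const_iff)
  then show ?thesis
    using lebesgue_integral_continuous[OF test_functions_continuous[OF dt]] by simp
qed

section \<open>Locally integrable functions\<close>

lemma continuous_L1_loc:
  assumes "continuous_on UNIV f" shows "f \<in> L1_loc"
  unfolding L1_loc_def
proof (intro CollectI allI impI)
  fix K :: "'a set" assume "compact K"
  then obtain a b where "K \<subseteq> cbox a b" using bounded_subset_cbox_symmetric[OF compact_imp_bounded] by blast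
  moreover have "set_integrable lebesgue (cbox a b) f"
    using assms by (intro absolutely_integrable_continuous) (auto intro: continuous_on_subset)
  moreover have "K \<in> sets lebesgue" using \<open>compact K\<close> by (simp add: compact_imp_closed)
  ultimately show "set_integrable lebesgue K f" by (blast intro: set_integrable_subset)
qed

text \<open>\<open>L1_loc\<close> restricts \<open>g\<close> only on compact sets; global
  measurability is recovered from the truncations of \<open>g\<close> to growing balls.\<close>

lemma L1_loc_borel_measurable:
  assumes "g \<in> L1_loc" shows "g \<in> borel_measurable lebesgue"
proof (rule borel_measurable_LIMSEQ_metric)
  show "(\<lambda>x. indicator (cball 0 (real n)) x *\<^sub>R g x) \<in> borel_measurable lebesgue" for n
    using assms by (auto simp: L1_loc_def set_integrable_def intro!: borel_measurable_integrable)
  fix x :: 'a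
  obtain N :: nat where N: "norm x \<le> N" using real_arch_simple by blast
  have "eventually (\<lambda>n. indicator (cball 0 (real n)) x *\<^sub>R g x = g x) sequentially"
    using eventually_ge_at_top[of N] by eventually_elim (use N in \<open>auto simp: indicator_def\<close>)
  then show "(\<lambda>n. indicator (cball 0 (real n)) x *\<^sub>R g x) \<longlonglongrightarrow> g x"
    by (rule tendsto_eventually)
qed

lemma L1_loc_add: "f \<in> L1_loc \<Longrightarrow> g \<in> L1_loc \<Longrightarrow> (\<lambda>x. f x + g x) \<in> L1_loc"
  unfolding L1_loc_def by (auto intro: set_integral_add)

lemma L1_loc_scale: "f \<in> L1_loc \<Longrightarrow> (\<lambda>x. c * f x) \<in> L1_loc"
  unfolding L1_loc_def by auto

lemma L1_loc_mult_integrable: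
  assumes g: "g \<in> L1_loc" and f: "\<phi> \<in> borel_measurable lebesgue" "\<And>x. \<bar>\<phi> x\<bar> \<le> B"
    and R: "\<And>x. \<phi> x \<noteq> 0 \<Longrightarrow> norm x \<le> R"
  shows "integrable lebesgue (\<lambda>x. g x * \<phi> x)"
proof (rule Bochner_Integration.integrable_bound)
  have "set_integrable lebesgue (cball 0 R) g" using g by (simp add: L1_loc_def)
  then show "integrable lebesgue (\<lambda>x. B * (indicator (cball 0 R) x *\<^sub>R g x))"
    unfolding set_integrable_def by (intro integrable_mult_right)
  show "(\<lambda>x. g x * \<phi> x) \<in> borel_measurable lebesgue"
    using L1_loc_borel_measurable[OF g] f by (intro borel_measurable_times)
  have "norm (g x * \<phi> x) \<le> norm (B * (indicator (cball 0 R) x *\<^sub>R g x))" for x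
  proof (cases "\<phi> x = 0")
    case False
    have "\<bar>\<phi> x\<bar> * \<bar>g x\<bar> \<le> \<bar>B\<bar> * \<bar>g x\<bar>"
      using f(2)[of x] by (intro mult_right_mono) auto
    then show ?thesis using R[OF False] by (simp add: abs_mult mult.commute)
  qed simp
  then show "AE x in lebesgue. norm (g x * \<phi> x) \<le> norm (B * (indicator (cball 0 R) x *\<^sub>R g x))" by simp
qed

lemma L1_loc_test_integrable:
  assumes "g \<in> L1_loc" "\<phi> \<in> test_functions"
  shows "integrable lebesgue (\<lambda>x. g x * \<phi> x)"
proof -
  obtain R where R: "\<And>x. \<phi> x \<noteq> 0 \<Longrightarrow> norm x \<le> R" using test_functions_support[OF assms(2)] by blast
  obtain B where B: "\<And>x. \<bar>\<phi> x\<bar> \<le> B" using test_functions_bounded[OF assms(2)] by blast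
  show ?thesis
    using continuous_borel_measurable_lebesgue[OF test_functions_continuous[OF assms(2)]]
    by (rule L1_loc_mult_integrable[OF assms(1) _ B R])
qed

text \<open>The fundamental lemma of the calculus of variations. Bumps tending to the indicator of a
  box show that \<open>g\<close> has integral 0 over every box, and Lebesgue differentiation along
  shrinking cubes recovers \<open>g\<close> almost everywhere from these integrals.\<close>

lemma L1_loc_AE_0:
  fixes g :: "real ^ 'n \<Rightarrow> real"
  assumes g: "g \<in> L1_loc" and z: "\<And>\<phi>. \<phi> \<in> test_functions \<Longrightarrow> (\<integral>x. g x * \<phi> x \<partial>lebesgue) = 0"
  shows "AE x in lebesgue. g x = 0"
proof -
  have gm: "g \<in> borel_measurable lebesgue" by (rule L1_loc_borel_measurable[OF g])
  have gK: "set_integrable lebesgue (cbox a b) g" for a b using g by (simp add: L1_loc_def)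
  have int0: "integral (cbox a b) g = 0" for a b
  proof -
    have bm: "box_bump (Suc m) a b \<in> borel_measurable lebesgue" for m
      by (intro continuous_borel_measurable_lebesgue test_functions_continuous box_bump_test_function) simp
    have "(\<lambda>m. \<integral>x. g x * box_bump (Suc m) a b x \<partial>lebesgue) \<longlonglongrightarrow> (\<integral>x. g x * indicator (box a b) x \<partial>lebesgue)"
    proof (rule integral_dominated_convergence)
      show "(\<lambda>x. g x * indicator (box a b) x) \<in> borel_measurable lebesgue"
        using gm by (intro borel_measurable_times borel_measurable_indicator) auto
      show "(\<lambda>x. g x * box_bump (Suc m) a b x) \<in> borel_measurable lebesgue" for m
        by (intro borel_measurable_times gm bm)
      show "integrable lebesgue (\<lambda>x. norm (indicator (cbox a b) x *\<^sub>R g x))"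
        using gK[of a b] unfolding set_integrable_def by (rule integrable_norm)
      show "AE x in lebesgue. (\<lambda>m. g x * box_bump (Suc m) a b x) \<longlonglongrightarrow> g x * indicator (box a b) x"
        by (intro AE_I2 tendsto_intros box_bump_tendsto)
      fix m
      have "norm (g x * box_bump (Suc m) a b x) \<le> norm (indicator (cbox a b) x *\<^sub>R g x)" for x
      proof (cases "x \<in> box a b")
        case True
        then have "x \<in> cbox a b" using box_subset_cbox by blast
        then show ?thesis using box_bump_bounds[of "Suc m" a b x] by (simp add: abs_mult mult_left_le)
      next
        case False
        then show ?thesis using box_bump_pos_iff[of "Suc m" a b x] by simp
      qed
      then show "AE x in lebesgue. norm (g x * box_bump (Suc m) a b x) \<le> norm (indicator (cbox a b) x *\<^sub>R g x)" by simp
    qed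
    moreover have "(\<integral>x. g x * box_bump (Suc m) a b x \<partial>lebesgue) = 0" for m
      by (rule z[OF box_bump_test_function]) simp
    ultimately have "(\<integral>x. g x * indicator (box a b) x \<partial>lebesgue) = 0" by (simp add: LIMSEQ_const_iff)
    moreover have "set_integrable lebesgue (box a b) g"
      by (rule set_integrable_subset[OF gK[of a b] _ box_subset_cbox]) auto
    ultimately have "integral (box a b) g = 0"
      using set_lebesgue_integral_eq_integral(2)[of "box a b" g] by (simp add: set_lebesgue_integral_def mult.commute)
    then show ?thesis by (simp add: integral_open_interval)
  qed
  have "g integrable_on cbox a b" for a b by (rule set_lebesgue_integral_eq_integral(1)[OF gK])
  from integrable_ccontinuous_explicit[OF this] obtain N where N: "negligible N"
    "\<And>x e. x \<notin> N \<Longrightarrow> 0 < e \<Longrightarrow> \<exists>d>0. \<forall>h. 0 < h \<and> h < d \<longrightarrow>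
       norm (integral (cbox x (x + h *\<^sub>R One)) g /\<^sub>R h ^ DIM(real ^ 'n) - g x) < e" by blast
  have "g x = 0" if xN: "x \<notin> N" for x
  proof (rule ccontr)
    assume "g x \<noteq> 0"
    then obtain d where "0 < d" "\<forall>h. 0 < h \<and> h < d \<longrightarrow>
       norm (integral (cbox x (x + h *\<^sub>R One)) g /\<^sub>R h ^ DIM(real ^ 'n) - g x) < \<bar>g x\<bar>"
      using N(2)[OF xN, of "\<bar>g x\<bar>"] by auto
    then have "norm (integral (cbox x (x + (d/2) *\<^sub>R One)) g /\<^sub>R (d/2) ^ DIM(real ^ 'n) - g x) < \<bar>g x\<bar>"
      by (simp del: norm_minus_cancel)
    then show False by (simp add: int0)
  qed
  moreover have "AE x in lebesgue. x \<notin> N" using N(1) by (intro AE_not_in) (simp add: negligible_iff_null_sets)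
  ultimately show ?thesis by auto
qed

section \<open>Weak gradients\<close>

lemma has_weak_partial_unique:
  assumes "has_weak_partial u i g" "has_weak_partial u i h"
  shows "AE x in lebesgue. g x = h x"
proof -
  have gh: "g \<in> L1_loc" "h \<in> L1_loc" using assms by (auto simp: has_weak_partial_def)
  have "AE x in lebesgue. g x + (-1) * h x = 0"
  proof (rule L1_loc_AE_0)
    show "(\<lambda>x. g x + (-1) * h x) \<in> L1_loc" by (intro L1_loc_add L1_loc_scale gh)
    fix \<phi> :: "real ^ 'a \<Rightarrow> real" assume \<phi>: "\<phi> \<in> test_functions"
    have "(\<integral>x. (g x + (-1) * h x) * \<phi> x \<partial>lebesgue) = (\<integral>x. g x * \<phi> x \<partial>lebesgue) - (\<integral>x. h x * \<phi> x \<partial>lebesgue)"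
      using L1_loc_test_integrable[OF gh(1) \<phi>] L1_loc_test_integrable[OF gh(2) \<phi>]
      by (simp add: left_diff_distrib)
    also have "\<dots> = 0"
    proof -
      have "(\<integral>x. u x * partial_deriv i \<phi> x \<partial>lebesgue) = - (\<integral>x. g x * \<phi> x \<partial>lebesgue)"
        "(\<integral>x. u x * partial_deriv i \<phi> x \<partial>lebesgue) = - (\<integral>x. h x * \<phi> x \<partial>lebesgue)"
        using assms \<phi> by (simp_all add: has_weak_partial_def)
      then show ?thesis by simp
    qed
    finally show "(\<integral>x. (g x + (-1) * h x) * \<phi> x \<partial>lebesgue) = 0" .
  qed
  then show ?thesis by simp
qed

lemma has_weak_partial_add:
  assumes "u \<in> L1_loc" "v \<in> L1_loc" "has_weak_partial u i g" "has_weak_partial v i h"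
  shows "has_weak_partial (\<lambda>x. u x + v x) i (\<lambda>x. g x + h x)"
  using assms
  by (auto simp: has_weak_partial_def L1_loc_add ring_distribs L1_loc_test_integrable test_functions_partial_deriv)

lemma has_weak_partial_scale:
  assumes "has_weak_partial u i g"
  shows "has_weak_partial (\<lambda>x. c * u x) i (\<lambda>x. c * g x)"
  using assms
  by (auto simp: has_weak_partial_def L1_loc_scale mult.assoc)

lemma has_weak_partial_test_function:
  assumes "v \<in> test_functions"
  shows "has_weak_partial v i (partial_deriv i v)"
  unfolding has_weak_partial_def
proof (intro conjI ballI)
  note dv = test_functions_partial_deriv[OF assms, of i]
  show vl: "partial_deriv i v \<in> L1_loc" by (intro continuous_L1_loc test_functions_continuous dv)
  fix \<phi> :: "real ^ 'a \<Rightarrow> real" assume \<phi>: "\<phi> \<in> test_functions"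
  have "(\<lambda>x. v x * \<phi> x) \<in> test_functions"
    by (intro test_functions_mult test_functions_C_diff assms \<phi>)
  from integral_partial_deriv_eq_0[OF this, of i]
  have "0 = (\<integral>x. v x * partial_deriv i \<phi> x + partial_deriv i v x * \<phi> x \<partial>lebesgue)"
    using test_functions_differentiable[OF assms] test_functions_differentiable[OF \<phi>]
    by (simp add: partial_deriv_mult)
  also have "\<dots> = (\<integral>x. v x * partial_deriv i \<phi> x \<partial>lebesgue) + (\<integral>x. partial_deriv i v x * \<phi> x \<partial>lebesgue)"
    by (intro Bochner_Integration.integral_add L1_loc_test_integrable vl \<phi> test_functions_partial_deriv
        continuous_L1_loc test_functions_continuous assms)
  finally show "(\<integral>x. v x * partial_deriv i \<phi> x \<partial>lebesgue) = - (\<integral>x. partial_deriv i v x * \<phi> x \<partial>lebesgue)"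
    by simp
qed

lemma Lp_fun_vec:
  fixes G :: "real ^ 'n \<Rightarrow> real ^ 'm"
  assumes p: "0 < p" and G: "\<And>i. (\<lambda>x. G x $ i) \<in> Lp_fun p"
  shows "G \<in> Lp_fun p"
proof -
  have ax: "(\<lambda>x. G x $ i *\<^sub>R (axis i 1 :: real ^ 'm)) \<in> Lp_fun p" for i
    using G[of i] unfolding Lp_fun_def by (auto intro!: borel_measurable_scaleR simp: norm_axis_1)
  have "(\<lambda>x. \<Sum>i\<in>I. G x $ i *\<^sub>R (axis i 1 :: real ^ 'm)) \<in> Lp_fun p" if "finite I" for I :: "'m set"
    using that
  proof (induction I rule: finite_induct)
    case empty
    show ?case using p by (simp add: Lp_fun_def)
  next
    case (insert i I)
    then show ?case using Lp_fun_add[OF _ ax insert.IH] p by simp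
  qed
  from this[of UNIV] show ?thesis
    using basis_expansion[of "G _"] by (simp add: scalar_mult_eq_scaleR)
qed

text \<open>As \<open>weak_grad\<close> is a choice, it can be computed only up to null sets: any
  field \<open>G\<close> of weak partials shows that the choice succeeds, and uniqueness in each
  coordinate identifies the result with \<open>G\<close> almost everywhere.\<close>

lemma weak_grad_eqI:
  fixes u :: "real ^ 'n \<Rightarrow> real"
  assumes "\<And>i. has_weak_partial u i (\<lambda>x. G x $ i)"
  shows "has_weak_partial u i (\<lambda>x. weak_grad u x $ i)"
    and "AE x in lebesgue. weak_grad u x = G x"
proof -
  show w: "has_weak_partial u i (\<lambda>x. weak_grad u x $ i)" for i
    using someI[of "\<lambda>G. \<forall>i. has_weak_partial u i (\<lambda>x. G x $ i)" G] assms unfolding weak_grad_def by blast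
  have "AE x in lebesgue. \<forall>i\<in>UNIV. weak_grad u x $ i = G x $ i"
    by (rule AE_finite_allI) (auto intro: has_weak_partial_unique[OF w assms])
  then show "AE x in lebesgue. weak_grad u x = G x" by (simp add: vec_eq_iff)
qed

lemma L1_loc_vec_borel_measurable:
  fixes G :: "real ^ 'n \<Rightarrow> real ^ 'm"
  assumes "\<And>i. (\<lambda>x. G x $ i) \<in> L1_loc"
  shows "G \<in> borel_measurable lebesgue"
proof -
  have "(\<lambda>x. \<Sum>i\<in>UNIV. G x $ i *\<^sub>R (axis i 1 :: real ^ 'm)) \<in> borel_measurable lebesgue"
    by (intro borel_measurable_sum borel_measurable_scaleR L1_loc_borel_measurable assms) auto
  then show ?thesis using basis_expansion[of "G _"] by (simp add: scalar_mult_eq_scaleR)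
qed

lemma D1p_weak_grad:
  fixes u :: "real ^ 'n \<Rightarrow> real"
  assumes u: "u \<in> D1p p" and p: "0 < p"
  shows "has_weak_partial u i (\<lambda>x. weak_grad u x $ i)" and "weak_grad u \<in> Lp_fun p"
proof -
  have "\<forall>i. \<exists>g. g \<in> Lp_fun p \<and> has_weak_partial u i g" using u by (auto simp: D1p_def)
  then obtain g where "\<forall>i. g i \<in> Lp_fun p \<and> has_weak_partial u i (g i)" by (rule choice[THEN exE])
  then have g: "\<And>i. g i \<in> Lp_fun p" "\<And>i. has_weak_partial u i (g i)" by simp_all
  define G where "G x = (\<chi> i. g i x)" for x
  have G: "(\<lambda>x. G x $ i) = g i" for i by (simp add: G_def)
  show w: "has_weak_partial u i (\<lambda>x. weak_grad u x $ i)" for i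
    by (rule weak_grad_eqI(1)[of u G]) (simp add: G g)
  have AE: "AE x in lebesgue. weak_grad u x = G x"
    by (rule weak_grad_eqI(2)[of u G]) (simp add: G g)
  from AE have AE': "AE x in lebesgue. G x = weak_grad u x" by eventually_elim simp
  have "G \<in> Lp_fun p" using g p by (intro Lp_fun_vec) (simp_all add: G)
  moreover have "weak_grad u \<in> borel_measurable lebesgue"
    using w by (intro L1_loc_vec_borel_measurable) (simp add: has_weak_partial_def)
  ultimately show "weak_grad u \<in> Lp_fun p"
    by (rule Lp_fun_AE(1)[OF _ _ AE'])
qed

section \<open>The space \<open>D1p\<close>\<close>

lemma holder_continuous_add:
  fixes u v :: "'a::metric_space \<Rightarrow> real"
  assumes "holder_continuous \<alpha> u" "holder_continuous \<alpha> v"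
  shows "holder_continuous \<alpha> (\<lambda>x. u x + v x)"
proof -
  obtain K L where K: "\<And>x y. dist (u x) (u y) \<le> K * dist x y powr \<alpha>"
    and L: "\<And>x y. dist (v x) (v y) \<le> L * dist x y powr \<alpha>"
    using assms unfolding holder_continuous_def by blast
  have "dist (u x + v x) (u y + v y) \<le> (K + L) * dist x y powr \<alpha>" for x y
    using dist_triangle_add[of "u x" "v x" "u y" "v y"] K[of x y] L[of x y] by (simp add: ring_distribs)
  then show ?thesis unfolding holder_continuous_def by blast
qed

lemma holder_continuous_scale:
  fixes u :: "'a::metric_space \<Rightarrow> real"
  assumes "holder_continuous \<alpha> u"
  shows "holder_continuous \<alpha> (\<lambda>x. c * u x)"
proof -
  obtain K where K: "\<And>x y. dist (u x) (u y) \<le> K * dist x y powr \<alpha>"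
    using assms unfolding holder_continuous_def by blast
  have "dist (c * u x) (c * u y) \<le> (\<bar>c\<bar> * K) * dist x y powr \<alpha>" for x y
    using mult_left_mono[OF K[of x y], of "\<bar>c\<bar>"]
    by (simp add: dist_real_def abs_mult[symmetric] right_diff_distrib mult.assoc)
  then show ?thesis unfolding holder_continuous_def by blast
qed

lemma holder_continuous_imp_continuous:
  fixes u :: "'a::metric_space \<Rightarrow> 'b::metric_space"
  assumes "holder_continuous \<alpha> u" "0 < \<alpha>"
  shows "continuous_on UNIV u"
proof -
  obtain K where K: "\<And>x y. dist (u x) (u y) \<le> K * dist x y powr \<alpha>"
    using assms unfolding holder_continuous_def by blast
  have "(u \<longlongrightarrow> u x) (at x)" for x
  proof -
    have "((\<lambda>y. K * dist y x powr \<alpha>) \<longlongrightarrow> K * dist x x powr \<alpha>) (at x)"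
      using assms(2) by (intro tendsto_intros tendsto_powr') auto
    then have "((\<lambda>y. K * dist y x powr \<alpha>) \<longlongrightarrow> 0) (at x)" by simp
    then have "((\<lambda>y. dist (u y) (u x)) \<longlongrightarrow> 0) (at x)"
      by (rule Lim_null_comparison[rotated]) (simp add: K)
    then show ?thesis using tendsto_dist_iff[of u "u x" "at x"] by blast
  qed
  then show ?thesis by (simp add: continuous_on_def)
qed

lemma D1p_continuous:
  assumes "u \<in> D1p p" "real CARD('n) < p"
  shows "continuous_on UNIV (u :: real ^ 'n \<Rightarrow> real)"
proof (rule holder_continuous_imp_continuous)
  show "holder_continuous (1 - real CARD('n) / p) u" using assms by (simp add: D1p_def)
  show "0 < 1 - real CARD('n) / p" using assms by (simp add: divide_less_eq)
qed

lemma D1p_add: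
  fixes u v :: "real ^ 'n \<Rightarrow> real"
  assumes p: "0 < p" and u: "u \<in> D1p p" and v: "v \<in> D1p p"
  shows "(\<lambda>x. u x + v x) \<in> D1p p"
    and "AE x in lebesgue. weak_grad (\<lambda>x. u x + v x) x = weak_grad u x + weak_grad v x"
proof -
  have L: "u \<in> L1_loc" "v \<in> L1_loc" using u v by (auto simp: D1p_def)
  have w: "has_weak_partial (\<lambda>x. u x + v x) i (\<lambda>x. (weak_grad u x + weak_grad v x) $ i)" for i
    using has_weak_partial_add[OF L D1p_weak_grad(1)[OF u p] D1p_weak_grad(1)[OF v p]] by simp
  then show "AE x in lebesgue. weak_grad (\<lambda>x. u x + v x) x = weak_grad u x + weak_grad v x"
    by (rule weak_grad_eqI(2))
  have "\<exists>g\<in>Lp_fun p. has_weak_partial (\<lambda>x. u x + v x) i g" for i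
  proof -
    obtain g where "g \<in> Lp_fun p" "has_weak_partial u i g" using u by (auto simp: D1p_def)
    moreover obtain h where "h \<in> Lp_fun p" "has_weak_partial v i h" using v by (auto simp: D1p_def)
    ultimately show ?thesis using has_weak_partial_add[OF L, of i g h] Lp_fun_add[of p g h] p
      by (intro bexI[of _ "\<lambda>x. g x + h x"]) auto
  qed
  then show "(\<lambda>x. u x + v x) \<in> D1p p"
    using u v L by (auto simp: D1p_def L1_loc_add holder_continuous_add)
qed

lemma D1p_scale:
  fixes u :: "real ^ 'n \<Rightarrow> real"
  assumes p: "0 < p" and u: "u \<in> D1p p"
  shows "(\<lambda>x. c * u x) \<in> D1p p"
    and "AE x in lebesgue. weak_grad (\<lambda>x. c * u x) x = c *\<^sub>R weak_grad u x"
proof -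
  have w: "has_weak_partial (\<lambda>x. c * u x) i (\<lambda>x. (c *\<^sub>R weak_grad u x) $ i)" for i
    using has_weak_partial_scale[OF D1p_weak_grad(1)[OF u p]] by simp
  then show "AE x in lebesgue. weak_grad (\<lambda>x. c * u x) x = c *\<^sub>R weak_grad u x"
    by (rule weak_grad_eqI(2))
  have "\<exists>g\<in>Lp_fun p. has_weak_partial (\<lambda>x. c * u x) i g" for i
  proof -
    obtain g where "g \<in> Lp_fun p" "has_weak_partial u i g" using u by (auto simp: D1p_def)
    then show ?thesis using has_weak_partial_scale[of u i g c] Lp_fun_scaleR[of g p c]
      by (intro bexI[of _ "\<lambda>x. c * g x"]) auto
  qed
  then show "(\<lambda>x. c * u x) \<in> D1p p"
    using u by (auto simp: D1p_def L1_loc_scale holder_continuous_scale)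
qed

lemma test_functions_lipschitz:
  fixes v :: "real ^ 'n \<Rightarrow> real"
  assumes v: "v \<in> test_functions"
  shows "\<exists>B. \<forall>x y. \<bar>v x - v y\<bar> \<le> B * norm (x - y)"
proof -
  have "\<exists>B. \<forall>x. \<bar>partial_deriv j v x\<bar> \<le> B" for j
    by (intro test_functions_bounded test_functions_partial_deriv v)
  then obtain B where B: "\<And>j x. \<bar>partial_deriv j v x\<bar> \<le> B j" by metis
  have "norm (v x - v y) \<le> (\<Sum>j\<in>UNIV. B j) * norm (x - y)" for x y
  proof (rule differentiable_bound[of UNIV])
    fix x :: "real ^ 'n"
    show "(v has_derivative (\<lambda>w. \<Sum>j\<in>UNIV. w $ j * partial_deriv j v x)) (at x within UNIV)"
      using has_derivative_partial_deriv[OF test_functions_differentiable[OF v]] by simp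
    show "onorm (\<lambda>w. \<Sum>j\<in>UNIV. w $ j * partial_deriv j v x) \<le> (\<Sum>j\<in>UNIV. B j)"
    proof (rule onorm_le)
      fix w :: "real ^ 'n"
      have "norm (\<Sum>j\<in>UNIV. w $ j * partial_deriv j v x) \<le> (\<Sum>j\<in>UNIV. norm (w $ j * partial_deriv j v x))"
        by (rule norm_sum)
      also have "\<dots> \<le> (\<Sum>j\<in>UNIV. norm w * B j)"
        using B component_le_norm_cart[of w] by (intro sum_mono) (auto simp: abs_mult intro!: mult_mono)
      finally show "norm (\<Sum>j\<in>UNIV. w $ j * partial_deriv j v x) \<le> (\<Sum>j\<in>UNIV. B j) * norm w"
        by (simp add: sum_distrib_left mult.commute)
    qed
  qed auto
  then show ?thesis by auto
qed

text \<open>Hoelder continuity combines two bounds: at distance at most 1 the Lipschitz bound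
  suffices since \<open>t \<le> t powr \<alpha>\<close>, at larger distance boundedness does since
  \<open>1 \<le> t powr \<alpha>\<close>. The inclusion later provides an element of
  \<open>D1p\<close> with nonzero gradient.\<close>

lemma test_functions_subset_D1p:
  fixes v :: "real ^ 'n \<Rightarrow> real"
  assumes p: "real CARD('n) < p" and v: "v \<in> test_functions"
  shows "v \<in> D1p p"
proof -
  have p0: "0 < p" using p by (meson less_le_trans less_trans of_nat_0_less_iff not_le of_nat_less_0_iff)
  have cont: "continuous_on UNIV v" by (rule test_functions_continuous[OF v])
  have "\<exists>g\<in>Lp_fun p. has_weak_partial v i g" for i
  proof (intro bexI[of _ "partial_deriv i v"] has_weak_partial_test_function v)
    note dv = test_functions_partial_deriv[OF v, of i]
    obtain R where R: "\<And>x. partial_deriv i v x \<noteq> 0 \<Longrightarrow> norm x \<le> R" using test_functions_support[OF dv] by blast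
    have "integrable lebesgue (\<lambda>x. norm (partial_deriv i v x) powr p)"
    proof (rule continuous_compact_support_integrable(2))
      show "continuous_on UNIV (\<lambda>x. norm (partial_deriv i v x) powr p)"
        using p0 by (intro continuous_on_powr' continuous_intros test_functions_continuous[OF dv]) auto
    qed (use R in auto)
    then show "partial_deriv i v \<in> Lp_fun p"
      using continuous_borel_measurable_lebesgue[OF test_functions_continuous[OF dv]] by (simp add: Lp_fun_def)
  qed
  moreover have "holder_continuous (1 - real CARD('n) / p) v"
  proof -
    define \<alpha> where "\<alpha> = 1 - real CARD('n) / p"
    have \<alpha>: "0 < \<alpha>" "\<alpha> \<le> 1" using p p0 by (auto simp: \<alpha>_def divide_less_eq)
    obtain B where B: "\<And>x y. \<bar>v x - v y\<bar> \<le> B * norm (x - y)" using test_functions_lipschitz[OF v] by blast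
    obtain A where A: "\<And>x. \<bar>v x\<bar> \<le> A" using test_functions_bounded[OF v] by blast
    have "dist (v x) (v y) \<le> (\<bar>B\<bar> + 2 * A) * dist x y powr \<alpha>" for x y
    proof (cases "dist x y \<le> 1")
      case True
      have A0: "0 \<le> A" using A[of 0] by linarith
      have "dist x y \<le> dist x y powr \<alpha>"
        using powr_mono'[of \<alpha> 1 "dist x y"] True \<alpha> by simp
      then have "\<bar>B\<bar> * dist x y \<le> \<bar>B\<bar> * dist x y powr \<alpha>" by (intro mult_left_mono) auto
      moreover have "dist (v x) (v y) \<le> \<bar>B\<bar> * dist x y"
        using B[of x y] mult_right_mono[OF abs_ge_self[of B], of "norm (x - y)"] by (simp add: dist_norm)
      moreover have "0 \<le> 2 * A * dist x y powr \<alpha>" using A0 by simp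
      ultimately show ?thesis unfolding distrib_right by linarith
    next
      case False
      have A0: "0 \<le> A" using A[of 0] by linarith
      have "1 \<le> dist x y powr \<alpha>" using False \<alpha> by (intro ge_one_powr_ge_zero) auto
      then have "2 * A * 1 \<le> 2 * A * dist x y powr \<alpha>" using A0 by (intro mult_left_mono) auto
      moreover have "dist (v x) (v y) \<le> 2 * A" using A[of x] A[of y] by (simp add: dist_real_def)
      moreover have "0 \<le> \<bar>B\<bar> * dist x y powr \<alpha>" by simp
      ultimately show ?thesis unfolding distrib_right by linarith
    qed
    then show ?thesis unfolding holder_continuous_def \<alpha>_def by blast
  qed
  ultimately show ?thesis using continuous_L1_loc[OF cont] by (auto simp: D1p_def)
qed

section \<open>The local Morrey estimate\<close>

lemma integral_cbox_eq_lebesgue: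
  fixes f :: "'a::euclidean_space \<Rightarrow> real"
  assumes f: "continuous_on UNIV f" and s: "\<And>z. f z \<noteq> 0 \<Longrightarrow> z \<in> cbox a b"
  shows "integral (cbox a b) f = (\<integral>z. f z \<partial>lebesgue)"
proof -
  have "set_integrable lebesgue (cbox a b) f"
    using f by (intro absolutely_integrable_continuous) (auto intro: continuous_on_subset)
  then have "integral (cbox a b) f = (\<integral>z. indicator (cbox a b) z *\<^sub>R f z \<partial>lebesgue)"
    using set_lebesgue_integral_eq_integral(2)[of "cbox a b" f] by (simp add: set_lebesgue_integral_def)
  also have "(\<lambda>z. indicator (cbox a b) z *\<^sub>R f z) = f"
    using s by (auto simp: fun_eq_iff indicator_def)
  finally show ?thesis .
qed

lemma Lp_norm_bounded_support:
  fixes f :: "'a::euclidean_space \<Rightarrow> 'b::euclidean_space"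
  assumes q: "0 < q" and f: "f \<in> borel_measurable lebesgue" and M: "\<And>z. norm (f z) \<le> M"
    and s: "0 \<le> s" "\<And>z. f z \<noteq> 0 \<Longrightarrow> z \<in> cball x s"
  shows "f \<in> Lp_fun q"
    and "Lp_norm q f \<le> M * (unit_ball_vol (DIM('a)) * s ^ DIM('a)) powr (1 / q)"
proof -
  have M0: "0 \<le> M" using M[of 0] norm_ge_zero order_trans by blast
  have w: "integrable lebesgue (\<lambda>z. M powr q * indicator (cball x s) z)"
    by (intro integrable_mult_right integrable_real_indicator) (use emeasure_bounded_finite[of "cball x s"] in auto)
  have bound: "norm (f z) powr q \<le> M powr q * indicator (cball x s) z" for z
    using M[of z] s(2)[of z] q by (cases "f z = 0") (auto intro!: powr_mono2)
  have int: "integrable lebesgue (\<lambda>z. norm (f z) powr q)"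
    by (rule Bochner_Integration.integrable_bound[OF w])
      (use f bound in \<open>auto intro!: AE_I2 order_trans[OF bound abs_ge_self]\<close>)
  then show "f \<in> Lp_fun q" using f by (simp add: Lp_fun_def)
  have "measure lebesgue (cball x s) = unit_ball_vol (DIM('a)) * s ^ DIM('a)"
    using s(1) emeasure_cball[of s x] by (simp add: measure_def)
  moreover have "(\<integral>z. norm (f z) powr q \<partial>lebesgue) \<le> (\<integral>z. M powr q * indicator (cball x s) z \<partial>lebesgue)"
    by (intro integral_mono int w bound)
  ultimately have "(\<integral>z. norm (f z) powr q \<partial>lebesgue) \<le> M powr q * (unit_ball_vol (DIM('a)) * s ^ DIM('a))"
    by simp
  then have "Lp_norm q f \<le> (M powr q * (unit_ball_vol (DIM('a)) * s ^ DIM('a))) powr (1 / q)"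
    unfolding Lp_norm_def using q by (intro powr_mono2) auto
  also have "\<dots> = M * (unit_ball_vol (DIM('a)) * s ^ DIM('a)) powr (1 / q)"
    using q M0 by (subst powr_mult) (simp add: powr_powr)
  finally show "Lp_norm q f \<le> M * (unit_ball_vol (DIM('a)) * s ^ DIM('a)) powr (1 / q)" .
qed

lemma lebesgue_integral_scaling:
  fixes f :: "real ^ 'n \<Rightarrow> real"
  assumes f: "continuous_on UNIV f" and c: "0 < c"
  shows "(\<integral>z. c ^ CARD('n) * f (t + c *\<^sub>R z) \<partial>lebesgue) = (\<integral>z. f z \<partial>lebesgue)"
proof -
  have fm: "f \<in> borel_measurable borel" by (rule borel_measurable_continuous_onI[OF f])
  have cont: "continuous_on UNIV (\<lambda>z. f (t + c *\<^sub>R z))"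
    by (intro continuous_intros continuous_on_compose2[OF f]) auto
  have "(\<integral>z. f z \<partial>lborel) = (\<integral>z. f z \<partial>density (distr lborel borel (\<lambda>x. t + c *\<^sub>R x)) (\<lambda>_. ennreal (\<bar>c\<bar> ^ DIM(real ^ 'n))))"
    using lborel_affine[of c t] c by (simp add: ennreal_power)
  also have "\<dots> = (\<integral>z. \<bar>c\<bar> ^ DIM(real ^ 'n) *\<^sub>R f z \<partial>distr lborel borel (\<lambda>x. t + c *\<^sub>R x))"
    using fm c by (intro integral_density) auto
  also have "\<dots> = (\<integral>z. \<bar>c\<bar> ^ DIM(real ^ 'n) *\<^sub>R f (t + c *\<^sub>R z) \<partial>lborel)"
    using fm by (intro integral_distr) auto
  finally show ?thesis
    using c by (simp add: lebesgue_integral_continuous[OF f] lebesgue_integral_continuous[OF cont])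
qed

lemma C_diff_vec_nth: "C_diff k (\<lambda>x :: real ^ 'n. x $ j)"
proof -
  define c where "c m t = (if m = 0 then t else if m = 1 then 1 else 0)" for m :: nat and t :: real
  have "(c m has_real_derivative c (Suc m) t) (at t)" for m t
    unfolding c_def by (cases "m = 0"; cases "m = 1") (auto simp: DERIV_const)
  then have "C_diff k (\<lambda>x :: real ^ 'n. c 0 (x $ j))" by (rule C_diff_coordinate)
  then show ?thesis by (simp add: c_def)
qed

text \<open>The averages \<open>\<integral>\<sigma>\<^sup>n \<eta>(x + \<sigma>(z - x)) u(z) dz\<close> tend to \<open>u x\<close> as \<open>\<sigma> \<rightarrow> \<infinity>\<close>. Their kernel has
  \<open>\<sigma>\<close>-derivative equal to the divergence of \<open>\<sigma>\<^sup>n\<^sup>-\<^sup>1 \<eta>(x + \<sigma>(z - x)) (z - x)\<close>, so that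
  integration by parts bounds their variation by the gradient of \<open>u\<close>.\<close>

locale averaging_kernel =
  fixes \<eta> :: "real ^ 'n \<Rightarrow> real" and r B :: real
  assumes test: "\<eta> \<in> test_functions" and nonneg: "\<And>z. 0 \<le> \<eta> z"
    and integral_1: "(\<integral>z. \<eta> z \<partial>lebesgue) = 1"
    and support: "\<And>z. \<eta> z \<noteq> 0 \<Longrightarrow> norm z \<le> r" and bound: "\<And>z. \<eta> z \<le> B"
begin

lemma r_nonneg: "0 \<le> r"
proof -
  have "\<exists>z. \<eta> z \<noteq> 0"
  proof (rule ccontr)
    assume "\<not> ?thesis" then have "\<eta> = (\<lambda>z. 0)" by auto
    with integral_1 show False by simp
  qed
  then show ?thesis using support norm_ge_zero order_trans by blast
qed

lemma B_nonneg: "0 \<le> B" using nonneg[of 0] bound[of 0] by linarith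

text \<open>The dilation \<open>x + \<sigma> (z - x)\<close> about \<open>x\<close>, split into
  linear part and constant to match the lemmas on affine substitution. For
  \<open>\<sigma> = 1\<close> it is the identity, whatever \<open>x\<close> is.\<close>

abbreviation zoom :: "real ^ 'n \<Rightarrow> real \<Rightarrow> real ^ 'n \<Rightarrow> real ^ 'n" where
  "zoom x \<sigma> z \<equiv> \<sigma> *\<^sub>R z + (x - \<sigma> *\<^sub>R x)"

definition dilate :: "real ^ 'n \<Rightarrow> real \<Rightarrow> real ^ 'n \<Rightarrow> real" where
  "dilate x \<sigma> z = \<eta> (zoom x \<sigma> z)"

abbreviation kernel :: "real ^ 'n \<Rightarrow> real \<Rightarrow> real ^ 'n \<Rightarrow> real" where
  "kernel x \<sigma> z \<equiv> \<sigma> ^ CARD('n) * dilate x \<sigma> z"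

lemma dilate_test: "0 < \<sigma> \<Longrightarrow> dilate x \<sigma> \<in> test_functions"
  unfolding dilate_def using linear_scaleR[of \<sigma>] by (intro test_functions_affine[of _ _ \<sigma>] test) auto

text \<open>\<open>\<eta>\<close> is supported in a ball about 0 and not about \<open>x\<close>;
  this costs the additional \<open>norm x\<close> in the radius, which still shrinks like
  \<open>1 / \<sigma>\<close>.\<close>

lemma dilate_support:
  assumes "0 < \<sigma>" "dilate x \<sigma> z \<noteq> 0"
  shows "norm (z - x) \<le> (r + norm x) / \<sigma>"
proof -
  have "norm (zoom x \<sigma> z) \<le> r" using assms(2) support by (simp add: dilate_def)
  then have "norm (x + \<sigma> *\<^sub>R (z - x)) \<le> r" by (simp add: algebra_simps)
  then have "norm (\<sigma> *\<^sub>R (z - x)) \<le> r + norm x"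
    using norm_triangle_ineq4[of "x + \<sigma> *\<^sub>R (z - x)" x] by simp
  then have "\<sigma> * norm (z - x) \<le> r + norm x" using assms(1) by (simp only: norm_scaleR abs_of_pos)
  then show ?thesis using assms(1) by (simp add: pos_le_divide_eq mult.commute)
qed

lemma dilate_support_le:
  assumes "0 < \<sigma>" "dilate x \<sigma> z \<noteq> 0" "norm x \<le> R"
  shows "norm (z - x) \<le> (r + R) / \<sigma>"
proof -
  have "(r + norm x) / \<sigma> \<le> (r + R) / \<sigma>" using assms by (intro divide_right_mono) auto
  with dilate_support[OF assms(1,2)] show ?thesis by linarith
qed

definition flux :: "real ^ 'n \<Rightarrow> real \<Rightarrow> real ^ 'n \<Rightarrow> real ^ 'n" where
  "flux x \<sigma> z = (\<sigma> ^ (CARD('n) - 1) * dilate x \<sigma> z) *\<^sub>R (z - x)"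

lemma flux_test:
  assumes "0 < \<sigma>" shows "(\<lambda>z. flux x \<sigma> z $ j) \<in> test_functions"
proof -
  have "(\<lambda>z. (\<sigma> ^ (CARD('n) - 1) * (z $ j + - x $ j)) * dilate x \<sigma> z) \<in> test_functions"
    by (intro test_functions_mult dilate_test assms C_diff_mult C_diff_const C_diff_add C_diff_vec_nth)
  moreover have "(\<lambda>z. (\<sigma> ^ (CARD('n) - 1) * (z $ j + - x $ j)) * dilate x \<sigma> z) = (\<lambda>z. flux x \<sigma> z $ j)"
    by (auto simp: flux_def fun_eq_iff)
  ultimately show ?thesis by simp
qed

lemma dilate_partial:
  "partial_deriv j (dilate x \<sigma>) z = \<sigma> * partial_deriv j \<eta> (zoom x \<sigma> z)"
proof -
  have "(dilate x \<sigma> has_derivative (\<lambda>v. \<Sum>i\<in>UNIV. (\<sigma> *\<^sub>R v) $ i * partial_deriv i \<eta> (zoom x \<sigma> z))) (at z)"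
    unfolding dilate_def using linear_scaleR[of \<sigma>]
    by (intro partial_deriv_affine test_functions_differentiable test) auto
  then have "partial_deriv j (dilate x \<sigma>) z = (\<Sum>i\<in>UNIV. (\<sigma> *\<^sub>R axis j 1) $ i * partial_deriv i \<eta> (zoom x \<sigma> z))"
    by (rule partial_deriv_eq)
  also have "\<dots> = (\<Sum>i\<in>UNIV. if j = i then \<sigma> * partial_deriv i \<eta> (zoom x \<sigma> z) else 0)"
    by (intro sum.cong) (auto simp: axis_def)
  finally show ?thesis by simp
qed

lemma flux_partial:
  assumes "0 < \<sigma>"
  shows "partial_deriv j (\<lambda>z. flux x \<sigma> z $ j) z = \<sigma> ^ (CARD('n) - 1) * dilate x \<sigma> z
    + \<sigma> ^ CARD('n) * ((z - x) $ j * partial_deriv j \<eta> (zoom x \<sigma> z))"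
proof -
  have d: "((\<lambda>z. \<sigma> ^ (CARD('n) - 1) * (z $ j + - x $ j)) has_derivative (\<lambda>v. \<sigma> ^ (CARD('n) - 1) * v $ j)) (at z)"
    by (auto intro!: derivative_eq_intros bounded_linear_imp_has_derivative bounded_linear_vec_nth)
  have "(\<lambda>z. flux x \<sigma> z $ j) = (\<lambda>z. (\<sigma> ^ (CARD('n) - 1) * (z $ j + - x $ j)) * dilate x \<sigma> z)"
    by (auto simp: flux_def fun_eq_iff)
  then have "partial_deriv j (\<lambda>z. flux x \<sigma> z $ j) z =
      (\<sigma> ^ (CARD('n) - 1) * (z $ j + - x $ j)) * (\<sigma> * partial_deriv j \<eta> (zoom x \<sigma> z))
      + \<sigma> ^ (CARD('n) - 1) * dilate x \<sigma> z"
    using partial_deriv_mult[OF differentiableI[OF d] test_functions_differentiable[OF dilate_test[OF assms]], of j x]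
    by (simp only: dilate_partial partial_deriv_eq[OF d]) simp
  moreover have "\<sigma> ^ CARD('n) = \<sigma> ^ (CARD('n) - 1) * \<sigma>"
    using power_Suc2[of \<sigma> "CARD('n) - 1"] by simp
  ultimately show ?thesis by (simp add: algebra_simps)
qed

text \<open>The product rule in \<open>\<sigma>\<close> gives \<open>n \<sigma>^(n-1) \<eta> +
  \<sigma>^n (z - x) \<bullet> D\<eta>\<close> at the dilated point. In the divergence of
  \<open>flux\<close> the factor \<open>z - x\<close> contributes the first term, once per
  coordinate, and the dilated kernel the second.\<close>

lemma kernel_derivative:
  assumes "0 < \<sigma>"
  shows "((\<lambda>\<sigma>. kernel x \<sigma> z) has_real_derivative
    (\<Sum>j\<in>UNIV. partial_deriv j (\<lambda>z. flux x \<sigma> z $ j) z)) (at \<sigma>)"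
proof -
  have "((\<lambda>\<sigma>. zoom x \<sigma> z) has_derivative (\<lambda>h. h *\<^sub>R (z - x))) (at \<sigma>)"
    by (auto intro!: derivative_eq_intros simp: algebra_simps)
  from has_derivative_compose[OF this has_derivative_partial_deriv[OF test_functions_differentiable[OF test]]]
  have "((\<lambda>\<sigma>. dilate x \<sigma> z) has_derivative
      (\<lambda>h. \<Sum>j\<in>UNIV. (h *\<^sub>R (z - x)) $ j * partial_deriv j \<eta> (zoom x \<sigma> z))) (at \<sigma>)"
    by (simp add: dilate_def)
  then have "((\<lambda>\<sigma>. dilate x \<sigma> z) has_real_derivative
      (\<Sum>j\<in>UNIV. (z - x) $ j * partial_deriv j \<eta> (zoom x \<sigma> z))) (at \<sigma>)"
    unfolding has_field_derivative_def
    by (rule has_derivative_eq_rhs) (auto simp: sum_distrib_left mult_ac intro!: sum.cong)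
  then have "((\<lambda>\<sigma>. kernel x \<sigma> z) has_real_derivative
     real CARD('n) * \<sigma> ^ (CARD('n) - 1) * dilate x \<sigma> z
     + (\<Sum>j\<in>UNIV. (z - x) $ j * partial_deriv j \<eta> (zoom x \<sigma> z)) * \<sigma> ^ CARD('n)) (at \<sigma>)"
    using DERIV_pow[of "CARD('n)" \<sigma>] by (intro DERIV_mult) auto
  moreover have "(\<Sum>j\<in>UNIV. partial_deriv j (\<lambda>z. flux x \<sigma> z $ j) z) = real CARD('n) * \<sigma> ^ (CARD('n) - 1) * dilate x \<sigma> z
     + (\<Sum>j\<in>UNIV. (z - x) $ j * partial_deriv j \<eta> (zoom x \<sigma> z)) * \<sigma> ^ CARD('n)"
    by (simp add: flux_partial[OF assms] sum.distrib sum_distrib_left mult.commute)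
  ultimately show ?thesis by simp
qed

section \<open>Averages over concentrating kernels\<close>

definition average :: "(real ^ 'n \<Rightarrow> real) \<Rightarrow> real ^ 'n \<Rightarrow> real \<Rightarrow> real" where
  "average u x \<sigma> = (\<integral>z. kernel x \<sigma> z * u z \<partial>lebesgue)"

text \<open>Differentiation under the integral sign replaces the kernel by the divergence of
  \<open>flux\<close>. The components of \<open>flux\<close> are test functions, so the definition
  of the weak derivative moves the divergence onto \<open>u\<close>.\<close>

lemma average_derivative:
  assumes u: "continuous_on UNIV u" and \<sigma>: "1/2 < \<sigma>"
    and G: "\<And>j. has_weak_partial u j (\<lambda>z. G z $ j)"
  shows "(average u x has_real_derivative - (\<integral>z. G z \<bullet> flux x \<sigma> z \<partial>lebesgue)) (at \<sigma>)"
proof -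
  \<comment> \<open>Scales are used from 1 onwards; starting the open half-line at 1/2 makes 1 an
    interior point and keeps all kernels inside one box.\<close>
  define U where "U = {1/2 <..} - ({} :: real set)"
  obtain a where ab: "cball x (2 * (r + norm x)) \<subseteq> cbox (- a) a"
    using bounded_subset_cbox_symmetric[OF bounded_cball] by metis
  have supp: "z \<in> cbox (- a) a" if "dilate x \<tau> z \<noteq> 0" "1/2 < \<tau>" for z \<tau>
  proof -
    have "norm (z - x) \<le> (r + norm x) / \<tau>" using dilate_support[of \<tau> x z] that by simp
    also have "\<dots> \<le> (r + norm x) / (1/2)" using that r_nonneg by (intro divide_left_mono) auto
    finally have "z \<in> cball x (2 * (r + norm x))" by (simp add: dist_norm norm_minus_commute)
    then show ?thesis using ab by blast
  qed
  \<comment> \<open>The divergence of \<open>flux\<close> written out, so that its joint continuity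
    in scale and point is visible.\<close>
  define D where "D \<tau> z = (\<Sum>j\<in>UNIV. \<tau> ^ (CARD('n) - 1) * dilate x \<tau> z
    + \<tau> ^ CARD('n) * ((z - x) $ j * partial_deriv j \<eta> (zoom x \<tau> z)))" for \<tau> z
  have cK: "continuous_on UNIV (\<lambda>z. kernel x \<tau> z * u z)" if "1/2 < \<tau>" for \<tau>
    using that by (intro continuous_intros u test_functions_continuous dilate_test) auto
  have cD: "continuous_on (U \<times> cbox (- a) a) (\<lambda>(\<tau>, z). D \<tau> z * u z)"
    unfolding D_def dilate_def case_prod_beta
    by (intro continuous_intros continuous_on_compose2[OF test_functions_continuous[OF test]]
        continuous_on_compose2[OF test_functions_continuous[OF test_functions_partial_deriv[OF test]]]
        continuous_on_compose2[OF u]) auto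
  have "((\<lambda>\<tau>. integral (cbox (- a) a) (\<lambda>z. kernel x \<tau> z * u z)) has_field_derivative
      integral (cbox (- a) a) (\<lambda>z. D \<sigma> z * u z)) (at \<sigma> within U)"
  proof (rule leibniz_rule_field_derivative)
    fix \<tau> z assume \<tau>: "\<tau> \<in> U"
    then have t0: "0 < \<tau>" by (auto simp: U_def)
    show "((\<lambda>\<tau>. kernel x \<tau> z * u z) has_field_derivative D \<tau> z * u z) (at \<tau> within U)"
      using has_field_derivative_at_within[OF DERIV_cmult_right[OF kernel_derivative[OF t0, of x z]]]
      unfolding D_def flux_partial[OF t0] .
    show "(\<lambda>z. kernel x \<tau> z * u z) integrable_on cbox (- a) a"
      using cK[of \<tau>] \<tau> by (intro integrable_continuous) (auto simp: U_def intro: continuous_on_subset)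
  qed (use cD \<sigma> in \<open>auto simp: U_def\<close>)
  then have 1: "((\<lambda>\<tau>. integral (cbox (- a) a) (\<lambda>z. kernel x \<tau> z * u z)) has_field_derivative
      integral (cbox (- a) a) (\<lambda>z. D \<sigma> z * u z)) (at \<sigma>)"
    using \<sigma> by (simp add: U_def at_within_open[of _ "{1/2<..}"])
  have 2: "(average u x has_real_derivative integral (cbox (- a) a) (\<lambda>z. D \<sigma> z * u z)) (at \<sigma>)"
  proof (rule has_field_derivative_transform_within_open[OF 1])
    fix \<tau> :: real assume "\<tau> \<in> {1/2<..}"
    then have \<tau>: "1/2 < \<tau>" by simp
    show "integral (cbox (- a) a) (\<lambda>z. kernel x \<tau> z * u z) = average u x \<tau>"
      unfolding average_def using supp[OF _ \<tau>] by (intro integral_cbox_eq_lebesgue cK \<tau>) auto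
  qed (use \<sigma> in auto)
  have s0: "0 < \<sigma>" using \<sigma> by simp
  have Deq: "D \<sigma> z = (\<Sum>j\<in>UNIV. partial_deriv j (\<lambda>z. flux x \<sigma> z $ j) z)" for z
    by (simp add: D_def flux_partial[OF s0])
  have ft: "partial_deriv j (\<lambda>z. flux x \<sigma> z $ j) \<in> test_functions" for j
    by (intro test_functions_partial_deriv flux_test s0)
  have uL: "u \<in> L1_loc" by (rule continuous_L1_loc[OF u])
  have "integral (cbox (- a) a) (\<lambda>z. D \<sigma> z * u z) = (\<integral>z. D \<sigma> z * u z \<partial>lebesgue)"
  proof (rule integral_cbox_eq_lebesgue)
    show "continuous_on UNIV (\<lambda>z. D \<sigma> z * u z)"
      unfolding Deq by (intro continuous_intros u test_functions_continuous ft)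
    fix z assume z: "D \<sigma> z * u z \<noteq> 0"
    show "z \<in> cbox (- a) a"
    proof (rule ccontr)
      assume "z \<notin> cbox (- a) a"
      then have "z \<in> - cbox (- a) a" by simp
      have "((\<lambda>w. flux x \<sigma> w $ j) has_derivative (\<lambda>v. 0)) (at z)" for j
      proof (rule has_derivative_transform_within_open[OF has_derivative_const[of 0]])
        show "open (- cbox (- a) a)" by (rule open_Compl[OF closed_cbox])
        show "z \<in> - cbox (- a) a" by fact
        show "0 = flux x \<sigma> w $ j" if "w \<in> - cbox (- a) a" for w
          using supp[of \<sigma> w] that \<sigma> by (auto simp: flux_def)
      qed
      from partial_deriv_eq[OF this] have "D \<sigma> z = 0" unfolding Deq by (intro sum.neutral) simp
      then show False using z by simp
    qed
  qed
  also have "\<dots> = (\<integral>z. (\<Sum>j\<in>UNIV. u z * partial_deriv j (\<lambda>z. flux x \<sigma> z $ j) z) \<partial>lebesgue)"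
    by (simp add: Deq sum_distrib_left mult.commute)
  also have "\<dots> = (\<Sum>j\<in>UNIV. \<integral>z. u z * partial_deriv j (\<lambda>z. flux x \<sigma> z $ j) z \<partial>lebesgue)"
    by (intro Bochner_Integration.integral_sum L1_loc_test_integrable uL ft)
  also have "\<dots> = (\<Sum>j\<in>UNIV. - (\<integral>z. G z $ j * flux x \<sigma> z $ j \<partial>lebesgue))"
    using G flux_test[OF s0] by (simp add: has_weak_partial_def)
  also have "\<dots> = - (\<integral>z. (\<Sum>j\<in>UNIV. G z $ j * flux x \<sigma> z $ j) \<partial>lebesgue)"
    unfolding sum_negf using G
    by (subst Bochner_Integration.integral_sum)
      (auto intro!: L1_loc_test_integrable flux_test s0 simp: has_weak_partial_def)
  finally show ?thesis using 2 by (simp add: inner_vec_def)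
qed

lemma integral_dilate: "0 < \<sigma> \<Longrightarrow> (\<integral>z. kernel x \<sigma> z \<partial>lebesgue) = 1"
  using lebesgue_integral_scaling[OF test_functions_continuous[OF test], of \<sigma> "x - \<sigma> *\<^sub>R x"] integral_1
  by (simp add: dilate_def add.commute)

text \<open>The kernel is a probability density carried by points within
  \<open>(r + R) / \<sigma>\<close> of \<open>x\<close>. The Hoelder constant of \<open>u\<close>,
  which is not bounded in terms of the gradient at this stage, enters only here, in a term that
  vanishes as \<open>\<sigma>\<close> tends to infinity.\<close>

lemma average_approx:
  assumes u: "continuous_on UNIV u" and \<sigma>: "0 < \<sigma>" and \<alpha>: "0 < \<alpha>" and K: "0 \<le> K"
    and hol: "\<And>x y. dist (u x) (u y) \<le> K * dist x y powr \<alpha>" and x: "norm x \<le> R"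
  shows "\<bar>average u x \<sigma> - u x\<bar> \<le> K * ((r + R) / \<sigma>) powr \<alpha>"
proof -
  have R: "0 \<le> R" using x norm_ge_zero order_trans by blast
  have di: "integrable lebesgue (\<lambda>z. kernel x \<sigma> z)"
    by (intro integrable_mult_right test_functions_integrable dilate_test \<sigma>)
  have dui: "integrable lebesgue (\<lambda>z. kernel x \<sigma> z * u z)"
    using integrable_mult_right[OF L1_loc_test_integrable[OF continuous_L1_loc[OF u] dilate_test[OF \<sigma>]], of "\<sigma> ^ CARD('n)" x]
    by (simp add: mult_ac)
  have "average u x \<sigma> - u x = (\<integral>z. kernel x \<sigma> z * u z \<partial>lebesgue) - (\<integral>z. kernel x \<sigma> z * u x \<partial>lebesgue)"
    using di integral_dilate[OF \<sigma>, of x] by (simp add: average_def)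
  also have "\<dots> = (\<integral>z. kernel x \<sigma> z * u z - kernel x \<sigma> z * u x \<partial>lebesgue)"
    using di dui by (intro Bochner_Integration.integral_diff[symmetric] integrable_mult_left) auto
  finally have eq: "average u x \<sigma> - u x = (\<integral>z. kernel x \<sigma> z * u z - kernel x \<sigma> z * u x \<partial>lebesgue)" .
  have d0: "0 \<le> dilate x \<sigma> z" for z using nonneg by (simp add: dilate_def)
  have pt: "\<bar>kernel x \<sigma> z * u z - kernel x \<sigma> z * u x\<bar>
      \<le> kernel x \<sigma> z * (K * ((r + R) / \<sigma>) powr \<alpha>)" for z
  proof (cases "dilate x \<sigma> z = 0")
    case False
    have "norm (z - x) \<le> (r + R) / \<sigma>"
      by (rule dilate_support_le[OF \<sigma> False x])
    then have "K * dist z x powr \<alpha> \<le> K * ((r + R) / \<sigma>) powr \<alpha>"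
      using \<alpha> K by (intro mult_left_mono powr_mono2) (auto simp: dist_norm)
    then have "\<bar>u z - u x\<bar> \<le> K * ((r + R) / \<sigma>) powr \<alpha>" using hol[of z x] by (simp add: dist_real_def)
    then have "kernel x \<sigma> z * \<bar>u z - u x\<bar> \<le> kernel x \<sigma> z * (K * ((r + R) / \<sigma>) powr \<alpha>)"
      using \<sigma> d0 by (intro mult_left_mono) auto
    moreover have "\<bar>kernel x \<sigma> z * u z - kernel x \<sigma> z * u x\<bar> = kernel x \<sigma> z * \<bar>u z - u x\<bar>"
      unfolding right_diff_distrib[symmetric] using \<sigma> d0[of z] by (simp add: abs_mult)
    ultimately show ?thesis by simp
  qed simp
  have "\<bar>average u x \<sigma> - u x\<bar> \<le> (\<integral>z. \<bar>kernel x \<sigma> z * u z - kernel x \<sigma> z * u x\<bar> \<partial>lebesgue)"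
    unfolding eq by (rule integral_abs_bound)
  also have "\<dots> \<le> (\<integral>z. kernel x \<sigma> z * (K * ((r + R) / \<sigma>) powr \<alpha>) \<partial>lebesgue)"
    by (intro integral_mono integrable_abs Bochner_Integration.integrable_diff dui integrable_mult_left di pt)
  also have "\<dots> = K * ((r + R) / \<sigma>) powr \<alpha>" using di integral_dilate[OF \<sigma>, of x] by simp
  finally show ?thesis .
qed

text \<open>A bound for the \<open>L^q\<close> norm of \<open>flux\<close> at scale 1: its height
  \<open>B (r + R)\<close> times the \<open>q\<close>-th root of the volume of a ball of radius
  \<open>r + R\<close>.\<close>

definition flux_const :: "real \<Rightarrow> real \<Rightarrow> real" where
  "flux_const q R = B * (r + R) * (unit_ball_vol CARD('n) * (r + R) ^ CARD('n)) powr (1 / q)"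

text \<open>Height times a root of the volume: the field is at most
  \<open>\<sigma> ^ (n - 1) * B * s\<close> and lives on a ball of radius
  \<open>s = (r + R) / \<sigma>\<close>. The exponents \<open>n - 2\<close> from the height and
  \<open>- n / q\<close> from the volume add up to \<open>n / p - 2\<close>.\<close>

lemma flux_Lp:
  assumes pq: "1 < p" "1 / p + 1 / q = 1" and \<sigma>: "0 < \<sigma>" and x: "norm x \<le> R"
  shows "flux x \<sigma> \<in> Lp_fun q"
    and "Lp_norm q (flux x \<sigma>) \<le> flux_const q R * \<sigma> powr (real CARD('n) / p - 2)"
proof -
  have R: "0 \<le> R" using x norm_ge_zero order_trans by blast
  have q: "1 < q" using conjugate_exponents[OF pq] by simp
  define s where "s = (r + R) / \<sigma>"
  define M where "M = \<sigma> ^ (CARD('n) - 1) * B * s"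
  have s0: "0 \<le> s" using \<sigma> R r_nonneg by (simp add: s_def)
  have supp: "norm (z - x) \<le> s" if "dilate x \<sigma> z \<noteq> 0" for z
    unfolding s_def by (rule dilate_support_le[OF \<sigma> that x])
  have bd: "norm (flux x \<sigma> z) \<le> M" for z
  proof (cases "dilate x \<sigma> z = 0")
    case True then show ?thesis using \<sigma> s0 B_nonneg by (simp add: flux_def M_def)
  next
    case False
    have d: "0 \<le> dilate x \<sigma> z" "dilate x \<sigma> z \<le> B" using nonneg bound by (auto simp: dilate_def)
    have "norm (flux x \<sigma> z) = \<sigma> ^ (CARD('n) - 1) * dilate x \<sigma> z * norm (z - x)"
      using \<sigma> d by (simp add: flux_def)
    also have "\<dots> \<le> \<sigma> ^ (CARD('n) - 1) * B * s"
      using \<sigma> d supp[OF False] s0 B_nonneg by (intro mult_mono mult_nonneg_nonneg) auto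
    finally show ?thesis by (simp add: M_def)
  qed
  have meas: "flux x \<sigma> \<in> borel_measurable lebesgue"
  proof -
    have "continuous_on UNIV (flux x \<sigma>)"
      unfolding flux_def[abs_def] by (intro continuous_intros test_functions_continuous dilate_test \<sigma>)
    then show ?thesis by (rule continuous_borel_measurable_lebesgue)
  qed
  have zs: "z \<in> cball x s" if "flux x \<sigma> z \<noteq> 0" for z
    using supp[of z] that by (auto simp: flux_def dist_norm norm_minus_commute)
  note b = Lp_norm_bounded_support[OF _ meas bd s0 zs, of q]
  show "flux x \<sigma> \<in> Lp_fun q" using b(1) q by simp
  have "Lp_norm q (flux x \<sigma>) \<le> M * (unit_ball_vol (DIM(real ^ 'n)) * s ^ DIM(real ^ 'n)) powr (1 / q)"
    using b(2) q by simp
  also have "\<dots> = M * (unit_ball_vol CARD('n) * (r + R) ^ CARD('n) / \<sigma> ^ CARD('n)) powr (1 / q)"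
    by (simp add: s_def power_divide)
  also have "\<dots> = M * ((unit_ball_vol CARD('n) * (r + R) ^ CARD('n)) powr (1 / q) * \<sigma> powr (- (real CARD('n) / q)))"
    using \<sigma> r_nonneg R by (simp add: powr_divide powr_minus_divide powr_powr flip: powr_realpow)
  also have "M = B * (r + R) * \<sigma> powr (real CARD('n) - 2)"
  proof -
    have "\<sigma> ^ (CARD('n) - 1) / \<sigma> = \<sigma> powr (real CARD('n) - 2)"
      using \<sigma> powr_realpow[of \<sigma> "CARD('n) - 1"] powr_diff[of \<sigma> "real CARD('n) - 1" 1] by (simp add: of_nat_diff)
    moreover have "M = B * (r + R) * (\<sigma> ^ (CARD('n) - 1) / \<sigma>)" by (simp add: M_def s_def)
    ultimately show ?thesis by simp
  qed
  also have "B * (r + R) * \<sigma> powr (real CARD('n) - 2) * ((unit_ball_vol CARD('n) * (r + R) ^ CARD('n)) powr (1 / q) * \<sigma> powr (- (real CARD('n) / q)))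
      = flux_const q R * (\<sigma> powr (real CARD('n) - 2) * \<sigma> powr (- (real CARD('n) / q)))"
    by (simp add: flux_const_def mult_ac)
  also have "\<sigma> powr (real CARD('n) - 2) * \<sigma> powr (- (real CARD('n) / q)) = \<sigma> powr (real CARD('n) / p - 2)"
  proof -
    have "1 / q = 1 - 1 / p" using pq by simp
    then have "real CARD('n) / q = real CARD('n) * (1 - 1 / p)" by (metis times_divide_eq_right mult.right_neutral)
    then have e: "real CARD('n) - 2 + - (real CARD('n) / q) = real CARD('n) / p - 2" by (simp add: right_diff_distrib)
    show ?thesis by (simp only: powr_add[symmetric] e)
  qed
  finally show "Lp_norm q (flux x \<sigma>) \<le> flux_const q R * \<sigma> powr (real CARD('n) / p - 2)" .
qed

text \<open>With \<open>\<beta> = 1 - n / p\<close> the derivative of the average is at most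
  \<open>c * t powr (- \<beta> - 1)\<close>, which is the derivative of
  \<open>- (c / \<beta>) * t powr (- \<beta>)\<close>. Since \<open>\<beta>\<close> is positive, the
  change from scale 1 to any larger scale stays below \<open>c / \<beta>\<close>.\<close>

lemma average_variation:
  assumes p: "real CARD('n) < p" and pq: "1 < p" "1 / p + 1 / q = 1" and u: "u \<in> D1p p"
    and x: "norm x \<le> R" and \<sigma>: "1 < \<sigma>"
  shows "\<bar>average u x \<sigma> - average u x 1\<bar>
    \<le> flux_const q R / (1 - real CARD('n) / p) * Lp_norm p (weak_grad u)"
proof -
  define \<beta> where "\<beta> = 1 - real CARD('n) / p"
  have \<beta>: "0 < \<beta>" using p pq by (simp add: \<beta>_def divide_less_eq)
  define c where "c = Lp_norm p (weak_grad u) * flux_const q R"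
  have R: "0 \<le> R" using x norm_ge_zero order_trans by blast
  have c: "0 \<le> c"
    unfolding c_def flux_const_def Lp_norm_def using R r_nonneg B_nonneg by (intro mult_nonneg_nonneg) auto
  have cont: "continuous_on UNIV u" by (rule D1p_continuous[OF u p])
  have p0: "0 < p" using pq by simp
  note d = average_derivative[OF cont _ D1p_weak_grad(1)[OF u p0], of _ x]
  have "norm (average u x \<sigma> - average u x 1) \<le> - (c / \<beta>) * \<sigma> powr (- \<beta>) - - (c / \<beta>) * 1 powr (- \<beta>)"
  proof (rule differentiable_bound_general[OF \<sigma>])
    show "continuous_on {1..\<sigma>} (average u x)"
      by (rule DERIV_continuous_on[OF has_field_derivative_at_within[OF d]]) auto
    show "continuous_on {1..\<sigma>} (\<lambda>t. - (c / \<beta>) * t powr (- \<beta>))"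
      by (intro continuous_intros) auto
    fix t assume t: "1 < t" "t < \<sigma>"
    show "(average u x has_vector_derivative - (\<integral>z. weak_grad u z \<bullet> flux x t z \<partial>lebesgue)) (at t)"
      using d[of t] t by (simp add: has_real_derivative_iff_has_vector_derivative)
    have "((\<lambda>t. - (c / \<beta>) * t powr (- \<beta>)) has_real_derivative - (c / \<beta>) * (- \<beta> * t powr (- \<beta> - 1))) (at t)"
      using t by (intro DERIV_cmult has_real_derivative_powr) auto
    then show "((\<lambda>t. - (c / \<beta>) * t powr (- \<beta>)) has_vector_derivative c * t powr (- \<beta> - 1)) (at t)"
      using \<beta> by (simp add: has_real_derivative_iff_has_vector_derivative)
    have "\<bar>\<integral>z. weak_grad u z \<bullet> flux x t z \<partial>lebesgue\<bar> \<le> Lp_norm p (weak_grad u) * Lp_norm q (flux x t)"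
      using t by (intro Lp_inner(2)[OF pq] D1p_weak_grad(2)[OF u p0] flux_Lp(1)[OF pq _ x]) auto
    also have "\<dots> \<le> Lp_norm p (weak_grad u) * (flux_const q R * t powr (real CARD('n) / p - 2))"
      using t by (intro mult_left_mono flux_Lp(2)[OF pq _ x]) (auto simp: Lp_norm_def)
    also have "real CARD('n) / p - 2 = - \<beta> - 1" by (simp add: \<beta>_def)
    finally show "norm (- (\<integral>z. weak_grad u z \<bullet> flux x t z \<partial>lebesgue)) \<le> c * t powr (- \<beta> - 1)"
      by (simp add: c_def mult.assoc)
  qed
  also have "\<dots> \<le> c / \<beta>" using c \<beta> by simp
  finally show ?thesis by (simp add: c_def \<beta>_def mult.commute)
qed

text \<open>At scale 1 the average about \<open>x\<close> is the integral of
  \<open>\<eta> u\<close>, the same number for every \<open>x\<close>; as the scale tends to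
  infinity it tends to \<open>u x\<close>. The variation in between is controlled by the gradient
  alone.\<close>

lemma morrey_estimate:
  assumes p: "real CARD('n) < p" and pq: "1 < p" "1 / p + 1 / q = 1" and u: "u \<in> D1p p"
    and x: "norm x \<le> R"
  shows "\<bar>u x - (\<integral>z. \<eta> z * u z \<partial>lebesgue)\<bar>
    \<le> flux_const q R / (1 - real CARD('n) / p) * Lp_norm p (weak_grad u)"
proof -
  define \<alpha> where "\<alpha> = 1 - real CARD('n) / p"
  have \<alpha>: "0 < \<alpha>" using p pq by (simp add: \<alpha>_def divide_less_eq)
  define c where "c = flux_const q R / (1 - real CARD('n) / p) * Lp_norm p (weak_grad u)"
  have cont: "continuous_on UNIV u" by (rule D1p_continuous[OF u p])
  obtain K where K: "\<And>x y. dist (u x) (u y) \<le> K * dist x y powr \<alpha>"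
    using u unfolding D1p_def holder_continuous_def \<alpha>_def by blast
  have K': "dist (u x) (u y) \<le> \<bar>K\<bar> * dist x y powr \<alpha>" for x y
    using K[of x y] mult_right_mono[OF abs_ge_self[of K], of "dist x y powr \<alpha>"] by simp
  have avg1: "average u x 1 = (\<integral>z. \<eta> z * u z \<partial>lebesgue)" by (simp add: average_def dilate_def)
  \<comment> \<open>Two successors keep the scale strictly above 1.\<close>
  have *: "\<bar>u x - average u x 1\<bar> \<le> \<bar>K\<bar> * ((r + R) * inverse (real (Suc (Suc m)))) powr \<alpha> + c" for m
  proof -
    have "\<bar>average u x (real (Suc (Suc m))) - u x\<bar> \<le> \<bar>K\<bar> * ((r + R) / real (Suc (Suc m))) powr \<alpha>"
      by (intro average_approx cont \<alpha> K' x) auto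
    moreover have "\<bar>average u x (real (Suc (Suc m))) - average u x 1\<bar> \<le> c"
      unfolding c_def by (intro average_variation p pq u x) simp
    ultimately show ?thesis by (simp add: divide_inverse)
  qed
  have "(\<lambda>m. \<bar>K\<bar> * ((r + R) * inverse (real (Suc (Suc m)))) powr \<alpha> + c) \<longlonglongrightarrow> \<bar>K\<bar> * ((r + R) * 0) powr \<alpha> + c"
    using \<alpha> x r_nonneg norm_ge_zero[of x]
    by (intro tendsto_intros tendsto_powr' LIMSEQ_Suc[OF LIMSEQ_inverse_real_of_nat]) 
      (auto intro!: always_eventually mult_nonneg_nonneg simp del: norm_ge_zero)
  then have "\<bar>u x - average u x 1\<bar> \<le> \<bar>K\<bar> * ((r + R) * 0) powr \<alpha> + c"
    by (rule LIMSEQ_le_const) (use * in blast)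
  then show ?thesis by (simp add: avg1 c_def)
qed

end

text \<open>A bump on the unit cube divided by its integral, which is positive because otherwise the
  open cube would be a null set.\<close>

lemma averaging_kernel_exists: "\<exists>(\<eta> :: real ^ 'n \<Rightarrow> real) r B. averaging_kernel \<eta> r B"
proof -
  define \<psi> where "\<psi> = box_bump 1 (0 :: real ^ 'n) 1"
  have \<psi>: "\<psi> \<in> test_functions" unfolding \<psi>_def by (rule box_bump_test_function) simp
  have int: "integrable lebesgue \<psi>" by (rule test_functions_integrable[OF \<psi>])
  have nn: "0 \<le> \<psi> x" for x unfolding \<psi>_def by (rule box_bump_bounds)
  define I where "I = (\<integral>x. \<psi> x \<partial>lebesgue)"
  have "I \<noteq> 0"
  proof
    assume "I = 0"
    then have "AE x in lebesgue. \<psi> x = 0"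
      using integral_nonneg_eq_0_iff_AE[OF int] nn by (simp add: I_def)
    then have "AE x in lebesgue. x \<notin> box (0 :: real ^ 'n) 1"
      by eventually_elim (use box_bump_pos_iff[of 1 "0 :: real ^ 'n" 1] in \<open>auto simp: \<psi>_def\<close>)
    then have "box (0 :: real ^ 'n) 1 \<in> null_sets lebesgue"
      by (subst AE_iff_null_sets) auto
    then have "box (0 :: real ^ 'n) 1 = {}"
      using negligible_interval(2)[of "0 :: real ^ 'n" 1] negligible_iff_null_sets by blast
    moreover have "(\<chi> i. 1/2) \<in> box (0 :: real ^ 'n) 1" by (simp add: mem_box_cart)
    ultimately show False by simp
  qed
  moreover have "0 \<le> I" unfolding I_def using nn by (intro integral_nonneg_AE) auto
  ultimately have I: "0 < I" by simp
  obtain r where r: "\<And>x. \<psi> x \<noteq> 0 \<Longrightarrow> norm x \<le> r" using test_functions_support[OF \<psi>] by blast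
  have "averaging_kernel (\<lambda>x. (1 / I) * \<psi> x) r (1 / I)"
  proof
    show "(\<lambda>x. (1 / I) * \<psi> x) \<in> test_functions" by (intro test_functions_mult C_diff_const \<psi>)
    show "(\<integral>x. (1 / I) * \<psi> x \<partial>lebesgue) = 1" using I int by (simp add: I_def)
    show "0 \<le> (1 / I) * \<psi> x" for x using I nn by simp
    show "(1 / I) * \<psi> x \<le> 1 / I" for x
      using I box_bump_bounds(2)[of 1 0 1 x] by (simp add: \<psi>_def divide_right_mono)
    show "norm x \<le> r" if "(1 / I) * \<psi> x \<noteq> 0" for x using r that by auto
  qed
  then show ?thesis by blast
qed

lemma morrey_local_estimate:
  assumes p: "real CARD('n) < p" and pq: "1 < p" "1 / p + 1 / q = 1"
  shows "\<exists>C\<ge>0. \<forall>u :: real ^ 'n \<Rightarrow> real. u \<in> D1p p \<longrightarrow>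
    (\<exists>c. \<forall>x. norm x \<le> R \<longrightarrow> \<bar>u x - c\<bar> \<le> C * Lp_norm p (weak_grad u))"
proof -
  obtain \<eta> :: "real ^ 'n \<Rightarrow> real" and r B where "averaging_kernel \<eta> r B"
    using averaging_kernel_exists by blast
  then interpret averaging_kernel \<eta> r B .
  have "\<bar>u x - (\<integral>z. \<eta> z * u z \<partial>lebesgue)\<bar>
    \<le> \<bar>flux_const q R / (1 - real CARD('n) / p)\<bar> * Lp_norm p (weak_grad u)"
    if "u \<in> D1p p" "norm x \<le> R" for u x
    using morrey_estimate[OF p pq that]
      mult_right_mono[OF abs_ge_self[of "flux_const q R / (1 - real CARD('n) / p)"], of "Lp_norm p (weak_grad u)"]
    by (simp add: Lp_norm_def)
  \<comment> \<open>The absolute value makes the constant nonnegative also for negative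
    \<open>R\<close>, where the estimate is vacuous.\<close>
  then show ?thesis by (intro exI[of _ "\<bar>flux_const q R / (1 - real CARD('n) / p)\<bar>"]) (use abs_ge_zero in blast)
qed

section \<open>Similarities\<close>

lemma nn_integral_lborel_translate:
  fixes f :: "'a::euclidean_space \<Rightarrow> ennreal"
  assumes f: "f \<in> borel_measurable borel"
  shows "(\<integral>\<^sup>+x. f (x + c) \<partial>lborel) = (\<integral>\<^sup>+x. f x \<partial>lborel)"
proof -
  have "(\<integral>\<^sup>+x. f x \<partial>distr lborel borel ((+) c)) = (\<integral>\<^sup>+x. f (c + x) \<partial>lborel)"
    using f by (intro nn_integral_distr) auto
  then show ?thesis by (simp add: lborel_distr_plus add.commute)
qed

text \<open>Both \<open>lborel\<close> and its image are translation invariant, so by Fubini they are proportional;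
  they agree on the unit ball.\<close>

lemma lborel_distr_orthogonal:
  fixes R :: "'a::euclidean_space \<Rightarrow> 'a"
  assumes R: "orthogonal_transformation R"
  shows "distr lborel borel R = lborel"
proof (rule measure_eqI)
  have lin: "linear R" using R by (simp add: orthogonal_transformation_linear)
  have Rm [measurable]: "R \<in> borel_measurable borel"
    by (intro borel_measurable_continuous_onI linear_continuous_on) (simp add: lin linear_conv_bounded_linear[symmetric])
  fix A assume "A \<in> sets (distr lborel borel R)"
  then have A [measurable]: "A \<in> sets borel" by simp
  define b where "b = ball (0 :: 'a) 1"
  have [measurable]: "b \<in> sets borel" by (simp add: b_def)
  have ind [measurable]: "indicator A \<in> borel_measurable borel" "(indicator b :: 'a \<Rightarrow> ennreal) \<in> borel_measurable borel" by auto
  have "emeasure lborel (R -` A) * emeasure lborel b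
      = (\<integral>\<^sup>+x. indicator A (R x) * (\<integral>\<^sup>+y. indicator b y \<partial>lborel) \<partial>lborel)"
  proof -
    have "(\<lambda>x. indicator A (R x) :: ennreal) = indicator (R -` A)" by (auto simp: indicator_def)
    then have "emeasure lborel (R -` A) = (\<integral>\<^sup>+x. indicator A (R x) \<partial>lborel)"
      using measurable_sets[OF Rm A] by simp
    then show ?thesis by (simp add: nn_integral_multc)
  qed
  also have "\<dots> = (\<integral>\<^sup>+x. indicator A (R x) * (\<integral>\<^sup>+y. indicator b (y + (- R x)) \<partial>lborel) \<partial>lborel)"
    by (subst nn_integral_lborel_translate[OF ind(2)]) simp
  also have "\<dots> = (\<integral>\<^sup>+x. \<integral>\<^sup>+y. indicator A (R x) * indicator b (y + (- R x)) \<partial>lborel \<partial>lborel)"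
    by (intro nn_integral_cong nn_integral_cmult[symmetric]) measurable
  also have "\<dots> = (\<integral>\<^sup>+y. \<integral>\<^sup>+x. indicator A (R x) * indicator b (y + (- R x)) \<partial>lborel \<partial>lborel)"
    by (intro lborel_pair.Fubini'[symmetric]) measurable
  also have "\<dots> = (\<integral>\<^sup>+y. \<integral>\<^sup>+x. indicator A (R x + y) * indicator b (- R x) \<partial>lborel \<partial>lborel)"
  proof (rule nn_integral_cong)
    fix y :: 'a
    \<comment> \<open>Translating \<open>x\<close> by the preimage \<open>w\<close> of
      \<open>y\<close> turns \<open>y - R x\<close> into \<open>- R x\<close> and moves
      \<open>y\<close> into the argument of \<open>A\<close>; afterwards the two integrals
      separate.\<close>
    obtain w where w: "R w = y" using orthogonal_transformation_surj[OF R] by (metis surjD)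
    have "(\<integral>\<^sup>+x. indicator A (R (x + w)) * indicator b (y + (- R (x + w))) \<partial>lborel)
        = (\<integral>\<^sup>+x. indicator A (R x) * (indicator b (y + (- R x)) :: ennreal) \<partial>lborel)"
      by (rule nn_integral_lborel_translate) measurable
    then show "(\<integral>\<^sup>+x. indicator A (R x) * indicator b (y + (- R x)) \<partial>lborel) =
        (\<integral>\<^sup>+x. indicator A (R x + y) * (indicator b (- R x) :: ennreal) \<partial>lborel)"
      by (simp add: linear_add[OF lin] w)
  qed
  also have "\<dots> = (\<integral>\<^sup>+x. \<integral>\<^sup>+y. indicator A (R x + y) * indicator b (- R x) \<partial>lborel \<partial>lborel)"
    by (intro lborel_pair.Fubini') measurable
  also have "\<dots> = (\<integral>\<^sup>+x. emeasure lborel A * indicator b x \<partial>lborel)"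
  proof (rule nn_integral_cong)
    fix x :: 'a
    have "(\<integral>\<^sup>+y. indicator A (R x + y) * indicator b (- R x) \<partial>lborel)
        = (\<integral>\<^sup>+y. indicator A (y + R x) \<partial>lborel) * (indicator b (- R x) :: ennreal)"
      by (subst nn_integral_multc[symmetric]) (auto simp: add.commute)
    also have "(\<integral>\<^sup>+y. indicator A (y + R x) \<partial>lborel) = emeasure lborel A"
      by (subst nn_integral_lborel_translate[OF ind(1)]) simp
    \<comment> \<open>The ball is symmetric and \<open>R\<close> preserves norms, so
      \<open>- R x\<close> lies in \<open>b\<close> exactly when \<open>x\<close> does.\<close>
    finally show "(\<integral>\<^sup>+y. indicator A (R x + y) * indicator b (- R x) \<partial>lborel) = emeasure lborel A * indicator b x"
      using orthogonal_transformation_norm[OF R, of x] by (simp add: b_def indicator_def)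
  qed
  also have "\<dots> = emeasure lborel A * emeasure lborel b" by (simp add: nn_integral_cmult)
  finally have eq: "emeasure lborel b * emeasure lborel (R -` A) = emeasure lborel b * emeasure lborel A"
    by (simp add: mult.commute)
  have "emeasure lborel b \<noteq> 0"
  proof
    assume "emeasure lborel b = 0"
    then have "b \<in> null_sets lborel" by (auto simp: null_sets_def)
    then have "negligible b" by (simp add: negligible_iff_null_sets null_sets_completion_iff)
    moreover have "open b" "b \<noteq> {}" by (auto simp: b_def)
    ultimately show False using open_not_negligible by blast
  qed
  moreover have "emeasure lborel b < \<infinity>" by (rule emeasure_bounded_finite) (simp add: b_def)
  ultimately have "emeasure lborel (R -` A) = emeasure lborel A"
    using eq by (auto simp: ennreal_mult_cancel_left)
  then show "emeasure (distr lborel borel R) A = emeasure lborel A" by (simp add: emeasure_distr)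
qed simp

lemma lborel_similarity:
  fixes R :: "'a::euclidean_space \<Rightarrow> 'a"
  assumes R: "orthogonal_transformation R" and c: "0 < c"
  shows "lborel = density (distr lborel borel (\<lambda>y. c *\<^sub>R R y + z)) (\<lambda>_. ennreal (c ^ DIM('a)))"
proof -
  have Rm: "R \<in> borel_measurable borel"
    using orthogonal_transformation_linear[OF R]
    by (intro borel_measurable_continuous_onI linear_continuous_on) (simp add: linear_conv_bounded_linear[symmetric])
  have "distr lborel borel (\<lambda>y. c *\<^sub>R R y + z) = distr (distr lborel borel R) borel (\<lambda>y. z + c *\<^sub>R y)"
    using Rm by (subst distr_distr) (auto simp: comp_def add.commute)
  also have "\<dots> = distr lborel borel (\<lambda>y. z + c *\<^sub>R y)" by (simp add: lborel_distr_orthogonal[OF R])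
  finally show ?thesis using lborel_affine[of c z] c by (simp add: ennreal_power)
qed

text \<open>Weak gradients are only Lebesgue measurable, so the change of variables has to be lifted
  from Borel sets to the completion. The density is a positive constant, hence \<open>lborel\<close>
  and its image under \<open>S\<close> have the same null sets, and completion is compatible with
  image and density.\<close>

lemma
  fixes S :: "'a::euclidean_space \<Rightarrow> 'a"
  assumes S [measurable]: "S \<in> borel_measurable borel" and k: "0 < k"
    and eq: "lborel = density (distr lborel borel S) (\<lambda>_. ennreal k)"
  shows lebesgue_density_distr_measurable: "S \<in> lebesgue \<rightarrow>\<^sub>M lebesgue"
    and lebesgue_density_distr: "lebesgue = density (distr lebesgue lebesgue S) (\<lambda>_. ennreal k)"
proof -
  { fix A :: "'a set" assume A: "A \<in> sets borel"
    then have "emeasure lborel A = 0 \<longleftrightarrow> emeasure (density (distr lborel borel S) (\<lambda>_. ennreal k)) A = 0"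
      using eq by simp
    also have "\<dots> \<longleftrightarrow> emeasure (distr lebesgue lborel S) A = 0"
      using A k by (simp add: distr_completion emeasure_density nn_integral_cmult cong: distr_cong)
    finally have "emeasure lborel A = 0 \<longleftrightarrow> emeasure (distr lebesgue lborel S) A = 0" . }
  then have null: "null_sets lborel = null_sets (distr lebesgue lborel S)"
    by (auto simp: null_sets_def)
  show "S \<in> lebesgue \<rightarrow>\<^sub>M lebesgue"
    by (simp add: completion.measurable_completion2 null measurable_completion)
  have "lebesgue = completion (density (distr lborel borel S) (\<lambda>_. ennreal k))"
    by (simp flip: eq)
  also have "\<dots> = density (completion (distr lebesgue lborel S)) (\<lambda>_. ennreal k)"
    using k by (auto intro!: always_eventually completion_density_eq simp: distr_completion cong: distr_cong)
  also have "\<dots> = density (distr lebesgue lebesgue S) (\<lambda>_. ennreal k)"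
    by (subst completion.completion_distr_eq) (auto simp: null measurable_completion)
  finally show "lebesgue = density (distr lebesgue lebesgue S) (\<lambda>_. ennreal k)" .
qed

section \<open>Composition with a similarity\<close>

locale similarity =
  fixes c :: real and R :: "real ^ 'n \<Rightarrow> real ^ 'n" and z :: "real ^ 'n"
  assumes c: "0 < c" and R: "orthogonal_transformation R"
begin

definition S :: "real ^ 'n \<Rightarrow> real ^ 'n" where "S y = c *\<^sub>R R y + z"

definition T :: "real ^ 'n \<Rightarrow> real ^ 'n" where "T y = (1 / c) *\<^sub>R inv R y + (1 / c) *\<^sub>R inv R (- z)"

lemma R_linear: "linear R" using R by (simp add: orthogonal_transformation_linear)

lemma inv_R: "orthogonal_transformation (inv R)" by (rule orthogonal_transformation_inv[OF R])

lemma inv_R_linear: "linear (inv R)" using inv_R by (simp add: orthogonal_transformation_linear)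

lemma inv_R_R [simp]: "inv R (R y) = y" using orthogonal_transformation_inj[OF R] by simp

lemma R_inv_R [simp]: "R (inv R y) = y" using orthogonal_transformation_surj[OF R] by (simp add: surj_f_inv_f)

lemma T_S [simp]: "T (S y) = y"
  using c by (simp add: S_def T_def linear_add[OF inv_R_linear] linear_cmul[OF inv_R_linear]
      linear_neg[OF inv_R_linear] scaleR_add_right)

lemma S_T [simp]: "S (T y) = y"
  using c by (simp add: S_def T_def linear_add[OF R_linear] linear_cmul[OF R_linear]
      linear_diff[OF R_linear] linear_neg[OF inv_R_linear] linear_neg[OF R_linear] scaleR_diff_right)

lemma inj_S: "inj S"
  by (rule inj_on_inverseI[of _ T]) simp

lemma dist_S: "dist (S x) (S y) = c * dist x y"
proof -
  have "S x - S y = c *\<^sub>R R (x - y)" by (simp add: S_def linear_diff[OF R_linear] scaleR_diff_right)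
  then show ?thesis using c by (simp add: dist_norm orthogonal_transformation_norm[OF R])
qed

lemma continuous_S: "continuous_on A S"
  unfolding S_def using R_linear
  by (intro continuous_intros linear_continuous_on) (simp add: linear_conv_bounded_linear)

lemma continuous_T: "continuous_on A T"
  unfolding T_def using inv_R_linear
  by (intro continuous_intros linear_continuous_on) (simp add: linear_conv_bounded_linear)

lemma S_borel: "S \<in> borel_measurable borel" and T_borel: "T \<in> borel_measurable borel"
  by (intro borel_measurable_continuous_onI continuous_S continuous_T)+

lemma ck: "0 < c ^ CARD('n)" using c by simp

lemma lborel_eq: "lborel = density (distr lborel borel S) (\<lambda>_. ennreal (c ^ CARD('n)))"
  using lborel_similarity[OF R c, of z] by (simp add: S_def[abs_def])

lemma S_lebesgue [measurable]: "S \<in> lebesgue \<rightarrow>\<^sub>M lebesgue"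
  by (rule lebesgue_density_distr_measurable[OF S_borel ck lborel_eq])

lemma lebesgue_eq: "lebesgue = density (distr lebesgue lebesgue S) (\<lambda>_. ennreal (c ^ CARD('n)))"
  by (rule lebesgue_density_distr[OF S_borel ck lborel_eq])

lemma integrable_S:
  fixes f :: "real ^ 'n \<Rightarrow> real"
  assumes f: "f \<in> borel_measurable lebesgue"
  shows "integrable lebesgue (\<lambda>x. f (S x)) \<longleftrightarrow> integrable lebesgue f"
proof -
  have "integrable lebesgue f \<longleftrightarrow> integrable (density (distr lebesgue lebesgue S) (\<lambda>_. ennreal (c ^ CARD('n)))) f"
    by (subst lebesgue_eq) simp
  also have "\<dots> \<longleftrightarrow> integrable (distr lebesgue lebesgue S) (\<lambda>x. c ^ CARD('n) *\<^sub>R f x)"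
    using f c by (intro integrable_density) auto
  also have "\<dots> \<longleftrightarrow> integrable lebesgue (\<lambda>x. c ^ CARD('n) *\<^sub>R f (S x))"
    using f by (intro integrable_distr_eq S_lebesgue borel_measurable_scaleR) auto
  also have "\<dots> \<longleftrightarrow> integrable lebesgue (\<lambda>x. f (S x))" using c by simp
  finally show ?thesis ..
qed

lemma integral_S:
  fixes f :: "real ^ 'n \<Rightarrow> real"
  assumes f: "f \<in> borel_measurable lebesgue"
  shows "c ^ CARD('n) * (\<integral>x. f (S x) \<partial>lebesgue) = (\<integral>x. f x \<partial>lebesgue)"
proof -
  have "(\<integral>x. f x \<partial>lebesgue) = integral\<^sup>L (density (distr lebesgue lebesgue S) (\<lambda>_. ennreal (c ^ CARD('n)))) f"
    by (subst lebesgue_eq) simp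
  also have "\<dots> = (\<integral>x. c ^ CARD('n) *\<^sub>R f x \<partial>distr lebesgue lebesgue S)"
    using f c by (intro integral_density) auto
  also have "\<dots> = (\<integral>x. c ^ CARD('n) *\<^sub>R f (S x) \<partial>lebesgue)"
    using f by (intro integral_distr S_lebesgue borel_measurable_scaleR) auto
  finally show ?thesis by simp
qed

lemma L1_loc_S:
  assumes g: "g \<in> L1_loc" shows "(\<lambda>x. g (S x)) \<in> L1_loc"
  unfolding L1_loc_def
proof (intro CollectI allI impI)
  fix K :: "(real ^ 'n) set" assume "compact K"
  then have K: "compact (S ` K)" by (intro compact_continuous_image continuous_S)
  then have int: "integrable lebesgue (\<lambda>x. indicator (S ` K) x *\<^sub>R g x)"
    using g by (simp add: L1_loc_def set_integrable_def)
  have "integrable lebesgue (\<lambda>x. indicator (S ` K) (S x) *\<^sub>R g (S x))"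
    using int integrable_S[OF borel_measurable_integrable[OF int]] by simp
  moreover have "S x \<in> S ` K \<longleftrightarrow> x \<in> K" for x using inj_S by (rule inj_image_mem_iff)
  ultimately show "set_integrable lebesgue K (\<lambda>x. g (S x))"
    by (simp add: set_integrable_def indicator_def)
qed

text \<open>The chain rule for gradients: \<open>u o S\<close> has gradient
  \<open>c R^T (Du o S)\<close>, and the transpose of an orthogonal map is its inverse.\<close>

definition pull :: "(real ^ 'n \<Rightarrow> real ^ 'n) \<Rightarrow> real ^ 'n \<Rightarrow> real ^ 'n" where
  "pull G x = c *\<^sub>R inv R (G (S x))"

lemma norm_pull: "norm (pull G x) = c * norm (G (S x))"
  using c by (simp add: pull_def orthogonal_transformation_norm[OF inv_R])

lemma pull_nth: "pull G x $ i = c * (\<Sum>j\<in>UNIV. R (axis i 1) $ j * G (S x) $ j)"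
proof -
  have "inv R (G (S x)) $ i = axis i 1 \<bullet> inv R (G (S x))" by (subst inner_commute) (simp add: inner_axis)
  also have "\<dots> = R (axis i 1) \<bullet> R (inv R (G (S x)))"
  proof -
    have "R v \<bullet> R w = v \<bullet> w" for v w using R by (simp add: orthogonal_transformation_def)
    then show ?thesis by (rule sym)
  qed
  finally show ?thesis by (simp add: pull_def inner_vec_def)
qed

text \<open>A test function \<open>\<phi>\<close> for \<open>u o S\<close> is written as
  \<open>\<psi> o S\<close> with \<open>\<psi> = \<phi> o T\<close>. The change of variables puts
  the same factor \<open>c ^ n\<close> on both sides of the defining identity for \<open>u\<close>
  and \<open>\<psi>\<close>, and it cancels.\<close>

lemma has_weak_partial_S:
  assumes u: "u \<in> L1_loc" and G: "\<And>j. has_weak_partial u j (\<lambda>x. G x $ j)"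
  shows "has_weak_partial (\<lambda>x. u (S x)) i (\<lambda>x. pull G x $ i)"
  unfolding has_weak_partial_def
proof (intro conjI ballI)
  have GL: "(\<lambda>x. G x $ j) \<in> L1_loc" for j using G by (simp add: has_weak_partial_def)
  have sumL: "(\<lambda>x. \<Sum>j\<in>I. f j x) \<in> L1_loc" if "finite I" "\<And>j. f j \<in> L1_loc" for I :: "'n set" and f :: "'n \<Rightarrow> real ^ 'n \<Rightarrow> real"
    using that(1) by (induction I rule: finite_induct) (auto intro: L1_loc_add that(2) continuous_L1_loc)
  show pullL: "(\<lambda>x. pull G x $ i) \<in> L1_loc"
    unfolding pull_nth by (intro L1_loc_scale sumL L1_loc_S GL finite)
  fix \<phi> :: "real ^ 'n \<Rightarrow> real" assume \<phi>: "\<phi> \<in> test_functions"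
  define \<psi> where "\<psi> y = \<phi> (T y)" for y
  have \<psi>: "\<psi> \<in> test_functions"
    unfolding \<psi>_def T_def
  proof (rule test_functions_affine[OF \<phi>])
    show "linear (\<lambda>x. (1 / c) *\<^sub>R inv R x)" using inv_R_linear by (rule linear_compose_scale_right)
    show "0 < 1 / c" using c by simp
    show "1 / c * norm x \<le> norm ((1 / c) *\<^sub>R inv R x)" for x
      using c by (simp add: orthogonal_transformation_norm[OF inv_R])
  qed
  have \<phi>\<psi>: "\<phi> = (\<lambda>x. \<psi> (c *\<^sub>R R x + z))"
    using T_S by (simp add: \<psi>_def fun_eq_iff S_def)
  have linc: "linear (\<lambda>x. c *\<^sub>R R x)" using R_linear by (rule linear_compose_scale_right)
  have pd: "partial_deriv i \<phi> x = (\<Sum>j\<in>UNIV. c * R (axis i 1) $ j * partial_deriv j \<psi> (S x))" for x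
    unfolding \<phi>\<psi> using partial_deriv_eq[OF partial_deriv_affine[OF test_functions_differentiable[OF \<psi>] linc]]
    by (simp add: S_def)
  have m\<psi>: "(\<lambda>y. u y * partial_deriv j \<psi> y) \<in> borel_measurable lebesgue"
    "integrable lebesgue (\<lambda>y. u y * partial_deriv j \<psi> y)"
    "(\<lambda>y. G y $ j * \<psi> y) \<in> borel_measurable lebesgue" "integrable lebesgue (\<lambda>y. G y $ j * \<psi> y)" for j
    using L1_loc_test_integrable[OF u test_functions_partial_deriv[OF \<psi>], of j]
      L1_loc_test_integrable[OF GL \<psi>, of j] by auto
  note i\<psi> = m\<psi>(2)[folded integrable_S[OF m\<psi>(1)]] m\<psi>(4)[folded integrable_S[OF m\<psi>(3)]]
  have scaled: "c ^ CARD('n) * (\<integral>x. u (S x) * partial_deriv j \<psi> (S x) \<partial>lebesgue)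
      = - (c ^ CARD('n) * (\<integral>x. G (S x) $ j * \<psi> (S x) \<partial>lebesgue))" for j
    using integral_S[OF m\<psi>(1), of j] integral_S[OF m\<psi>(3), of j] G \<psi> by (simp add: has_weak_partial_def)
  have swap: "(\<integral>x. u (S x) * partial_deriv j \<psi> (S x) \<partial>lebesgue) = - (\<integral>x. G (S x) $ j * \<psi> (S x) \<partial>lebesgue)" for j
  proof -
    have "c ^ CARD('n) * a = c ^ CARD('n) * b \<Longrightarrow> a = b" for a b :: real using c by simp
    from this[OF scaled[unfolded mult_minus_right[symmetric]]] show ?thesis .
  qed
  have "(\<integral>x. u (S x) * partial_deriv i \<phi> x \<partial>lebesgue)
      = (\<integral>x. (\<Sum>j\<in>UNIV. (c * R (axis i 1) $ j) * (u (S x) * partial_deriv j \<psi> (S x))) \<partial>lebesgue)"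
    by (simp add: pd sum_distrib_left mult_ac)
  also have "\<dots> = (\<Sum>j\<in>UNIV. (c * R (axis i 1) $ j) * (\<integral>x. u (S x) * partial_deriv j \<psi> (S x) \<partial>lebesgue))"
    using i\<psi>(1) by (subst Bochner_Integration.integral_sum) auto
  also have "\<dots> = - (\<Sum>j\<in>UNIV. (c * R (axis i 1) $ j) * (\<integral>x. G (S x) $ j * \<psi> (S x) \<partial>lebesgue))"
    by (simp add: swap sum_negf)
  also have "(\<Sum>j\<in>UNIV. (c * R (axis i 1) $ j) * (\<integral>x. G (S x) $ j * \<psi> (S x) \<partial>lebesgue))
      = (\<integral>x. (\<Sum>j\<in>UNIV. (c * R (axis i 1) $ j) * (G (S x) $ j * \<psi> (S x))) \<partial>lebesgue)"
    using i\<psi>(2) by (subst Bochner_Integration.integral_sum) auto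
  also have "\<dots> = (\<integral>x. pull G x $ i * \<phi> x \<partial>lebesgue)"
    by (simp add: pull_nth \<psi>_def sum_distrib_left sum_distrib_right mult_ac)
  finally show "(\<integral>x. u (S x) * partial_deriv i \<phi> x \<partial>lebesgue) = - (\<integral>x. pull G x $ i * \<phi> x \<partial>lebesgue)" .
qed

text \<open>The factor \<open>c\<close> of the chain rule contributes \<open>c powr p\<close> to the
  integral and the change of variables \<open>c powr (- n)\<close>; taking the \<open>p\<close>-th
  root gives the exponent \<open>1 - n / p\<close>.\<close>

lemma pull_Lp:
  assumes p: "0 < p" and G: "G \<in> Lp_fun p" and m: "pull G \<in> borel_measurable lebesgue"
  shows "pull G \<in> Lp_fun p"
    and "Lp_norm p (pull G) = c powr (1 - real CARD('n) / p) * Lp_norm p G"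
proof -
  have Gm: "(\<lambda>x. norm (G x) powr p) \<in> borel_measurable lebesgue"
    and Gi: "integrable lebesgue (\<lambda>x. norm (G x) powr p)" using G by (auto simp: Lp_fun_def)
  have eq: "(\<lambda>x. norm (pull G x) powr p) = (\<lambda>x. c powr p * norm (G (S x)) powr p)"
    using c by (simp add: norm_pull powr_mult)
  have "integrable lebesgue (\<lambda>x. norm (pull G x) powr p)"
    unfolding eq using Gi integrable_S[OF Gm] by simp
  then show "pull G \<in> Lp_fun p" using m by (simp add: Lp_fun_def)
  have "(\<integral>x. norm (G (S x)) powr p \<partial>lebesgue) = c powr (- real CARD('n)) * (\<integral>x. norm (G x) powr p \<partial>lebesgue)"
    using integral_S[OF Gm] c by (simp add: powr_minus powr_realpow field_simps)
  then have "(\<integral>x. norm (pull G x) powr p \<partial>lebesgue) = c powr (p - real CARD('n)) * (\<integral>x. norm (G x) powr p \<partial>lebesgue)"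
    unfolding eq by (simp add: powr_diff powr_minus divide_inverse)
  then show "Lp_norm p (pull G) = c powr (1 - real CARD('n) / p) * Lp_norm p G"
    unfolding Lp_norm_def using p by (simp add: powr_mult powr_powr diff_divide_distrib)
qed

lemma D1p_S:
  assumes p: "0 < p" and u: "u \<in> D1p p"
  shows "(\<lambda>x. u (S x)) \<in> D1p p"
    and "Lp_norm p (weak_grad (\<lambda>x. u (S x))) = c powr (1 - real CARD('n) / p) * Lp_norm p (weak_grad u)"
proof -
  define G where "G = weak_grad u"
  have G: "\<And>j. has_weak_partial u j (\<lambda>x. G x $ j)" "G \<in> Lp_fun p"
    using D1p_weak_grad[OF u p] by (auto simp: G_def)
  have uL: "u \<in> L1_loc" using u by (simp add: D1p_def)
  note w = has_weak_partial_S[OF uL G(1)]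
  have m: "pull G \<in> borel_measurable lebesgue"
    using w by (intro L1_loc_vec_borel_measurable) (simp add: has_weak_partial_def)
  have pullp: "(\<lambda>x. pull G x $ i) \<in> Lp_fun p" for i
  proof -
    have mi: "(\<lambda>x. pull G x $ i) \<in> borel_measurable lebesgue"
      using w[of i] by (intro L1_loc_borel_measurable) (simp add: has_weak_partial_def)
    have "integrable lebesgue (\<lambda>x. norm (pull G x $ i) powr p)"
    proof (rule Bochner_Integration.integrable_bound)
      show "integrable lebesgue (\<lambda>x. norm (pull G x) powr p)" using pull_Lp(1)[OF p G(2) m] by (simp add: Lp_fun_def)
      show "AE x in lebesgue. norm (norm (pull G x $ i) powr p) \<le> norm (norm (pull G x) powr p)"
        using p component_le_norm_cart[of "pull G _" i] by (auto intro!: AE_I2 powr_mono2)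
    qed (use mi in measurable)
    then show ?thesis using mi by (simp add: Lp_fun_def)
  qed
  have hol: "holder_continuous (1 - real CARD('n) / p) (\<lambda>x. u (S x))"
  proof -
    obtain K where K: "\<And>x y. dist (u x) (u y) \<le> K * dist x y powr (1 - real CARD('n) / p)"
      using u unfolding D1p_def holder_continuous_def by blast
    have "dist (u (S x)) (u (S y)) \<le> (K * c powr (1 - real CARD('n) / p)) * dist x y powr (1 - real CARD('n) / p)" for x y
      using K[of "S x" "S y"] c by (simp add: dist_S powr_mult mult.assoc)
    then show ?thesis unfolding holder_continuous_def by blast
  qed
  show "(\<lambda>x. u (S x)) \<in> D1p p"
    unfolding D1p_def using L1_loc_S[OF uL] hol w pullp by blast
  from weak_grad_eqI(2)[OF w] have AE: "AE x in lebesgue. pull G x = weak_grad (\<lambda>x. u (S x)) x"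
    by eventually_elim simp
  have "weak_grad (\<lambda>x. u (S x)) \<in> borel_measurable lebesgue"
    using weak_grad_eqI(1)[OF w] by (intro L1_loc_vec_borel_measurable) (simp add: has_weak_partial_def)
  from Lp_fun_AE(2)[OF pull_Lp(1)[OF p G(2) m] this AE] pull_Lp(2)[OF p G(2) m]
  show "Lp_norm p (weak_grad (\<lambda>x. u (S x))) = c powr (1 - real CARD('n) / p) * Lp_norm p (weak_grad u)"
    by (simp add: G_def)
qed

text \<open>Total mass 0 removes the translation \<open>z\<close>, the linear part commutes with the
  integral, and its orthogonal factor preserves the norm of the moment.\<close>

lemma signed_integral_S:
  assumes \<rho>: "signed_borel_measure \<rho>" "compact (signed_support \<rho>)" "\<rho> UNIV = 0"
  shows "norm (signed_integral \<rho> S) = c * norm (signed_integral \<rho> (\<lambda>y. y))"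
proof -
  have bl: "bounded_linear (\<lambda>v. c *\<^sub>R R v)"
    using linear_compose_scale_right[OF R_linear] by (simp add: linear_conv_bounded_linear)
  have "signed_integral \<rho> S = signed_integral \<rho> (\<lambda>y. c *\<^sub>R R y + z)" by (simp add: S_def[abs_def])
  also have "\<dots> = signed_integral \<rho> (\<lambda>y. c *\<^sub>R R y) + signed_integral \<rho> (\<lambda>y. z)"
    using bl by (intro signed_integral_add \<rho>) (auto intro!: linear_continuous_on)
  also have "\<dots> = c *\<^sub>R R (signed_integral \<rho> (\<lambda>y. y))"
    using signed_integral_bounded_linear[OF \<rho>(1,2) continuous_on_id bl] signed_integral_const[OF \<rho>(1,3)] by simp
  finally show ?thesis using c by (simp add: orthogonal_transformation_norm[OF R])
qed

end

section \<open>The minimisation problem\<close>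

definition duality_map :: "real \<Rightarrow> 'a::real_normed_vector \<Rightarrow> 'a" where
  "duality_map p b = norm b powr (p - 2) *\<^sub>R b"

lemma norm_duality_map:
  fixes b :: "'a::real_normed_vector"
  shows "norm (duality_map p b) = norm b powr (p - 1)"
proof (cases "b = 0")
  case False
  have "norm b powr (p - 2) * norm b powr 1 = norm b powr (p - 1)"
    unfolding powr_add[symmetric] by simp
  then show ?thesis using False by (simp add: duality_map_def)
qed (simp add: duality_map_def)

text \<open>At 0 the exponent \<open>p - 2\<close> may be negative; there continuity is read off
  from the norm of the map, \<open>norm b powr (p - 1)\<close>, whose exponent is positive.\<close>

lemma isCont_duality_map:
  fixes b :: "'a::real_normed_vector"
  assumes "1 < p"
  shows "isCont (duality_map p) b"
proof (cases "b = 0")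
  case True
  have "((\<lambda>x :: 'a. norm x powr (p - 1)) \<longlongrightarrow> norm (0 :: 'a) powr (p - 1)) (at 0)"
    using assms by (intro tendsto_powr' tendsto_intros) auto
  then have "((\<lambda>x :: 'a. norm (duality_map p x)) \<longlongrightarrow> 0) (at 0)" by (simp add: norm_duality_map)
  then have "((\<lambda>x :: 'a. duality_map p x) \<longlongrightarrow> 0) (at 0)" by (rule tendsto_norm_zero_cancel)
  moreover have "duality_map p (0 :: 'a) = 0" by (simp add: duality_map_def)
  ultimately show ?thesis using True by (simp add: isCont_def)
next
  case False
  then show ?thesis unfolding isCont_def duality_map_def[abs_def] by (intro tendsto_intros) auto
qed

lemma duality_map_measurable:
  fixes f :: "'a::euclidean_space \<Rightarrow> 'b::euclidean_space"
  assumes "1 < p" "f \<in> borel_measurable lebesgue"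
  shows "(\<lambda>x. duality_map p (f x)) \<in> borel_measurable lebesgue"
proof -
  have "continuous_on UNIV (duality_map p :: 'b \<Rightarrow> 'b)"
    by (intro continuous_at_imp_continuous_on ballI isCont_duality_map assms)
  then show ?thesis by (intro measurable_compose[OF assms(2)] borel_measurable_continuous_onI)
qed

text \<open>By convexity the integrand \<open>norm (G + t V) powr p - norm G powr p\<close> is at most
  \<open>t p (duality_map p (G + t V) \<bullet> V)\<close>, and by Bernoulli's inequality
  \<open>\<bar>1 + t l\<bar> powr p \<ge> 1 + p t l\<close>; now divide by \<open>t\<close> and let \<open>t\<close> tend to 0.\<close>

lemma first_variation:
  fixes G V :: "'a::euclidean_space \<Rightarrow> 'b::euclidean_space"
  assumes p: "1 < p" and G: "G \<in> Lp_fun p" and V: "V \<in> Lp_fun p"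
    and j: "0 \<le> j" "(\<integral>x. norm (G x) powr p \<partial>lebesgue) = j"
    and min: "\<And>t. j * \<bar>1 + t * l\<bar> powr p \<le> (\<integral>x. norm (G x + t *\<^sub>R V x) powr p \<partial>lebesgue)"
  shows "j * l \<le> (\<integral>x. duality_map p (G x) \<bullet> V x \<partial>lebesgue)"
proof -
  have Gm: "G \<in> borel_measurable lebesgue" and Vm: "V \<in> borel_measurable lebesgue"
    using G V by (auto simp: Lp_fun_def)
  define q where "q = p / (p - 1)"
  have q: "1 < q" "1 / p + 1 / q = 1" using p by (auto simp: q_def field_simps)
  define J where "J t x = duality_map p (G x + t *\<^sub>R V x) \<bullet> V x" for t x
  have GV: "(\<lambda>x. G x + t *\<^sub>R V x) \<in> Lp_fun p" for t
    using p by (intro Lp_fun_add G Lp_fun_scaleR V) auto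
  have Jm: "J t \<in> borel_measurable lebesgue" for t
    unfolding J_def using GV[of t] Vm p
    by (intro borel_measurable_inner duality_map_measurable) (auto simp: Lp_fun_def)
  \<comment> \<open>One integrable majorant for all \<open>t\<close> between 0 and 1, coming from
    Young's inequality and \<open>(p - 1) * q = p\<close>.\<close>
  define w where "w x = 2 powr p * (norm (G x) powr p + norm (V x) powr p) + norm (V x) powr p" for x
  have w: "integrable lebesgue w" unfolding w_def using G V by (auto simp: Lp_fun_def)
  have Jw: "norm (J t x) \<le> w x" if t: "0 \<le> t" "t \<le> 1" for t x
  proof -
    have "norm (J t x) \<le> norm (duality_map p (G x + t *\<^sub>R V x)) * norm (V x)"
      unfolding J_def by (simp add: Cauchy_Schwarz_ineq2)
    also have "\<dots> = norm (V x) * norm (G x + t *\<^sub>R V x) powr (p - 1)" by (simp add: norm_duality_map)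
    also have "\<dots> \<le> norm (V x) powr p / p + (norm (G x + t *\<^sub>R V x) powr (p - 1)) powr q / q"
      using p q by (intro Youngs_inequality) auto
    also have "(norm (G x + t *\<^sub>R V x) powr (p - 1)) powr q = norm (G x + t *\<^sub>R V x) powr p"
      using p by (simp add: powr_powr q_def)
    also have "norm (V x) powr p / p + norm (G x + t *\<^sub>R V x) powr p / q \<le> norm (V x) powr p + norm (G x + t *\<^sub>R V x) powr p"
      using p q mult_left_mono[of 1 p "norm (V x) powr p"] mult_left_mono[of 1 q "norm (G x + t *\<^sub>R V x) powr p"]
      by (intro add_mono) (auto simp: divide_le_eq)
    also have "norm (G x + t *\<^sub>R V x) powr p \<le> 2 powr p * (norm (G x) powr p + norm (t *\<^sub>R V x) powr p)"
      using p by (intro norm_add_powr_le) auto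
    also have "\<dots> \<le> 2 powr p * (norm (G x) powr p + norm (V x) powr p)"
      using t p by (intro mult_left_mono add_left_mono powr_mono2) (auto intro: mult_left_le_one_le)
    finally show ?thesis by (simp add: w_def)
  qed
  have Ji: "integrable lebesgue (J t)" if "0 \<le> t" "t \<le> 1" for t
    by (rule Bochner_Integration.integrable_bound[OF w Jm])
      (use Jw[OF that] in \<open>auto intro!: AE_I2 order_trans[OF _ abs_ge_self]\<close>)
  have le: "j * l \<le> (\<integral>x. J t x \<partial>lebesgue)" if t: "0 < t" "t \<le> 1" for t
  proof -
    have pt: "norm (G x + t *\<^sub>R V x) powr p \<le> norm (G x) powr p + t * p * J t x" for x
      using norm_powr_duality[OF p, of "G x + t *\<^sub>R V x" "G x"]
      by (simp add: J_def duality_map_def algebra_simps)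
    have "(\<integral>x. norm (G x + t *\<^sub>R V x) powr p \<partial>lebesgue) \<le> (\<integral>x. norm (G x) powr p + t * p * J t x \<partial>lebesgue)"
      using GV[of t] G Ji t by (intro integral_mono pt) (auto simp: Lp_fun_def)
    also have "\<dots> = j + t * p * (\<integral>x. J t x \<partial>lebesgue)"
      using G Ji t j by (subst Bochner_Integration.integral_add) (auto simp: Lp_fun_def)
    finally have 1: "j * \<bar>1 + t * l\<bar> powr p \<le> j + t * p * (\<integral>x. J t x \<partial>lebesgue)"
      using min[of t] by linarith
    have "1 + p * (t * l) \<le> \<bar>1 + t * l\<bar> powr p"
      using norm_powr_duality[OF p, of "1::real" "1 + t * l"] by simp
    then have "j * (1 + p * (t * l)) \<le> j * \<bar>1 + t * l\<bar> powr p" using j by (intro mult_left_mono) auto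
    with 1 have "(t * p) * (j * l) \<le> (t * p) * (\<integral>x. J t x \<partial>lebesgue)" by (simp add: algebra_simps)
    then show ?thesis using t p by (simp add: mult_le_cancel_left_pos)
  qed
  have "(\<lambda>m. \<integral>x. J (inverse (real (Suc m))) x \<partial>lebesgue) \<longlonglongrightarrow> (\<integral>x. J 0 x \<partial>lebesgue)"
  proof (rule integral_dominated_convergence[OF Jm Jm w])
    show "AE x in lebesgue. (\<lambda>m. J (inverse (real (Suc m))) x) \<longlonglongrightarrow> J 0 x"
    proof (rule AE_I2)
      fix x
      have "(\<lambda>m. G x + inverse (real (Suc m)) *\<^sub>R V x) \<longlonglongrightarrow> G x + 0 *\<^sub>R V x"
        by (intro tendsto_intros LIMSEQ_inverse_real_of_nat)
      from isCont_tendsto_compose[OF isCont_duality_map[OF p] this]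
      show "(\<lambda>m. J (inverse (real (Suc m))) x) \<longlonglongrightarrow> J 0 x" unfolding J_def by (intro tendsto_inner tendsto_const)
    qed
    show "AE x in lebesgue. norm (J (inverse (real (Suc m))) x) \<le> w x" for m
      by (rule AE_I2, rule Jw) (auto simp: field_simps)
  qed
  then have "j * l \<le> (\<integral>x. J 0 x \<partial>lebesgue)"
    by (rule LIMSEQ_le_const) (auto intro!: exI[of _ 0] le simp: field_simps)
  then show ?thesis by (simp add: J_def)
qed

lemma integral_norm_powr_cong_AE:
  fixes f g :: "'a \<Rightarrow> 'b::euclidean_space"
  assumes f: "f \<in> borel_measurable M" and g: "g \<in> borel_measurable M" and AE: "AE x in M. f x = g x"
  shows "(\<integral>x. norm (f x) powr p \<partial>M) = (\<integral>x. norm (g x) powr p \<partial>M)"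
proof (rule integral_cong_AE)
  show "(\<lambda>x. norm (f x) powr p) \<in> borel_measurable M" using f by measurable
  show "(\<lambda>x. norm (g x) powr p) \<in> borel_measurable M" using g by measurable
  show "AE x in M. norm (f x) powr p = norm (g x) powr p" using AE by eventually_elim simp
qed

lemma Lp_norm_powr:
  assumes "0 < p" shows "Lp_norm p f powr p = (\<integral>x. norm (f x) powr p \<partial>lebesgue)"
  using assms by (simp add: Lp_norm_def powr_powr)

section \<open>The functional L and the gradient norm\<close>

lemma signed_integral_le_Lp_norm_weak_grad:
  fixes \<rho> :: "(real ^ 'n) set \<Rightarrow> real"
  assumes p: "real CARD('n) < p" and pq: "1 < p" "1 / p + 1 / q = 1" and \<rho>: "admissible_measure \<rho>"
  shows "\<exists>A\<ge>0. \<forall>u\<in>D1p p. \<bar>signed_integral \<rho> u\<bar> \<le> A * Lp_norm p (weak_grad u)"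
proof -
  have sb: "signed_borel_measure \<rho>" "compact (signed_support \<rho>)" "\<rho> UNIV = 0"
    using \<rho> by (auto simp: admissible_measure_def)
  obtain R where R: "\<And>x. x \<in> signed_support \<rho> \<Longrightarrow> norm x \<le> R"
    using compact_imp_bounded[OF sb(2)] by (auto simp: bounded_iff)
  obtain A where A: "0 \<le> A" "\<And>(f :: real ^ 'n \<Rightarrow> real) b. continuous_on UNIV f \<Longrightarrow>
      (\<forall>x\<in>signed_support \<rho>. \<bar>f x\<bar> \<le> b) \<Longrightarrow> \<bar>signed_integral \<rho> f\<bar> \<le> A * b"
    using signed_integral_abs_le[OF sb(1,2)] by blast
  obtain C where C: "0 \<le> C" "\<And>u :: real ^ 'n \<Rightarrow> real. u \<in> D1p p \<Longrightarrow>
      \<exists>c. \<forall>x. norm x \<le> R \<longrightarrow> \<bar>u x - c\<bar> \<le> C * Lp_norm p (weak_grad u)"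
    using morrey_local_estimate[OF p pq, of R] by blast
  have "\<bar>signed_integral \<rho> u\<bar> \<le> (A * C) * Lp_norm p (weak_grad u)" if u: "u \<in> D1p p" for u
  proof -
    obtain c where c: "\<And>x. norm x \<le> R \<Longrightarrow> \<bar>u x - c\<bar> \<le> C * Lp_norm p (weak_grad u)" using C(2)[OF u] by blast
    have cont: "continuous_on UNIV u" by (rule D1p_continuous[OF u p])
    have "signed_integral \<rho> (\<lambda>x. u x + (- c)) = signed_integral \<rho> u + signed_integral \<rho> (\<lambda>x. - c)"
      by (intro signed_integral_add sb cont continuous_on_const)
    then have "signed_integral \<rho> u = signed_integral \<rho> (\<lambda>x. u x + (- c))"
      using signed_integral_const[OF sb(1,3), of "- c"] by simp
    moreover have "\<bar>signed_integral \<rho> (\<lambda>x. u x + (- c))\<bar> \<le> A * (C * Lp_norm p (weak_grad u))"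
      using R c by (intro A(2) continuous_intros cont) auto
    ultimately show ?thesis by (simp add: mult.assoc)
  qed
  then show ?thesis using A(1) C(1) by (intro exI[of _ "A * C"]) auto
qed

text \<open>Were the gradient of \<open>\<eta>\<close> zero, the local estimate would make
  \<open>\<eta>\<close> constant on a ball larger than its support, hence 0, against its integral 1.
  Such a function forces admissible constants to be nonnegative when the functional vanishes
  identically.\<close>

lemma D1p_nonconstant:
  assumes p: "real CARD('n) < p" and pq: "1 < p" "1 / p + 1 / q = 1"
  shows "\<exists>u :: real ^ 'n \<Rightarrow> real. u \<in> D1p p \<and> 0 < Lp_norm p (weak_grad u)"
proof -
  obtain \<eta> :: "real ^ 'n \<Rightarrow> real" and r B where "averaging_kernel \<eta> r B"
    using averaging_kernel_exists by blast
  then interpret averaging_kernel \<eta> r B .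
  have \<eta>: "\<eta> \<in> D1p p" by (rule test_functions_subset_D1p[OF p test])
  have "Lp_norm p (weak_grad \<eta>) \<noteq> 0"
  proof
    assume 0: "Lp_norm p (weak_grad \<eta>) = 0"
    \<comment> \<open>Radius \<open>r + 1\<close>, so that the ball contains a point outside the
      support of \<open>\<eta>\<close>.\<close>
    obtain C c where c: "\<And>x. norm x \<le> r + 1 \<Longrightarrow> \<bar>\<eta> x - c\<bar> \<le> C * Lp_norm p (weak_grad \<eta>)"
      using morrey_local_estimate[OF p pq, of "r + 1"] \<eta> by blast
    have eq: "\<eta> x = c" if "norm x \<le> r + 1" for x using c[OF that] 0 by simp
    have "axis undefined (r + 1) = (r + 1) *\<^sub>R (axis undefined 1 :: real ^ 'n)" by (simp add: axis_def vec_eq_iff)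
    then have n: "norm (axis undefined (r + 1) :: real ^ 'n) = r + 1" using r_nonneg by simp
    have "\<eta> (axis undefined (r + 1)) = 0" using support[of "axis undefined (r + 1)"] n by fastforce
    then have "c = 0" using eq[of "axis undefined (r + 1)"] n by simp
    have "\<eta> x = 0" for x
    proof (rule ccontr)
      assume "\<eta> x \<noteq> 0" with support[of x] eq[of x] \<open>c = 0\<close> show False by simp
    qed
    then show False using integral_1 by simp
  qed
  moreover have "0 \<le> Lp_norm p (weak_grad \<eta>)" by (simp add: Lp_norm_def)
  ultimately show ?thesis using \<eta> by (intro exI[of _ \<eta>]) simp
qed

lemma has_divergence_bound:
  fixes F :: "real ^ 'n \<Rightarrow> real ^ 'n"
  assumes pq: "1 < p" "1 / p + 1 / q = 1" and F: "F \<in> Lp_fun q" "has_divergence p F \<rho>" and u: "u \<in> D1p p"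
  shows "\<bar>signed_integral \<rho> u\<bar> \<le> Lp_norm q F * Lp_norm p (weak_grad u)"
proof -
  have "weak_grad u \<in> Lp_fun p" using D1p_weak_grad(2)[OF u] pq by simp
  from Lp_inner(2)[OF pq this F(1)] show ?thesis
    using bspec[OF F(2)[unfolded has_divergence_def] u] by (simp add: mult.commute)
qed

section \<open>Minimising the energy under the constraint L u = 1\<close>

locale gradient_minimisation =
  fixes \<rho> :: "(real ^ 'n) set \<Rightarrow> real" and p q :: real
  assumes p: "real CARD('n) < p" and q: "1 / p + 1 / q = 1" and \<rho>: "admissible_measure \<rho>"
    and nontrivial: "\<exists>u\<in>D1p p. signed_integral \<rho> u \<noteq> 0"
begin

abbreviation L :: "(real ^ 'n \<Rightarrow> real) \<Rightarrow> real" where "L u \<equiv> signed_integral \<rho> u"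

definition E :: "(real ^ 'n \<Rightarrow> real) \<Rightarrow> real" where
  "E u = (\<integral>x. norm (weak_grad u x) powr p \<partial>lebesgue)"

text \<open>The assumption \<open>nontrivial\<close> keeps the constraint set nonempty; otherwise
  this infimum would be an unspecified real number.\<close>

definition m :: real where "m = Inf (E ` {u \<in> D1p p. L u = 1})"

lemma p1: "1 < p"
proof -
  have "1 \<le> real CARD('n)" by (simp add: Suc_leI)
  then show ?thesis using p by linarith
qed

lemma p0: "0 < p" using p1 by simp

lemma E_nonneg: "0 \<le> E u" by (simp add: E_def)

lemma Lp_norm_E: "Lp_norm p (weak_grad u) = E u powr (1 / p)" by (simp add: Lp_norm_def E_def)

lemma \<rho>_props: "signed_borel_measure \<rho>" "compact (signed_support \<rho>)" "\<rho> UNIV = 0"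
  using \<rho> by (auto simp: admissible_measure_def)

lemma L_add: "u \<in> D1p p \<Longrightarrow> v \<in> D1p p \<Longrightarrow> L (\<lambda>x. u x + v x) = L u + L v"
  by (intro signed_integral_add \<rho>_props D1p_continuous[OF _ p])

lemma L_scale: "u \<in> D1p p \<Longrightarrow> L (\<lambda>x. c * u x) = c * L u"
  using signed_integral_bounded_linear[OF \<rho>_props(1,2) D1p_continuous[OF _ p], of u "(*) c"]
  by (simp add: bounded_linear_mult_right)

lemma L_normalise:
  assumes "u \<in> D1p p" "L u \<noteq> 0" shows "L (\<lambda>x. (1 / L u) * u x) = 1"
proof -
  have "L (\<lambda>x. (1 / L u) * u x) = (1 / L u) * L u" by (rule L_scale[OF assms(1)])
  also have "\<dots> = 1" using assms(2) by simp
  finally show ?thesis .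
qed

lemma weak_grad_measurable: "u \<in> D1p p \<Longrightarrow> weak_grad u \<in> borel_measurable lebesgue"
  using D1p_weak_grad(2)[of u p] p0 by (simp add: Lp_fun_def)

lemma E_scale:
  assumes "u \<in> D1p p" shows "E (\<lambda>x. c * u x) = \<bar>c\<bar> powr p * E u"
proof -
  have "E (\<lambda>x. c * u x) = (\<integral>x. norm (c *\<^sub>R weak_grad u x) powr p \<partial>lebesgue)"
    unfolding E_def
    using D1p_scale[OF p0 assms, of c] weak_grad_measurable[OF assms] weak_grad_measurable[OF D1p_scale(1)[OF p0 assms, of c]]
    by (intro integral_norm_powr_cong_AE) auto
  then show ?thesis by (simp add: E_def powr_mult)
qed

lemma E_lower: "\<exists>a>0. \<forall>u\<in>D1p p. L u = 1 \<longrightarrow> a \<le> E u"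
proof -
  obtain A where A: "0 \<le> A" "\<And>u. u \<in> D1p p \<Longrightarrow> \<bar>L u\<bar> \<le> A * Lp_norm p (weak_grad u)"
    using signed_integral_le_Lp_norm_weak_grad[OF p p1 q \<rho>] by blast
  \<comment> \<open>\<open>A + 1\<close> in place of \<open>A\<close>, because only
    \<open>0 \<le> A\<close> is known and a reciprocal is wanted.\<close>
  have "(1 / (A + 1)) powr p \<le> E u" if u: "u \<in> D1p p" "L u = 1" for u
  proof -
    have N: "0 \<le> Lp_norm p (weak_grad u)" by (simp add: Lp_norm_def)
    have "1 \<le> A * Lp_norm p (weak_grad u)" using A(2)[OF u(1)] u(2) by simp
    also have "\<dots> \<le> (A + 1) * Lp_norm p (weak_grad u)" using N by (intro mult_right_mono) auto
    finally have "1 / (A + 1) \<le> Lp_norm p (weak_grad u)" using A(1) by (simp add: divide_le_eq mult.commute)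
    then have "(1 / (A + 1)) powr p \<le> Lp_norm p (weak_grad u) powr p"
      using p0 A(1) by (intro powr_mono2) auto
    then show ?thesis using Lp_norm_powr[OF p0, of "weak_grad u"] by (simp add: E_def)
  qed
  moreover have "0 < (1 / (A + 1)) powr p" using A(1) by simp
  ultimately show ?thesis by blast
qed

lemma normalised_nonempty: "{u \<in> D1p p. L u = 1} \<noteq> {}"
proof -
  obtain u where u: "u \<in> D1p p" "L u \<noteq> 0" using nontrivial by blast
  from L_normalise[OF this] show ?thesis using D1p_scale(1)[OF p0 u(1), of "1 / L u"] by blast
qed

lemma E_bdd_below: "bdd_below (E ` X)"
  by (rule bdd_belowI2[of _ 0]) (rule E_nonneg)

lemma m_pos: "0 < m"
proof -
  obtain a where a: "0 < a" "\<And>u. u \<in> D1p p \<Longrightarrow> L u = 1 \<Longrightarrow> a \<le> E u" using E_lower by blast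
  have "a \<le> m" unfolding m_def using normalised_nonempty a(2) by (intro cINF_greatest) auto
  with a(1) show ?thesis by simp
qed

lemma m_le: "u \<in> D1p p \<Longrightarrow> L u = 1 \<Longrightarrow> m \<le> E u"
  unfolding m_def by (intro cINF_lower E_bdd_below) auto

text \<open>Homogeneity frees the bound from the constraint, so that perturbations of a function
  with \<open>L u = 1\<close> can be compared with \<open>m\<close> without renormalising
  them.\<close>

lemma m_le_E:
  assumes u: "u \<in> D1p p" shows "m * \<bar>L u\<bar> powr p \<le> E u"
proof (cases "L u = 0")
  case False
  have "m \<le> E (\<lambda>x. (1 / L u) * u x)"
    by (intro m_le D1p_scale(1)[OF p0] L_normalise u False)
  also have "\<dots> = \<bar>1 / L u\<bar> powr p * E u" by (rule E_scale[OF u])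
  also have "\<dots> = E u / \<bar>L u\<bar> powr p" by (simp add: powr_divide)
  finally show ?thesis using False by (simp add: field_simps)
qed (use E_nonneg p0 in simp)

lemma minimising_sequence: "\<exists>u. u \<in> D1p p \<and> L u = 1 \<and> E u < m + 1 / real (Suc k)"
proof -
  have "Inf (E ` {u \<in> D1p p. L u = 1}) < m + 1 / real (Suc k)" by (simp add: m_def)
  then obtain y where "y \<in> E ` {u \<in> D1p p. L u = 1}" "y < m + 1 / real (Suc k)"
    using cInf_lessD normalised_nonempty by (metis (no_types, lifting) image_is_empty)
  then show ?thesis by blast
qed

text \<open>The midpoint of two nearly minimal functions again satisfies the constraint, so its
  energy is at least \<open>m\<close> and the integrated convexity defect of the two gradients is
  small. Uniform convexity turns this into closeness in \<open>L^p\<close>.\<close>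

lemma minimising_Cauchy:
  assumes u: "\<And>k. u k \<in> D1p p" "\<And>k. L (u k) = 1" "\<And>k. E (u k) < m + 1 / real (Suc k)" and \<epsilon>: "0 < \<epsilon>"
  shows "\<exists>N. \<forall>k\<ge>N. \<forall>l\<ge>N. (\<integral>x. norm (weak_grad (u k) x - weak_grad (u l) x) powr p \<partial>lebesgue) < \<epsilon>"
proof -
  \<comment> \<open>Both energies are at most \<open>m + 1\<close>, so the first term of the
    convexity bound is at most \<open>\<epsilon> / 2\<close>.\<close>
  define \<delta> where "\<delta> = \<epsilon> / (4 * (m + 1))"
  have \<delta>: "0 < \<delta>" using m_pos \<epsilon> by (simp add: \<delta>_def)
  obtain C where C: "0 \<le> C" "\<And>a b :: real ^ 'n. norm (a - b) powr p \<le> \<delta> * (norm a powr p + norm b powr p) +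
    C * ((norm a powr p + norm b powr p) / 2 - norm ((1/2) *\<^sub>R (a + b)) powr p)"
    using norm_powr_uniformly_convex[OF p1 \<delta>] by blast
  \<comment> \<open>From index \<open>N\<close> on the defect is at most
    \<open>1 / real (Suc N)\<close>, and \<open>C\<close> times this number is below
    \<open>\<epsilon> / 2\<close>.\<close>
  obtain N where N: "C / (\<epsilon> / 2) < real N" using reals_Archimedean2 by blast
  have "(\<integral>x. norm (weak_grad (u k) x - weak_grad (u l) x) powr p \<partial>lebesgue) < \<epsilon>" if kl: "N \<le> k" "N \<le> l" for k l
  proof -
    define f where "f = weak_grad (u k)"
    define g where "g = weak_grad (u l)"
    have f: "f \<in> Lp_fun p" and g: "g \<in> Lp_fun p" using D1p_weak_grad(2)[OF u(1) p0] by (auto simp: f_def g_def)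
    define v where "v x = (1/2) * (u k x + u l x)" for x
    have uv: "(\<lambda>x. u k x + u l x) \<in> D1p p" by (rule D1p_add(1)[OF p0 u(1) u(1)])
    have v: "v \<in> D1p p" "L v = 1"
      unfolding v_def using D1p_scale(1)[OF p0 uv, of "1/2"] L_scale[OF uv, of "1/2"] L_add[OF u(1)[of k] u(1)[of l]] u(2)
      by auto
    have "AE x in lebesgue. weak_grad v x = (1/2) *\<^sub>R (f x + g x)"
      using D1p_scale(2)[OF p0 D1p_add(1)[OF p0 u(1)[of k] u(1)[of l]], of "1/2"] D1p_add(2)[OF p0 u(1)[of k] u(1)[of l]]
      unfolding v_def f_def g_def by eventually_elim simp
    moreover have fg: "(\<lambda>x. (1/2) *\<^sub>R (f x + g x)) \<in> Lp_fun p"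
      using p0 by (intro Lp_fun_scaleR Lp_fun_add f g) auto
    moreover have "weak_grad v \<in> Lp_fun p" by (rule D1p_weak_grad(2)[OF v(1) p0])
    ultimately have "E v = (\<integral>x. norm ((1/2) *\<^sub>R (f x + g x)) powr p \<partial>lebesgue)"
      unfolding E_def Lp_fun_def by (intro integral_norm_powr_cong_AE) auto
    then have mid: "m \<le> (\<integral>x. norm ((1/2) *\<^sub>R (f x + g x)) powr p \<partial>lebesgue)" using m_le[OF v] by simp
    have fi: "integrable lebesgue (\<lambda>x. norm (f x) powr p)" and gi: "integrable lebesgue (\<lambda>x. norm (g x) powr p)"
      and mi: "integrable lebesgue (\<lambda>x. norm ((1/2) *\<^sub>R (f x + g x)) powr p)"
      using f g fg by (auto simp: Lp_fun_def)
    have di: "integrable lebesgue (\<lambda>x. norm (f x - g x) powr p)"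
      using Lp_fun_add[OF _ f Lp_fun_scaleR[OF g, of "-1"]] p0 by (simp add: Lp_fun_def)
    have "(\<integral>x. norm (f x - g x) powr p \<partial>lebesgue) \<le> (\<integral>x. \<delta> * (norm (f x) powr p + norm (g x) powr p) +
        C * ((norm (f x) powr p + norm (g x) powr p) / 2 - norm ((1/2) *\<^sub>R (f x + g x)) powr p) \<partial>lebesgue)"
      by (intro integral_mono di C(2) Bochner_Integration.integrable_add Bochner_Integration.integrable_diff
          integrable_mult_right integrable_divide fi gi mi)
    also have "\<dots> = \<delta> * (E (u k) + E (u l)) + C * ((E (u k) + E (u l)) / 2 - (\<integral>x. norm ((1/2) *\<^sub>R (f x + g x)) powr p \<partial>lebesgue))"
      using fi gi mi by (simp add: E_def f_def g_def del: norm_scaleR)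
    also have "\<dots> \<le> \<delta> * (2 * (m + 1)) + C * (1 / real (Suc N))"
    proof (intro add_mono mult_left_mono C(1))
      have Ele: "E (u i) \<le> m + 1 / real (Suc N)" if "N \<le> i" for i
      proof -
        have "1 / real (Suc i) \<le> 1 / real (Suc N)" using that by (intro divide_left_mono) auto
        then show ?thesis using u(3)[of i] by linarith
      qed
      have "m + 1 / real (Suc N) \<le> m + 1" by simp
      then have "E (u k) \<le> m + 1" "E (u l) \<le> m + 1"
        using Ele[OF kl(1)] Ele[OF kl(2)] order_trans by blast+
      then show "E (u k) + E (u l) \<le> 2 * (m + 1)" by simp
      show "(E (u k) + E (u l)) / 2 - (\<integral>x. norm ((1/2) *\<^sub>R (f x + g x)) powr p \<partial>lebesgue) \<le> 1 / real (Suc N)"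
        using Ele[OF kl(1)] Ele[OF kl(2)] mid by argo
    qed (use \<delta> in simp)
    also have "\<delta> * (2 * (m + 1)) = \<epsilon> / 2" using m_pos by (simp add: \<delta>_def field_simps)
    also have "C * (1 / real (Suc N)) < \<epsilon> / 2"
    proof -
      have "C / (\<epsilon> / 2) < real (Suc N)" using N by simp
      then show ?thesis using \<epsilon> by (simp add: field_simps)
    qed
    finally show ?thesis by (simp add: f_def g_def)
  qed
  then show ?thesis by blast
qed

text \<open>The limit \<open>G\<close> of the gradients of a minimising sequence need not be recognised as a gradient:
  the inequality satisfied by its perturbations suffices for the first variation.\<close>

lemma minimiser:
  "\<exists>G\<in>Lp_fun p. (\<integral>x. norm (G x) powr p \<partial>lebesgue) = m \<and>
    (\<forall>v\<in>D1p p. m * \<bar>1 + L v\<bar> powr p \<le> (\<integral>x. norm (G x + weak_grad v x) powr p \<partial>lebesgue))"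
proof -
  obtain u where u: "\<And>k. u k \<in> D1p p" "\<And>k. L (u k) = 1" "\<And>k. E (u k) < m + 1 / real (Suc k)"
    using minimising_sequence by metis
  define f where "f k = weak_grad (u k)" for k
  have f: "f k \<in> Lp_fun p" for k unfolding f_def by (rule D1p_weak_grad(2)[OF u(1) p0])
  then have fm: "f k \<in> borel_measurable lebesgue" for k by (simp add: Lp_fun_def)
  obtain r G S where r: "strict_mono r" and G: "G \<in> borel_measurable lebesgue" and S: "integrable lebesgue S"
    and lim: "AE x in lebesgue. (\<lambda>k. f (r k) x) \<longlonglongrightarrow> G x"
    and dom: "AE x in lebesgue. \<forall>k. norm (f (r k) x) powr p \<le> S x"
    using Lp_Cauchy_subseq[OF p0 f minimising_Cauchy[OF u, folded f_def]] by blast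
  note D = Lp_dominated_limit[OF p0 fm _ G S lim dom]
  have zero: "(\<lambda>x :: real ^ 'n. 0 :: real ^ 'n) \<in> Lp_fun p" using p0 by (simp add: Lp_fun_def)
  have GL: "G \<in> Lp_fun p" using D(1)[OF zero] by simp
  have "(\<lambda>k. E (u (r k))) \<longlonglongrightarrow> (\<integral>x. norm (G x) powr p \<partial>lebesgue)"
    using D(2)[OF zero] by (simp add: E_def f_def)
  moreover have "(\<lambda>k. E (u (r k))) \<longlonglongrightarrow> m"
  proof (rule tendsto_sandwich[OF _ _ tendsto_const])
    show "\<forall>\<^sub>F k in sequentially. m \<le> E (u (r k))" using u by (intro always_eventually allI m_le)
    have "E (u (r k)) \<le> m + inverse (real (Suc k))" for k
    proof -
      have "k \<le> r k" by (rule strict_mono_imp_increasing[OF r])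
      then have "1 / real (Suc (r k)) \<le> 1 / real (Suc k)" by (intro divide_left_mono) auto
      then show ?thesis using u(3)[of "r k"] unfolding inverse_eq_divide by linarith
    qed
    then show "\<forall>\<^sub>F k in sequentially. E (u (r k)) \<le> m + inverse (real (Suc k))" by simp
    show "(\<lambda>k. m + inverse (real (Suc k))) \<longlonglongrightarrow> m"
      using tendsto_add[OF tendsto_const LIMSEQ_inverse_real_of_nat, of m] by simp
  qed
  ultimately have Gm: "(\<integral>x. norm (G x) powr p \<partial>lebesgue) = m" by (rule LIMSEQ_unique)
  have "m * \<bar>1 + L v\<bar> powr p \<le> (\<integral>x. norm (G x + weak_grad v x) powr p \<partial>lebesgue)" if v: "v \<in> D1p p" for v
  proof (rule LIMSEQ_le_const[OF D(2)[OF D1p_weak_grad(2)[OF v p0]]])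
    have "m * \<bar>1 + L v\<bar> powr p \<le> (\<integral>x. norm (f (r k) x + weak_grad v x) powr p \<partial>lebesgue)" for k
    proof -
      define w where "w x = u (r k) x + v x" for x
      have w: "w \<in> D1p p" unfolding w_def by (rule D1p_add(1)[OF p0 u(1) v])
      have "L w = 1 + L v" unfolding w_def using L_add[OF u(1) v] u(2) by simp
      then have "m * \<bar>1 + L v\<bar> powr p \<le> E w" using m_le_E[OF w] by simp
      also have "E w = (\<integral>x. norm (f (r k) x + weak_grad v x) powr p \<partial>lebesgue)"
      proof -
        have "AE x in lebesgue. weak_grad w x = f (r k) x + weak_grad v x"
          using D1p_add(2)[OF p0 u(1)[of "r k"] v] unfolding w_def f_def by eventually_elim simp
        then show ?thesis unfolding E_def using fm[of "r k"] weak_grad_measurable[OF w] weak_grad_measurable[OF v]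
          by (intro integral_norm_powr_cong_AE) auto
      qed
      finally show ?thesis .
    qed
    then show "\<exists>N. \<forall>k\<ge>N. m * \<bar>1 + L v\<bar> powr p \<le> (\<integral>x. norm (f (r k) x + weak_grad v x) powr p \<partial>lebesgue)" by blast
  qed
  then show ?thesis using GL Gm by blast
qed

text \<open>The first variation yields only an inequality; used for \<open>v\<close> and for its
  negative it becomes the Euler-Lagrange equation. The minus sign in \<open>F\<close> comes from the
  sign convention for the divergence. Since \<open>q * (p - 1) = p\<close>, the integral of
  \<open>norm (F x) powr q\<close> is \<open>m powr (1 - q)\<close>, and its \<open>q\<close>-th
  root is \<open>m powr (- 1 / p)\<close>.\<close>

lemma optimal_field:
  "\<exists>F\<in>Lp_fun q. has_divergence p F \<rho> \<and> Lp_norm q F = m powr (- 1 / p)"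
proof -
  obtain G where G: "G \<in> Lp_fun p" "(\<integral>x. norm (G x) powr p \<partial>lebesgue) = m"
    and min: "\<And>v. v \<in> D1p p \<Longrightarrow> m * \<bar>1 + L v\<bar> powr p \<le> (\<integral>x. norm (G x + weak_grad v x) powr p \<partial>lebesgue)"
    using minimiser by blast
  have Gm: "G \<in> borel_measurable lebesgue" using G by (simp add: Lp_fun_def)
  have m0: "0 \<le> m" using m_pos by simp
  have q1: "1 < q" "q * (p - 1) = p" using conjugate_exponents[OF p1 q] by auto
  have le: "m * L v \<le> (\<integral>x. duality_map p (G x) \<bullet> weak_grad v x \<partial>lebesgue)" if v: "v \<in> D1p p" for v
  proof (rule first_variation[OF p1 G(1) D1p_weak_grad(2)[OF v p0] m0 G(2)])
    fix t :: real
    have tv: "(\<lambda>x. t * v x) \<in> D1p p" by (rule D1p_scale(1)[OF p0 v])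
    have "AE x in lebesgue. G x + weak_grad (\<lambda>x. t * v x) x = G x + t *\<^sub>R weak_grad v x"
      using D1p_scale(2)[OF p0 v, of t] by eventually_elim simp
    then have "(\<integral>x. norm (G x + weak_grad (\<lambda>x. t * v x) x) powr p \<partial>lebesgue)
        = (\<integral>x. norm (G x + t *\<^sub>R weak_grad v x) powr p \<partial>lebesgue)"
      using Gm weak_grad_measurable[OF tv] weak_grad_measurable[OF v] by (intro integral_norm_powr_cong_AE) auto
    then show "m * \<bar>1 + t * L v\<bar> powr p \<le> (\<integral>x. norm (G x + t *\<^sub>R weak_grad v x) powr p \<partial>lebesgue)"
      using min[OF tv] by (simp add: L_scale[OF v])
  qed
  have JGm: "(\<lambda>x. duality_map p (G x)) \<in> borel_measurable lebesgue" by (rule duality_map_measurable[OF p1 Gm])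
  have eq: "m * L v = (\<integral>x. duality_map p (G x) \<bullet> weak_grad v x \<partial>lebesgue)" if v: "v \<in> D1p p" for v
  proof (rule antisym[OF le[OF v]])
    have v': "(\<lambda>x. (-1) * v x) \<in> D1p p" by (rule D1p_scale(1)[OF p0 v])
    have "AE x in lebesgue. duality_map p (G x) \<bullet> weak_grad (\<lambda>x. (-1) * v x) x = - (duality_map p (G x) \<bullet> weak_grad v x)"
      using D1p_scale(2)[OF p0 v, of "-1"] by eventually_elim simp
    then have "(\<integral>x. duality_map p (G x) \<bullet> weak_grad (\<lambda>x. (-1) * v x) x \<partial>lebesgue)
        = (\<integral>x. - (duality_map p (G x) \<bullet> weak_grad v x) \<partial>lebesgue)"
      using JGm weak_grad_measurable[OF v'] weak_grad_measurable[OF v] by (intro integral_cong_AE) auto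
    then show "(\<integral>x. duality_map p (G x) \<bullet> weak_grad v x \<partial>lebesgue) \<le> m * L v"
      using le[OF v'] L_scale[OF v, of "-1"] by simp
  qed
  define F where "F x = (- (1 / m)) *\<^sub>R duality_map p (G x)" for x
  have nF: "(\<lambda>x. norm (F x) powr q) = (\<lambda>x. (1 / m) powr q * norm (G x) powr p)"
    using m_pos q1 by (simp add: F_def norm_duality_map powr_mult powr_divide powr_powr mult.commute[of q])
  have "F \<in> borel_measurable lebesgue" unfolding F_def using JGm by measurable
  moreover have "integrable lebesgue (\<lambda>x. norm (F x) powr q)"
    unfolding nF using G(1) by (simp add: Lp_fun_def)
  ultimately have "F \<in> Lp_fun q" by (simp add: Lp_fun_def)
  moreover have "has_divergence p F \<rho>"
    unfolding has_divergence_def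
  proof
    fix v :: "real ^ 'n \<Rightarrow> real" assume v: "v \<in> D1p p"
    have "(\<integral>x. weak_grad v x \<bullet> F x \<partial>lebesgue) = - (1 / m) * (\<integral>x. duality_map p (G x) \<bullet> weak_grad v x \<partial>lebesgue)"
      by (simp add: F_def inner_commute)
    then show "- (\<integral>x. weak_grad v x \<bullet> F x \<partial>lebesgue) = L v" using eq[OF v, symmetric] m_pos by simp
  qed
  moreover have "Lp_norm q F = m powr (- 1 / p)"
  proof -
    have "(1 / m) powr q * m = m powr (1 - q)"
      using m_pos by (simp add: powr_diff powr_divide)
    then have "Lp_norm q F = (m powr (1 - q)) powr (1 / q)"
      unfolding Lp_norm_def nF using G(2) by simp
    also have "\<dots> = m powr (1 / q - 1)" using q1 by (simp add: powr_powr diff_divide_distrib)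
    also have "1 / q - 1 = - 1 / p" using q by simp
    finally show ?thesis .
  qed
  ultimately show ?thesis by blast
qed

text \<open>The constant is tested along a minimising sequence, where the hypothesis reads
  \<open>1 \<le> a * E (u k) powr (1 / p)\<close>; no function attaining the infimum is required.
  The same inequality shows that \<open>a\<close> is nonnegative, which allows
  \<open>E (u k)\<close> to be replaced by its upper bound.\<close>

lemma optimal_bound:
  assumes a: "\<And>u. u \<in> D1p p \<Longrightarrow> \<bar>L u\<bar> \<le> a * Lp_norm p (weak_grad u)"
  shows "m powr (- 1 / p) \<le> a"
proof -
  obtain u where u: "\<And>k. u k \<in> D1p p" "\<And>k. L (u k) = 1" "\<And>k. E (u k) < m + 1 / real (Suc k)"
    using minimising_sequence by metis
  have 1: "1 \<le> a * E (u k) powr (1 / p)" for k using a[OF u(1), of k] u(2)[of k] by (simp add: Lp_norm_E)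
  have a0: "0 \<le> a"
  proof (rule ccontr)
    assume "\<not> 0 \<le> a"
    then have "a * E (u 0) powr (1 / p) \<le> 0" by (intro mult_nonpos_nonneg) auto
    then show False using 1[of 0] by simp
  qed
  have "1 \<le> a * (m + inverse (real (Suc k))) powr (1 / p)" for k
  proof -
    have "E (u k) powr (1 / p) \<le> (m + inverse (real (Suc k))) powr (1 / p)"
      using u(3)[of k] p0 E_nonneg[of "u k"] by (intro powr_mono2) (auto simp: inverse_eq_divide)
    then have "a * E (u k) powr (1 / p) \<le> a * (m + inverse (real (Suc k))) powr (1 / p)"
      using a0 by (rule mult_left_mono)
    then show ?thesis using 1[of k] by linarith
  qed
  moreover have "(\<lambda>k. a * (m + inverse (real (Suc k))) powr (1 / p)) \<longlonglongrightarrow> a * (m + 0) powr (1 / p)"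
    using m_pos by (intro tendsto_intros LIMSEQ_inverse_real_of_nat) auto
  ultimately have "1 \<le> a * m powr (1 / p)" using LIMSEQ_le_const[of _ "a * (m + 0) powr (1 / p)" 1] by auto
  then show ?thesis using m_pos by (simp add: powr_minus field_simps)
qed

end

text \<open>If the functional vanishes on \<open>D1p\<close>, the zero field is a solution, and it
  is optimal because a function with nonzero gradient makes every admissible \<open>a\<close>
  nonnegative. Otherwise the minimisation applies.\<close>

lemma optimal_field_exists:
  fixes \<rho> :: "(real ^ 'n) set \<Rightarrow> real"
  assumes p: "real CARD('n) < p" and pq: "1 < p" "1 / p + 1 / q = 1" and \<rho>: "admissible_measure \<rho>"
  shows "\<exists>F\<in>Lp_fun q. has_divergence p F \<rho> \<and>
    (\<forall>a. (\<forall>u\<in>D1p p. \<bar>signed_integral \<rho> u\<bar> \<le> a * Lp_norm p (weak_grad u)) \<longrightarrow> Lp_norm q F \<le> a)"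
proof (cases "\<exists>u\<in>D1p p. signed_integral \<rho> u \<noteq> 0")
  case True
  interpret gradient_minimisation \<rho> p q by unfold_locales (use assms True in auto)
  show ?thesis using optimal_field optimal_bound by metis
next
  case False
  have q0: "0 < q" using conjugate_exponents[OF pq] by simp
  define F where "F = (\<lambda>x :: real ^ 'n. 0 :: real ^ 'n)"
  have F: "F \<in> Lp_fun q" "Lp_norm q F = 0" using q0 by (auto simp: F_def Lp_fun_def Lp_norm_def)
  have "has_divergence p F \<rho>" using False by (simp add: has_divergence_def F_def)
  moreover have "0 \<le> a" if a: "\<forall>u\<in>D1p p. \<bar>signed_integral \<rho> u\<bar> \<le> a * Lp_norm p (weak_grad u)" for a
  proof -
    obtain u :: "real ^ 'n \<Rightarrow> real" where u: "u \<in> D1p p" "0 < Lp_norm p (weak_grad u)"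
      using D1p_nonconstant[OF p pq] by blast
    have "0 \<le> a * Lp_norm p (weak_grad u)" using a u(1) abs_ge_zero order_trans by blast
    then show ?thesis using u(2) by (simp add: zero_le_mult_iff)
  qed
  ultimately show ?thesis using F by auto
qed

section \<open>The best constant\<close>

lemma id_similarity: "(\<lambda>y. y) \<in> similarities"
  unfolding similarities_def
  by (intro CollectI exI[of _ 1] exI[of _ "\<lambda>y. y"] exI[of _ 0]) auto

theorem corollary6p4:
  fixes \<rho> :: "(real ^ 'n) set \<Rightarrow> real" and p q :: real
  assumes "real CARD('n) < p"
    and "1 / p + 1 / q = 1"
    and "admissible_measure \<rho>"
  shows "\<exists>C. best_morrey_constant p \<rho> C \<and>
    ereal C =
      (INF F\<in>{F \<in> Lp_fun q. has_divergence p F \<rho>}. ereal (Lp_norm q F)) /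
      ereal (norm (signed_integral \<rho> (\<lambda>y. y)) powr (1 - real CARD('n) / p))"
proof -
  have "1 \<le> real CARD('n)" by (simp add: Suc_leI)
  then have p1: "1 < p" using assms(1) by linarith
  note pq = p1 assms(2)
  have \<rho>: "signed_borel_measure \<rho>" "compact (signed_support \<rho>)" "\<rho> UNIV = 0"
    "signed_integral \<rho> (\<lambda>y. y) \<noteq> 0" using assms(3) by (auto simp: admissible_measure_def)
  define \<alpha> where "\<alpha> = 1 - real CARD('n) / p"
  define M where "M = norm (signed_integral \<rho> (\<lambda>y. y)) powr \<alpha>"
  have M: "0 < M" using \<rho>(4) by (simp add: M_def)
  obtain F where F: "F \<in> Lp_fun q" "has_divergence p F \<rho>"
    and best: "\<And>a. (\<And>u. u \<in> D1p p \<Longrightarrow> \<bar>signed_integral \<rho> u\<bar> \<le> a * Lp_norm p (weak_grad u)) \<Longrightarrow> Lp_norm q F \<le> a"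
    using optimal_field_exists[OF assms(1) pq assms(3)] by blast
  define \<kappa> where "\<kappa> = Lp_norm q F"
  \<comment> \<open>The norm of any competing field is an admissible constant for the functional, by
    Hoelder's inequality, so \<open>best\<close> applies to it; the infimum is a real number,
    attained at \<open>F\<close>.\<close>
  have inf: "(INF F\<in>{F \<in> Lp_fun q. has_divergence p F \<rho>}. ereal (Lp_norm q F)) = ereal \<kappa>"
  proof (rule antisym)
    show "(INF F\<in>{F \<in> Lp_fun q. has_divergence p F \<rho>}. ereal (Lp_norm q F)) \<le> ereal \<kappa>"
      unfolding \<kappa>_def using F by (intro INF_lower) auto
    show "ereal \<kappa> \<le> (INF F\<in>{F \<in> Lp_fun q. has_divergence p F \<rho>}. ereal (Lp_norm q F))"
      unfolding \<kappa>_def using has_divergence_bound[OF pq] by (intro INF_greatest) (auto intro!: best)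
  qed
  have upper: "morrey_inequality p \<rho> (\<kappa> / M)"
    unfolding morrey_inequality_def morrey_seminorm_def
  proof (intro ballI SUP_least)
    fix u :: "real ^ 'n \<Rightarrow> real" and \<mu> assume u: "u \<in> D1p p" and "\<mu> \<in> {push_forward S \<rho> |S. S \<in> similarities}"
    then obtain c R z where c: "0 < c" "orthogonal_transformation R"
      and \<mu>: "\<mu> = push_forward (\<lambda>y. c *\<^sub>R R y + z) \<rho>"
      by (auto simp: similarities_def)
    interpret similarity c R z by unfold_locales (use c in auto)
    have \<mu>S: "\<mu> = push_forward S \<rho>" using \<mu> by (simp add: S_def[abs_def])
    note push = signed_integral_push_forward[OF \<rho>(1) S_borel T_borel T_S S_T borel_measurable_continuous_onI, folded \<mu>S]
    have "\<bar>signed_integral \<mu> u\<bar> = \<bar>signed_integral \<rho> (\<lambda>x. u (S x))\<bar>"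
      using push[OF D1p_continuous[OF u assms(1)]] by simp
    also have "\<dots> \<le> \<kappa> * Lp_norm p (weak_grad (\<lambda>x. u (S x)))"
      unfolding \<kappa>_def using D1p_S(1)[OF _ u] p1 by (intro has_divergence_bound[OF pq F]) auto
    also have "Lp_norm p (weak_grad (\<lambda>x. u (S x))) = c powr \<alpha> * Lp_norm p (weak_grad u)"
      unfolding \<alpha>_def using D1p_S(2)[OF _ u] p1 by simp
    finally have le: "\<bar>signed_integral \<mu> u\<bar> \<le> \<kappa> * (c powr \<alpha> * Lp_norm p (weak_grad u))" .
    have "norm (signed_integral \<mu> (\<lambda>x. x)) = c * norm (signed_integral \<rho> (\<lambda>y. y))"
      using push[of "\<lambda>x. x"] signed_integral_S[OF \<rho>(1-3)] by simp
    then have den: "norm (signed_integral \<mu> (\<lambda>x. x)) powr \<alpha> = c powr \<alpha> * M"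
      by (simp add: M_def powr_mult)
    have "\<bar>signed_integral \<mu> u\<bar> / (c powr \<alpha> * M) \<le> \<kappa> * (c powr \<alpha> * Lp_norm p (weak_grad u)) / (c powr \<alpha> * M)"
      using le M by (intro divide_right_mono) auto
    also have "\<dots> = \<kappa> / M * Lp_norm p (weak_grad u)" using c by simp
    finally show "ereal (\<bar>signed_integral \<mu> u\<bar> / norm (signed_integral \<mu> (\<lambda>x. x)) powr (1 - real CARD('n) / p))
      \<le> ereal (\<kappa> / M * Lp_norm p (weak_grad u))"
      unfolding \<alpha>_def[symmetric] den by simp
  qed
  \<comment> \<open>The identity similarity already forces the constant: its quotient shows that
    \<open>C' * M\<close> is admissible for the functional, and \<open>best\<close> gives the
    rest.\<close>
  have lower: "\<kappa> / M \<le> C'" if C': "morrey_inequality p \<rho> C'" for C'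
  proof -
    have "\<bar>signed_integral \<rho> u\<bar> \<le> (C' * M) * Lp_norm p (weak_grad u)" if u: "u \<in> D1p p" for u
    proof -
      have "\<rho> \<in> {push_forward S \<rho> |S. S \<in> similarities}"
        using id_similarity by (intro CollectI exI[of _ "\<lambda>y. y"]) (auto simp: push_forward_def)
      then have "ereal (\<bar>signed_integral \<rho> u\<bar> / M) \<le> morrey_seminorm p \<rho> u"
        unfolding morrey_seminorm_def M_def \<alpha>_def by (rule SUP_upper)
      also have "\<dots> \<le> ereal (C' * Lp_norm p (weak_grad u))"
        using C' u by (simp add: morrey_inequality_def)
      finally show ?thesis using M by (simp add: field_simps)
    qed
    then have "\<kappa> \<le> C' * M" unfolding \<kappa>_def by (rule best)
    then show ?thesis using M by (simp add: divide_le_eq)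
  qed
  have "best_morrey_constant p \<rho> (\<kappa> / M)"
    using upper lower by (simp add: best_morrey_constant_def)
  moreover have "ereal (\<kappa> / M) = ereal \<kappa> / ereal M" using M by simp
  ultimately show ?thesis using inf unfolding M_def \<alpha>_def by (intro exI[of _ "\<kappa> / M"]) (simp add: M_def \<alpha>_def)
qed

end
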